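(* Let $n\ge 0$. The characteristic polynomial (in the variable $x$) of the Coxeter transformation $\theta$ of the Tamari poset $\mathsf{Y}_n$ is $$\frac{(x^{2n+2}-1)^{c_n}}{\left(\prod_{d\mid 2n+2}\bigl(x^d-(-1)^{d(n+1)}\bigr)^{b_d}\right)^{(-1)^{n+1}}}.$$
   Context: $\mathsf{Y}_n$ is the set of planar binary trees with $n$ internal (trivalent) vertices. A planar binary tree is either the trivial tree $|$ or a pair $(x,y)$ of planar binary trees (left and right subtrees at the root vertex). The Tamari order on $\mathsf{Y}_n$: $x\le y$ if one can pass from $y$ to $x$ by a (possibly empty) sequence of local moves replacing a subtree of the form $(A,(B,C))$ (right edge) by $((A,B),C)$ (left edge). $\operatorname{mod}\mathsf{Y}_n$ is the category of finite-dimensional modules (over a fixed field) over the Hasse diagram of $\mathsf{Y}_n$ viewed as a quiver oriented from maximum to minimum with all commutativity relations. Its Grothendieck group $K_0(\operatorname{mod}\mathsf{Y}_n)$ is free abelian with bases given by the classes of simples $S_x$, projectives $P_x=\sum_{y\le x}S_y$ and injectives $I_x=\sum_{y\ge x}S_y$, for $x\in\mathsf{Y}_n$. The Coxeter transformation $\theta$ is the endomorphism of $K_0(\operatorname{mod}\mathsf{Y}_n)$ defined by $\theta(P_x)=-I_x$ for all $x\in\mathsf{Y}_n$. Numbers: $c_n=\frac{1}{n+1}\binom{2n}{n}$; for $m\ge 1$, $\lambda(m)=(-1)^{\binom{m}{2}}\binom{m-1}{\lfloor (m-1)/2\rfloor}$ and $b_m=\frac1m\sum_{d\mid m}\mu(d)\lambda(m/d)$,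 where $\mu$ is the Möbius function (the $b_m$ are integers, possibly negative). *)

theory Defs
  imports
    "HOL-Algebra.Free_Abelian_Groups"
    "HOL-Computational_Algebra.Computational_Algebra"
    "Jordan_Normal_Form.Char_Poly"
    "Jordan_Normal_Form.Matrix_Kernel"
begin

section \<open>Planar binary trees and the Tamari order\<close>

datatype pbtree = Triv | Graft pbtree pbtree

fun internal :: "pbtree \<Rightarrow> nat" where
  "internal Triv = 0"
| "internal (Graft l r) = Suc (internal l + internal r)"

definition Yset :: "nat \<Rightarrow> pbtree set" where
  "Yset n = {t. internal t = n}"

inductive tamari_move :: "pbtree \<Rightarrow> pbtree \<Rightarrow> bool" where
  root: "tamari_move (Graft A (Graft B C)) (Graft (Graft A B) C)"
| left: "tamari_move l l' \<Longrightarrow> tamari_move (Graft l r) (Graft l' r)"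
| right: "tamari_move r r' \<Longrightarrow> tamari_move (Graft l r) (Graft l r')"

text \<open>A move goes down, so the smaller tree is the one that is reached.\<close>

definition tamari_le :: "pbtree \<Rightarrow> pbtree \<Rightarrow> bool" where
  "tamari_le x y \<longleftrightarrow> tamari_move\<^sup>*\<^sup>* y x"

section \<open>Modules over the Hasse diagram of a poset\<close>

text \<open>
  A finite poset is given by its underlying set \<open>V\<close> and its order \<open>leq\<close>. A finite-dimensional
  module over its Hasse diagram (arrows from larger to smaller elements, all commutativity
  relations) is a representation of this quiver on coordinate spaces: the space at \<open>x\<close> is
  \<open>carrier_vec (qdim M x)\<close>, and an arrow from \<open>x\<close> to \<open>y\<close> acts by the matrix \<open>qmap M x y\<close>. Every
  finite-dimensional module is isomorphic to one of this form. The values of \<open>qdim\<close> outside \<open>V\<close>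
  and of \<open>qmap\<close> outside the arrows are irrelevant; representations which differ only there are
  isomorphic.
\<close>

definition hasse_arrow :: "'v set \<Rightarrow> ('v \<Rightarrow> 'v \<Rightarrow> bool) \<Rightarrow> 'v \<Rightarrow> 'v \<Rightarrow> bool" where
  "hasse_arrow V leq x y \<longleftrightarrow> x \<in> V \<and> y \<in> V \<and> leq y x \<and> y \<noteq> x \<and>
     (\<forall>z\<in>V. leq y z \<and> leq z x \<longrightarrow> z = y \<or> z = x)"

datatype ('v, 'k) qrep = QRep (qdim: "'v \<Rightarrow> nat") (qmap: "'v \<Rightarrow> 'v \<Rightarrow> 'k mat")

fun hasse_path :: "'v set \<Rightarrow> ('v \<Rightarrow> 'v \<Rightarrow> bool) \<Rightarrow> 'v list \<Rightarrow> bool" where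
  "hasse_path V leq [] \<longleftrightarrow> False"
| "hasse_path V leq [x] \<longleftrightarrow> x \<in> V"
| "hasse_path V leq (x # y # p) \<longleftrightarrow> hasse_arrow V leq x y \<and> hasse_path V leq (y # p)"

fun path_map :: "('v, 'k::field) qrep \<Rightarrow> 'v list \<Rightarrow> 'k mat" where
  "path_map M [] = 1\<^sub>m 0"
| "path_map M [x] = 1\<^sub>m (qdim M x)"
| "path_map M (x # y # p) = path_map M (y # p) * qmap M x y"

definition hasse_module :: "'v set \<Rightarrow> ('v \<Rightarrow> 'v \<Rightarrow> bool) \<Rightarrow> ('v, 'k::field) qrep \<Rightarrow> bool" where
  "hasse_module V leq M \<longleftrightarrow>
     (\<forall>x y. hasse_arrow V leq x y \<longrightarrow> qmap M x y \<in> carrier_mat (qdim M y) (qdim M x)) \<and>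
     (\<forall>p q. hasse_path V leq p \<and> hasse_path V leq q \<and> hd p = hd q \<and> last p = last q \<longrightarrow>
        path_map M p = path_map M q)"

definition module_hom ::
  "'v set \<Rightarrow> ('v \<Rightarrow> 'v \<Rightarrow> bool) \<Rightarrow> ('v, 'k::field) qrep \<Rightarrow> ('v, 'k) qrep \<Rightarrow> ('v \<Rightarrow> 'k mat) \<Rightarrow> bool"
  where
  "module_hom V leq M N f \<longleftrightarrow>
     (\<forall>x\<in>V. f x \<in> carrier_mat (qdim N x) (qdim M x)) \<and>
     (\<forall>x y. hasse_arrow V leq x y \<longrightarrow> f y * qmap M x y = qmap N x y * f x)"

definition short_exact ::
  "'v set \<Rightarrow> ('v \<Rightarrow> 'v \<Rightarrow> bool) \<Rightarrow> ('v, 'k::field) qrep \<Rightarrow> ('v, 'k) qrep \<Rightarrow> ('v, 'k) qrep \<Rightarrow> bool"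
  where
  "short_exact V leq L M N \<longleftrightarrow>
     hasse_module V leq L \<and> hasse_module V leq M \<and> hasse_module V leq N \<and>
     (\<exists>f g. module_hom V leq L M f \<and> module_hom V leq M N g \<and>
        (\<forall>x\<in>V. inj_on ((*\<^sub>v) (f x)) (carrier_vec (qdim L x)) \<and>
               ((*\<^sub>v) (f x)) ` carrier_vec (qdim L x) = mat_kernel (g x) \<and>
               ((*\<^sub>v) (g x)) ` carrier_vec (qdim M x) = carrier_vec (qdim N x)))"

section \<open>The Grothendieck group\<close>

definition free_on_modules ::
  "'v set \<Rightarrow> ('v \<Rightarrow> 'v \<Rightarrow> bool) \<Rightarrow> (('v, 'k::field) qrep \<Rightarrow>\<^sub>0 int) monoid" where
  "free_on_modules V leq = free_Abelian_group {M. hasse_module V leq M}"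

definition exact_relations ::
  "'v set \<Rightarrow> ('v \<Rightarrow> 'v \<Rightarrow> bool) \<Rightarrow> (('v, 'k::field) qrep \<Rightarrow>\<^sub>0 int) set" where
  "exact_relations V leq =
     generate (free_on_modules V leq)
       {frag_of M - frag_of L - frag_of N | L M N. short_exact V leq L M N}"

type_synonym ('v, 'k) qrep_K0 = "(('v, 'k) qrep \<Rightarrow>\<^sub>0 int) set"

text \<open>The group is written multiplicatively, as always in \<open>HOL-Algebra\<close>.\<close>

definition K0 ::
  "'v set \<Rightarrow> ('v \<Rightarrow> 'v \<Rightarrow> bool) \<Rightarrow> ('v, 'k::field) qrep_K0 monoid" where
  "K0 V leq = free_on_modules V leq Mod exact_relations V leq"

definition K0_class ::
  "'v set \<Rightarrow> ('v \<Rightarrow> 'v \<Rightarrow> bool) \<Rightarrow> ('v, 'k::field) qrep \<Rightarrow> ('v, 'k) qrep_K0" where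
  "K0_class V leq M = exact_relations V leq #>\<^bsub>free_on_modules V leq\<^esub> frag_of M"

section \<open>Projectives, injectives and the Coxeter transformation\<close>

text \<open>
  The representation with a line at each element of \<open>U\<close> and identities between them. It is the
  simple module at \<open>x\<close> for \<open>U = {x}\<close>, the indecomposable projective at \<open>x\<close> (spanned by the paths
  starting at \<open>x\<close>) for \<open>U = {y. y \<le> x}\<close>, and the indecomposable injective at \<open>x\<close> for
  \<open>U = {y. y \<ge> x}\<close>.
\<close>

definition thin_module :: "'v set \<Rightarrow> ('v, 'k::field) qrep" where
  "thin_module U =
     (let d = (\<lambda>x. if x \<in> U then 1 else 0)
      in QRep d (\<lambda>x y. if x \<in> U \<and> y \<in> U then 1\<^sub>m 1 else 0\<^sub>m (d y) (d x)))"

definition projective_module :: "'v set \<Rightarrow> ('v \<Rightarrow> 'v \<Rightarrow> bool) \<Rightarrow> 'v \<Rightarrow> ('v, 'k::field) qrep" where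
  "projective_module V leq x = thin_module {y \<in> V. leq y x}"

definition injective_module :: "'v set \<Rightarrow> ('v \<Rightarrow> 'v \<Rightarrow> bool) \<Rightarrow> 'v \<Rightarrow> ('v, 'k::field) qrep" where
  "injective_module V leq x = thin_module {y \<in> V. leq x y}"

text \<open>Extensionality on the carrier makes the endomorphism unique as a total function.\<close>

definition coxeter_transformation ::
  "'v set \<Rightarrow> ('v \<Rightarrow> 'v \<Rightarrow> bool) \<Rightarrow>
     ('v, 'k::field) qrep_K0 \<Rightarrow> ('v, 'k) qrep_K0" where
  "coxeter_transformation V leq =
     (THE \<theta>. \<theta> \<in> hom (K0 V leq) (K0 V leq) \<and> \<theta> \<in> extensional (carrier (K0 V leq)) \<and>
        (\<forall>x\<in>V. \<theta> (K0_class V leq (projective_module V leq x)) =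
                 inv\<^bsub>K0 V leq\<^esub> K0_class V leq (injective_module V leq x)))"

section \<open>Characteristic polynomial of an endomorphism of a free abelian group\<close>

definition int_basis :: "('a, 'b) monoid_scheme \<Rightarrow> 'a list \<Rightarrow> bool" where
  "int_basis G bs \<longleftrightarrow> set bs \<subseteq> carrier G \<and>
     (\<forall>g\<in>carrier G. \<exists>!a. a \<in> carrier_vec (length bs) \<and>
        g = finprod G (\<lambda>i. (bs ! i) [^]\<^bsub>G\<^esub> (a $ i :: int)) {..<length bs})"

definition matrix_of_endo ::
  "('a, 'b) monoid_scheme \<Rightarrow> 'a list \<Rightarrow> ('a \<Rightarrow> 'a) \<Rightarrow> int mat \<Rightarrow> bool" where
  "matrix_of_endo G bs \<phi> A \<longleftrightarrow> A \<in> carrier_mat (length bs) (length bs) \<and>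
     (\<forall>j<length bs. \<phi> (bs ! j) =
        finprod G (\<lambda>i. (bs ! i) [^]\<^bsub>G\<^esub> (A $$ (i, j))) {..<length bs})"

text \<open>The description is over all bases, so it includes independence of the basis.\<close>

definition endo_char_poly :: "('a, 'b) monoid_scheme \<Rightarrow> ('a \<Rightarrow> 'a) \<Rightarrow> int poly" where
  "endo_char_poly G \<phi> =
     (THE p. \<exists>bs A. int_basis G bs \<and> matrix_of_endo G bs \<phi> A \<and> p = char_poly A)"

section \<open>Numbers\<close>

definition catalan :: "nat \<Rightarrow> nat" where
  "catalan n = ((2 * n) choose n) div (n + 1)"

definition moebius :: "nat \<Rightarrow> int" where
  "moebius n = (if squarefree n then (- 1) ^ card (prime_factors n) else 0)"

definition lam :: "nat \<Rightarrow> int" where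
  "lam m = (- 1) ^ (m choose 2) * int ((m - 1) choose ((m - 1) div 2))"

text \<open>The division is exact.\<close>

definition bnum :: "nat \<Rightarrow> int" where
  "bnum m = (\<Sum>d | d dvd m. moebius d * lam (m div d)) div int m"

end

theory Submission
  imports Defs "Jordan_Normal_Form.Schur_Decomposition"
begin

text \<open>
  A tree is encoded by its Dyck word \<open>o l c r\<close> in the free ring on an opener \<open>o\<close> and a closer \<open>c\<close>
  (\<open>True\<close> and \<open>False\<close> in lists). Let \<open>d\<close> be the derivation with \<open>d o = 0\<close> and \<open>d c = o\<close>, twisted by the
  automorphism \<open>o \<mapsto> - o\<close>, and let \<open>\<sigma> (o x c y) = - d (x c) y c\<close> on the span of the Dyck words with \<open>n\<close>
  openers. There are Dyck-span elements \<open>e y\<close> and \<open>u y\<close> for the trees \<open>y\<close>, with \<open>e y\<close> equal to \<open>\<sigma> (u y)\<close> up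
  to the sign \<open>(-1)^n\<close>, such that the sum of \<open>e y\<close> over \<open>y \<le> x\<close> agrees with the sum of \<open>u y\<close> over
  \<open>y \<ge> x\<close>. As the \<open>u y\<close> form a basis, \<open>\<theta>\<close> is conjugate to \<open>(-1)^(n+1) \<sigma>\<close>.

  The map \<open>\<sigma>\<close> behaves like a rotation of order \<open>2 n + 2\<close>. Signed rotation of all words of length
  \<open>2 n + 2\<close> commutes with \<open>d\<close>, and modulo the image of \<open>d\<close> the words with \<open>n\<close> openers decompose into
  \<open>2 n + 1\<close> shifted copies of the Dyck span; since \<open>d\<close> is exact, traces of powers of \<open>\<sigma>\<close> become
  alternating sums of traces of rotations on words, which only see words fixed by a rotation. This gives
  \<open>tr \<theta>^k\<close> as \<open>(2 n + 2) c_n\<close> (if \<open>2 n + 2\<close> divides \<open>k\<close>, else \<open>0\<close>) plus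
  \<open>(-1)^n (-1)^(k (n+1)) \<lambda>(gcd k (2 n + 2))\<close>, and the power sums determine the eigenvalues by Moebius
  inversion.

  On the side of modules, dimension vectors are coordinates on the Grothendieck group, because a simple
  module at a minimal element of the support splits off as a submodule.
\<close>

section \<open>The free ring on an opener and a closer\<close>

text \<open>In the Dyck basis \<open>rot\<close> of a tree is in general a signed sum of several
  trees, so its traces are not counts of fixed trees. On words, rotation is a signed permutation.
  The period \<open>2 * n + 2\<close> of \<open>rot\<close> only makes the eigenvalues roots of
  unity; their multiplicities need the traces of all powers.

  The hinge between trees and words is \<open>rot_ternary\<close>. It yields the period of
  \<open>rot\<close>, and it says that the map from words to the Dyck span built from
  \<open>rot\<close> vanishes on the image of \<open>der\<close>.

  There are \<open>2 * n + 2\<close> shifts of the Dyck span among the words but only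
  \<open>2 * n + 1\<close> independent ones: modulo the image of \<open>der\<close>, the last shift
  is an alternating combination of the others, twisted by powers of \<open>rot\<close>. This single
  relation produces the only diagonal block that survives in the trace of a proper rotation.

  The integrality of the numbers \<open>bnum d\<close> for \<open>d\<close> dividing
  \<open>2 * n + 2\<close> is not taken for granted: it is extracted from the fact that root
  multiplicities are integers.\<close>

instantiation list :: (type) monoid_add
begin
definition zero_list :: "'a list" where "zero_list = []"
definition plus_list :: "'a list \<Rightarrow> 'a list \<Rightarrow> 'a list" where "plus_list = (@)"
instance by standard (simp_all add: zero_list_def plus_list_def)
end

text \<open>\<open>poly_mapping\<close> multiplies by convolution over the addition of its index
  type. With concatenation as addition, this is the monoid ring of words, that is, noncommutative
  polynomials in two letters.\<close>

type_synonym walg = "bool list \<Rightarrow>\<^sub>0 int"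

lemma frag_of_mult: "frag_of v * frag_of w = frag_of (v @ w)"
  by (simp add: mult_single plus_list_def)

lemma frag_of_Nil: "frag_of [] = 1"
  by (metis single_one zero_list_def)

definition opn :: walg where "opn = frag_of [True]"
definition cls :: walg where "cls = frag_of [False]"

lemma frag_of_Cons: "frag_of (b # w) = (if b then opn else cls) * frag_of w"
  by (cases b) (simp_all add: opn_def cls_def frag_of_mult)

lemma frag_additive_eqI:
  assumes "Poly_Mapping.keys x \<subseteq> S"
    and "\<And>x y. f (x - y) = f x - f y" "\<And>x y. g (x - y) = g x - g y"
    and "\<And>a. a \<in> S \<Longrightarrow> f (frag_of a) = g (frag_of a)"
  shows "f x = (g x :: 'b::ab_group_add)"
proof -
  have "f 0 = 0" "g 0 = 0" using assms(2,3)[of 0 0] by simp_all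
  with assms show ?thesis
    by (induction x rule: frag_induction) auto
qed

lemma frag_biadditive_eqI:
  assumes "\<And>x y z. f (x - y) z = f x z - f y z" "\<And>x y z. f z (x - y) = f z x - f z y"
    and "\<And>x y z. g (x - y) z = g x z - g y z" "\<And>x y z. g z (x - y) = g z x - g z y"
    and "Poly_Mapping.keys x \<subseteq> S" "Poly_Mapping.keys y \<subseteq> T"
    and "\<And>a b. a \<in> S \<Longrightarrow> b \<in> T \<Longrightarrow> f (frag_of a) (frag_of b) = g (frag_of a) (frag_of b)"
  shows "f x y = (g x y :: 'b::ab_group_add)"
  by (rule frag_additive_eqI[of x S "\<lambda>x. f x y" "\<lambda>x. g x y"])
    (use assms in \<open>auto intro: frag_additive_eqI[of y T "f _" "g _"]\<close>)

definition sgnaut :: "walg \<Rightarrow> walg" where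
  "sgnaut = frag_extend (\<lambda>w. (-1) ^ count_list w True * frag_of w)"

text \<open>An opener has odd degree and a closer even degree; the sign in the opener branch is the
  Koszul sign for moving the derivation past it.\<close>

fun derw :: "bool list \<Rightarrow> walg" where
  "derw [] = 0"
| "derw (b # w) = (if b then - (opn * derw w) else opn * frag_of w + cls * derw w)"

definition der :: "walg \<Rightarrow> walg" where
  "der = frag_extend derw"

lemma sgnaut_linear [simp]: "sgnaut 0 = 0" "sgnaut (x + y) = sgnaut x + sgnaut y"
  "sgnaut (x - y) = sgnaut x - sgnaut y" "sgnaut (- x) = - sgnaut x"
  by (simp_all add: sgnaut_def frag_extend_add frag_extend_diff frag_extend_minus)

lemma der_linear [simp]: "der 0 = 0" "der (x + y) = der x + der y"
  "der (x - y) = der x - der y" "der (- x) = - der x"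
  by (simp_all add: der_def frag_extend_add frag_extend_diff frag_extend_minus)

lemma sgnaut_frag_of: "sgnaut (frag_of w) = (-1) ^ count_list w True * frag_of w"
  by (simp add: sgnaut_def)

lemma sgnaut_mult [simp]: "sgnaut (x * y) = sgnaut x * sgnaut y"
proof (rule frag_biadditive_eqI[where x = x and y = y and S = UNIV and T = UNIV])
  fix v w :: "bool list"
  show "sgnaut (frag_of v * frag_of w) = sgnaut (frag_of v) * sgnaut (frag_of w)"
    by (cases "even (count_list v True)"; cases "even (count_list w True)")
      (simp_all add: frag_of_mult sgnaut_frag_of)
qed (simp_all add: algebra_simps)

lemma sgnaut_1 [simp]: "sgnaut 1 = 1" "sgnaut opn = - opn" "sgnaut cls = cls"
  by (simp_all add: frag_of_Nil[symmetric] sgnaut_def opn_def cls_def) (simp_all add: frag_of_Nil)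

lemma der_Cons: "der (opn * x) = - (opn * der x)" "der (cls * x) = opn * x + cls * der x"
proof -
  show "der (opn * x) = - (opn * der x)"
    by (rule frag_additive_eqI[where S = UNIV])
      (auto simp: algebra_simps opn_def frag_of_mult der_def frag_extend_diff)
  show "der (cls * x) = opn * x + cls * der x"
    by (rule frag_additive_eqI[where S = UNIV])
      (auto simp: algebra_simps cls_def frag_of_mult der_def frag_extend_diff)
qed

lemma der_1 [simp]: "der 1 = 0" "der opn = 0" "der cls = opn"
proof -
  show "der 1 = 0" by (simp add: der_def frag_of_Nil[symmetric])
  then show "der opn = 0" "der cls = opn" using der_Cons[of 1] by simp_all
qed

lemma der_mult: "der (x * y) = der x * y + sgnaut x * der y"
proof (rule frag_biadditive_eqI[where x = x and y = y and S = UNIV and T = UNIV])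
  fix v w :: "bool list"
  show "der (frag_of v * frag_of w) = der (frag_of v) * frag_of w + sgnaut (frag_of v) * der (frag_of w)"
    by (induction v) (simp_all add: frag_of_Nil frag_of_Cons mult.assoc der_Cons algebra_simps)
qed (simp_all add: algebra_simps)

lemma sgnaut_sgnaut [simp]: "sgnaut (sgnaut x) = x"
proof (rule frag_additive_eqI[where S = UNIV])
  fix w :: "bool list"
  show "sgnaut (sgnaut (frag_of w)) = frag_of w"
    by (induction w) (simp_all add: frag_of_Nil frag_of_Cons)
qed simp_all

lemma sgnaut_der: "sgnaut (der x) = - der (sgnaut x)"
proof (rule frag_additive_eqI[where x = x and S = UNIV])
  fix w :: "bool list"
  show "sgnaut (der (frag_of w)) = - der (sgnaut (frag_of w))"
    by (induction w) (simp_all add: frag_of_Nil frag_of_Cons der_Cons algebra_simps)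
qed simp_all

text \<open>Two closers can be opened in either order, and the one further right sees one opener
  more or less, so the two orders cancel.\<close>

lemma der_der [simp]: "der (der x) = 0"
proof (rule frag_additive_eqI[where x = x and S = UNIV])
  fix w :: "bool list"
  show "der (der (frag_of w)) = 0"
    by (induction w) (simp_all add: frag_of_Nil frag_of_Cons der_Cons algebra_simps)
qed simp_all

section \<open>Dyck words and the Dyck span\<close>

fun dyck :: "pbtree \<Rightarrow> bool list" where
  "dyck Triv = []"
| "dyck (Graft l r) = True # dyck l @ False # dyck r"

text \<open>The closer behind a Dyck word is the first unmatched one, so it marks where the word
  ends. Unique parsing of all products of trees below rests on this.\<close>

lemma dyck_prefix: "dyck s @ False # u = dyck t @ False # v \<Longrightarrow> s = t \<and> u = v"
proof (induction s arbitrary: t u v)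
  case Triv then show ?case by (cases t) auto
next
  case (Graft l r)
  from Graft.prems obtain l' r' where t: "t = Graft l' r'" by (cases t) auto
  have "dyck l @ False # dyck r @ False # u = dyck l' @ False # dyck r' @ False # v"
    using Graft.prems t by simp
  then show ?case using Graft.IH t by blast
qed

lemma inj_dyck: "inj dyck"
  by (rule injI) (metis dyck_prefix)

definition dy :: "pbtree \<Rightarrow> walg" where "dy t = frag_of (dyck t)"

lemma dy_simps: "dy Triv = 1" "dy (Graft l r) = opn * dy l * cls * dy r"
proof -
  show "dy Triv = 1" by (simp add: dy_def frag_of_Nil)
  have "dy (Graft l r) = frag_of (True # dyck l) * frag_of (False # dyck r)"
    by (simp only: dy_def dyck.simps frag_of_mult append_Cons)
  then show "dy (Graft l r) = opn * dy l * cls * dy r"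
    by (simp add: dy_def frag_of_Cons mult.assoc)
qed

definition dyck_span :: "nat \<Rightarrow> walg set" where
  "dyck_span n = {x. Poly_Mapping.keys x \<subseteq> dyck ` Yset n}"

lemma dyck_span_closed:
  "0 \<in> dyck_span n" "x \<in> dyck_span n \<Longrightarrow> y \<in> dyck_span n \<Longrightarrow> x - y \<in> dyck_span n"
  "x \<in> dyck_span n \<Longrightarrow> y \<in> dyck_span n \<Longrightarrow> x + y \<in> dyck_span n"
  "x \<in> dyck_span n \<Longrightarrow> - x \<in> dyck_span n"
  using keys_diff[of x y] keys_add[of x y] by (auto simp: dyck_span_def)

lemma dyck_span_sign: "x \<in> dyck_span n \<Longrightarrow> (-1) ^ k * x \<in> dyck_span n"
  by (cases "even k") (auto simp: dyck_span_closed)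

lemma dyck_span_sum: "(\<And>i. i \<in> A \<Longrightarrow> f i \<in> dyck_span n) \<Longrightarrow> sum f A \<in> dyck_span n"
  by (induction A rule: infinite_finite_induct) (auto intro: dyck_span_closed)

lemma dy_in_span: "internal t = n \<Longrightarrow> dy t \<in> dyck_span n"
  by (auto simp: dy_def dyck_span_def Yset_def keys_frag_of)

lemma dyck_span_induct [consumes 1, case_names zero tree diff]:
  assumes "x \<in> dyck_span n" "P 0" "\<And>t. internal t = n \<Longrightarrow> P (dy t)"
    "\<And>x y. P x \<Longrightarrow> P y \<Longrightarrow> P (x - y)"
  shows "P x"
  using assms(1) unfolding dyck_span_def mem_Collect_eq
  by (induction x rule: frag_induction) (use assms in \<open>auto simp: Yset_def dy_def\<close>)

lemma one_in_span: "1 \<in> dyck_span 0"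
  using dy_in_span[of Triv 0] by (simp add: dy_simps)

lemma graft_in_span:
  assumes "x \<in> dyck_span a" "y \<in> dyck_span b"
  shows "opn * x * cls * y \<in> dyck_span (Suc (a + b))"
  using assms(1)
proof (induction x rule: dyck_span_induct)
  case (tree t)
  show ?case using assms(2)
  proof (induction y rule: dyck_span_induct)
    case (tree u)
    then show ?case using \<open>internal t = a\<close> dy_in_span[of "Graft t u"] by (simp add: dy_simps)
  qed (auto simp: algebra_simps intro: dyck_span_closed)
qed (auto simp: algebra_simps intro: dyck_span_closed)

lemma sgnaut_span: "x \<in> dyck_span n \<Longrightarrow> sgnaut x = (-1) ^ n * x"
proof (induction x rule: dyck_span_induct)
  case (tree t)
  have "sgnaut (dy t) = (-1) ^ internal t * dy t" for t
  proof (induction t)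
    case (Graft l r)
    then show ?case
      by (cases "even (internal l)"; cases "even (internal r)") (auto simp: dy_simps)
  qed (simp add: dy_simps)
  then show ?case using tree by simp
qed (auto simp: algebra_simps)

text \<open>The path of \<open>x c y c z\<close> stays nonnegative up to the end of \<open>x\<close>
  and never goes below -2. Opening a closer of \<open>x c\<close> lifts everything from there on by
  two, so every word that occurs is again Dyck.\<close>

lemma ternary_in_span:
  assumes "x \<in> dyck_span a" "y \<in> dyck_span b" "z \<in> dyck_span c"
  shows "der (x * cls) * y * cls * z \<in> dyck_span (Suc (a + b + c))"
proof -
  have "der (dy t * cls) * y * cls * z \<in> dyck_span (Suc (internal t + b + c))"
    if "y \<in> dyck_span b" "z \<in> dyck_span c" for t b c y z
    using that
  proof (induction t arbitrary: b c y z)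
    case Triv then show ?case using graft_in_span by (simp add: dy_simps)
  next
    case (Graft l r)
    \<comment> \<open>The opened closer lies either in \<open>l c\<close>, which is followed by
      \<open>r c y\<close>, or in \<open>r c\<close>, which is followed by \<open>y c z\<close>.
      Hence \<open>y\<close> and \<open>z\<close> vary in the induction.\<close>
    have 1: "der (dy l * cls) * dy r * cls * y \<in> dyck_span (Suc (internal l + internal r + b))"
      by (intro Graft.IH dy_in_span Graft.prems refl)
    have 2: "der (dy r * cls) * y * cls * z \<in> dyck_span (Suc (internal r + b + c))"
      by (intro Graft.IH Graft.prems)
    have h1: "- (opn * (der (dy l * cls) * dy r * cls * y) * cls * z) \<in>
        dyck_span (Suc (Suc (internal l + internal r + b) + c))"
      by (intro dyck_span_closed graft_in_span 1 Graft.prems)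
    have h2: "(-1) ^ internal l * (opn * dy l * cls * (der (dy r * cls) * y * cls * z)) \<in>
        dyck_span (Suc (internal l + Suc (internal r + b + c)))"
      by (intro dyck_span_sign graft_in_span 2 dy_in_span refl)
    have h3: "der (dy (Graft l r) * cls) * y * cls * z =
       - (opn * (der (dy l * cls) * dy r * cls * y) * cls * z) -
       (-1) ^ internal l * (opn * dy l * cls * (der (dy r * cls) * y * cls * z))"
    proof -
      have "dy (Graft l r) * cls = opn * ((dy l * cls) * (dy r * cls))"
        by (simp add: dy_simps mult.assoc)
      then have D: "der (dy (Graft l r) * cls) =
         - (opn * (der (dy l * cls) * (dy r * cls) + sgnaut (dy l) * cls * der (dy r * cls)))"
        by (simp only: der_Cons der_mult[of "dy l * cls" "dy r * cls"] sgnaut_mult sgnaut_1)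
      show ?thesis unfolding D
        by (cases "even (internal l)") (simp_all add: sgnaut_span[OF dy_in_span] algebra_simps)
    qed
    show ?case unfolding h3
      by (rule dyck_span_closed) (use h1 h2 in \<open>simp_all add: ac_simps\<close>)
  qed
  from assms(1) this[OF assms(2,3)] show ?thesis
    by (induction x rule: dyck_span_induct) (auto simp: algebra_simps intro: dyck_span_closed)
qed

section \<open>The twisted rotation and its period\<close>

fun rottree :: "pbtree \<Rightarrow> walg" where
  "rottree Triv = 1"
| "rottree (Graft l r) = - (der (dy l * cls) * dy r * cls)"

text \<open>The formula needs the root decomposition, so it is given on trees and carried to words
  by inverting the injective \<open>dyck\<close>; 0 is the default on other words.\<close>

definition rot :: "walg \<Rightarrow> walg" where
  "rot = frag_extend (\<lambda>w. if w \<in> range dyck then rottree (inv_into UNIV dyck w) else 0)"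

lemma rot_linear [simp]: "rot 0 = 0" "rot (x + y) = rot x + rot y"
  "rot (x - y) = rot x - rot y" "rot (- x) = - rot x"
  by (simp_all add: rot_def frag_extend_add frag_extend_diff frag_extend_minus)

lemma rot_sign: "rot ((-1) ^ k * x) = (-1) ^ k * rot x"
  by (cases "even k") auto

lemma rot_sum: "rot (sum f A) = (\<Sum>i\<in>A. rot (f i))"
  by (induction A rule: infinite_finite_induct) auto

lemma der_sum: "der (sum f A) = (\<Sum>i\<in>A. der (f i))"
  by (induction A rule: infinite_finite_induct) auto

lemma rot_dy [simp]: "rot (dy t) = rottree t"
  by (simp add: rot_def dy_def inj_dyck)

lemma rot_1 [simp]: "rot 1 = 1"
  using rot_dy[of Triv] by (simp add: dy_simps)

lemma rot_graft:
  assumes "x \<in> dyck_span a" "y \<in> dyck_span b"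
  shows "rot (opn * x * cls * y) = - (der (x * cls) * y * cls)"
  using assms(1)
proof (induction x rule: dyck_span_induct)
  case (tree t)
  show ?case using assms(2)
  proof (induction y rule: dyck_span_induct)
    case (tree u)
    show ?case using rot_dy[of "Graft t u"] by (simp add: dy_simps)
  qed (auto simp: algebra_simps)
qed (auto simp: algebra_simps)

lemma rot_in_span: "x \<in> dyck_span n \<Longrightarrow> rot x \<in> dyck_span n"
proof (induction x rule: dyck_span_induct)
  case (tree t)
  show ?case
  proof (cases t)
    case Triv then show ?thesis using tree one_in_span by simp
  next
    case (Graft l r)
    then show ?thesis
      using tree ternary_in_span[of "dy l" "internal l" "dy r" "internal r" 1 0]
      by (auto intro!: dyck_span_closed simp: dy_in_span one_in_span)
  qed
qed (auto intro: dyck_span_closed)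

text \<open>Rotation passes the derivation from the first tree to the second. For
  \<open>a = 1\<close> this is the formula for \<open>rot\<close>, as \<open>der cls = opn\<close>.
  For a graft with parts \<open>A\<close> and \<open>B\<close> the Leibniz rule expands both sides:
  \<open>der_der\<close> removes the iterated derivative of \<open>A c\<close>, and the terms with
  \<open>der (B c)\<close> cancel.\<close>

lemma rot_ternary:
  assumes "a \<in> dyck_span i" "b \<in> dyck_span j" "d \<in> dyck_span l"
  shows "rot (der (a * cls) * b * cls * d) = - (rot (sgnaut a) * der (b * cls) * d * cls)"
  using assms(1)
proof (induction a rule: dyck_span_induct)
  case (tree t)
  show ?case
  proof (cases t)
    case Triv
    then show ?thesis using assms by (simp add: dy_simps rot_graft)
  next
    case (Graft u v)
    let ?A = "dy u" and ?B = "dy v"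
    have A: "?A \<in> dyck_span (internal u)" "sgnaut ?A \<in> dyck_span (internal u)"
      and B: "?B \<in> dyck_span (internal v)" "sgnaut ?B \<in> dyck_span (internal v)"
      by (auto simp: sgnaut_span[OF dy_in_span] dyck_span_sign dy_in_span)
    have "der (dy t * cls) = - (opn * der (?A * cls) * ?B * cls) - opn * sgnaut ?A * cls * der (?B * cls)"
      using Graft der_Cons(1)[of "(?A * cls) * (?B * cls)"] der_mult[of "?A * cls" "?B * cls"]
      by (simp add: dy_simps mult.assoc distrib_left)
    then have "der (dy t * cls) * b * cls * d =
        - (opn * (der (?A * cls) * ?B * cls * b) * cls * d) -
        opn * sgnaut ?A * cls * (der (?B * cls) * b * cls * d)"
      by (simp only: left_diff_distrib minus_mult_left[symmetric] mult.assoc)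
    then have "rot (der (dy t * cls) * b * cls * d) =
        der (der (?A * cls) * ?B * cls * b * cls) * d * cls +
        der (sgnaut ?A * cls) * (der (?B * cls) * b * cls * d) * cls"
      using rot_graft[OF ternary_in_span[OF A(1) B(1) assms(2)] assms(3)]
        rot_graft[OF A(2) ternary_in_span[OF B(1) assms(2,3)]]
      by (simp add: mult.assoc)
    also have "der (der (?A * cls) * ?B * cls * b * cls) =
        - (der (sgnaut ?A * cls) * (der (?B * cls) * (b * cls) + sgnaut ?B * cls * der (b * cls)))"
      using der_mult[of "der (?A * cls)" "(?B * cls) * (b * cls)"] der_mult[of "?B * cls" "b * cls"]
      by (simp add: sgnaut_der mult.assoc)
    also have "- (der (sgnaut ?A * cls) * (der (?B * cls) * (b * cls) + sgnaut ?B * cls * der (b * cls))) * d * cls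
        + der (sgnaut ?A * cls) * (der (?B * cls) * b * cls * d) * cls =
        - (der (sgnaut ?A * cls) * sgnaut ?B * cls) * der (b * cls) * d * cls"
      by (simp add: algebra_simps)
    also have "- (der (sgnaut ?A * cls) * sgnaut ?B * cls) = rot (opn * sgnaut ?A * cls * sgnaut ?B)"
      using rot_graft[OF A(2) B(2)] by simp
    also have "\<dots> = - rot (sgnaut (dy t))"
      using Graft by (simp add: dy_simps)
    finally show ?thesis by simp
  qed
qed (auto simp: algebra_simps)

lemma rot_pow_sign: "(rot ^^ k) ((-1) ^ e * x) = (-1) ^ e * (rot ^^ k) x"
  by (induction k) (simp_all add: rot_sign)

lemma rot_pow_in_span: "x \<in> dyck_span n \<Longrightarrow> (rot ^^ k) x \<in> dyck_span n"
  by (induction k) (auto intro: rot_in_span)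

lemma rot_pow_linear: "(rot ^^ k) 0 = 0" "(rot ^^ k) (x - y) = (rot ^^ k) x - (rot ^^ k) y"
  "(rot ^^ k) (x + y) = (rot ^^ k) x + (rot ^^ k) y"
  by (induction k) simp_all

text \<open>One may picture \<open>rot (dy t) * s\<close> as two trees glued along an edge inside a
  polygon; turning by \<open>2 * internal t + 1\<close> steps brings the other tree to the front.
  The period is the case \<open>s = 1\<close>, but the induction needs general \<open>s\<close>,
  since peeling off the root of \<open>t\<close> moves its parts into \<open>s\<close>.\<close>

lemma rot_digon:
  assumes "s \<in> dyck_span m"
  shows "(rot ^^ (2 * internal t + 1)) (rot (dy t) * s) = (-1) ^ (internal t * m) * (rot s * dy t)"
  using assms
proof (induction t arbitrary: s m)
  case Triv
  then show ?case by (simp add: dy_simps)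
next
  case (Graft l r)
  let ?A = "dy l" and ?B = "dy r" and ?i = "internal l" and ?j = "internal r"
  let ?s1 = "der (?B * cls) * s * cls * 1" and ?s2 = "der (s * cls) * 1 * cls * ?A"
  have A: "?A \<in> dyck_span ?i" and B: "?B \<in> dyck_span ?j" by (simp_all add: dy_in_span)
  have s1: "?s1 \<in> dyck_span (Suc (?j + m + 0))" and s2: "?s2 \<in> dyck_span (Suc (m + 0 + ?i))"
    using ternary_in_span[OF B Graft.prems one_in_span] ternary_in_span[OF Graft.prems one_in_span A]
    by auto
  have "rot (dy (Graft l r)) * s = - (der (?A * cls) * ?B * cls * s)"
    by (simp add: mult.assoc)
  then have 1: "rot (rot (dy (Graft l r)) * s) = (-1) ^ ?i * (rot ?A * ?s1)"
    using rot_ternary[OF A B Graft.prems] by (simp only: sgnaut_span[OF A] rot_linear rot_sign mult.assoc)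
      simp
  have 2: "rot ?s1 * ?A = (-1) ^ Suc ?j * (rot ?B * ?s2)"
    unfolding rot_ternary[OF B Graft.prems one_in_span]
    by (simp add: sgnaut_span[OF B] rot_sign mult.assoc)
  have 3: "rot ?s2 * ?B = (-1) ^ Suc m * (rot s * dy (Graft l r))"
    unfolding rot_ternary[OF Graft.prems one_in_span A]
    by (simp add: sgnaut_span[OF Graft.prems] rot_sign dy_simps mult.assoc)
  \<comment> \<open>One step of \<open>rot_ternary\<close>, then the turns supplied by the
    hypotheses for \<open>l\<close> and for \<open>r\<close>.\<close>
  have "2 * internal (Graft l r) + 1 = (2 * ?j + 1) + ((2 * ?i + 1) + 1)" by simp
  then have "(rot ^^ (2 * internal (Graft l r) + 1)) (rot (dy (Graft l r)) * s) =
      (rot ^^ (2 * ?j + 1)) ((rot ^^ (2 * ?i + 1)) (rot (rot (dy (Graft l r)) * s)))"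
    by (simp only: funpow_add o_apply One_nat_def funpow.simps id_apply)
  also have "\<dots> = (-1) ^ (?i + ?i * Suc (?j + m + 0) + Suc ?j + ?j * Suc (m + 0 + ?i) + Suc m)
      * (rot s * dy (Graft l r))"
    unfolding 1 rot_pow_sign Graft.IH(1)[OF s1] 2 Graft.IH(2)[OF s2] 3
    by (simp only: power_add mult.assoc)
  \<comment> \<open>Modulo 2 the exponent is \<open>(?i + ?j + 1) * m\<close>; the other terms occur
    in pairs.\<close>
  also have "(-1 :: walg) ^ (?i + ?i * Suc (?j + m + 0) + Suc ?j + ?j * Suc (m + 0 + ?i) + Suc m) =
      (-1) ^ (internal (Graft l r) * m)"
    by (simp add: minus_one_power_iff) blast
  finally show ?case .
qed

lemma rot_period: "x \<in> dyck_span n \<Longrightarrow> (rot ^^ (2 * n + 2)) x = x"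
proof (induction x rule: dyck_span_induct)
  case (tree t)
  have "(rot ^^ (2 * n + 2)) (dy t) = (rot ^^ (2 * internal t + 1)) (rot (dy t) * 1)"
    using tree by (simp add: funpow_swap1)
  then show ?case using rot_digon[OF one_in_span, of t] by simp
qed (simp_all add: rot_pow_linear)

section \<open>The Tamari order\<close>

lemma tamari_le_refl [simp]: "tamari_le x x"
  by (simp add: tamari_le_def)

lemma tamari_le_trans: "tamari_le x y \<Longrightarrow> tamari_le y z \<Longrightarrow> tamari_le x z"
  unfolding tamari_le_def by (meson rtranclp_trans)

lemma tamari_le_internal: "tamari_le x y \<Longrightarrow> internal x = internal y"
proof -
  have "tamari_move a b \<Longrightarrow> internal b = internal a" for a b
    by (induction rule: tamari_move.induct) simp_all
  then show "tamari_le x y \<Longrightarrow> internal x = internal y"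
    unfolding tamari_le_def by (auto elim!: rtranclp_induct)
qed

lemma tamari_le_graft:
  assumes "tamari_le l l'" "tamari_le r r'"
  shows "tamari_le (Graft l r) (Graft l' r')"
proof -
  have "tamari_move\<^sup>*\<^sup>* (Graft l' r') (Graft l r')"
    using assms(1) unfolding tamari_le_def
    by (induction rule: rtranclp_induct) (auto intro: tamari_move.left rtranclp.rtrancl_into_rtrancl)
  moreover have "tamari_move\<^sup>*\<^sup>* (Graft l r') (Graft l r)"
    using assms(2) unfolding tamari_le_def
    by (induction rule: rtranclp_induct) (auto intro: tamari_move.right rtranclp.rtrancl_into_rtrancl)
  ultimately show ?thesis unfolding tamari_le_def by simp
qed

lemma tamari_le_rotate: "tamari_le (Graft (Graft A B) C) (Graft A (Graft B C))"
  unfolding tamari_le_def by (auto intro: tamari_move.root)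

text \<open>The trees below \<open>x\<close> whose root is a node of the right spine of \<open>x\<close> have a largest element
  \<open>Graft E D\<close>, and the pairs \<open>(E, D)\<close> are collected here.\<close>

fun splits :: "pbtree \<Rightarrow> (pbtree \<times> pbtree) set" where
  "splits Triv = {}"
| "splits (Graft A B) = insert (A, B) ((\<lambda>(E, D). (Graft A E, D)) ` splits B)"

fun cosplits :: "pbtree \<Rightarrow> (pbtree \<times> pbtree) set" where
  "cosplits Triv = {}"
| "cosplits (Graft A B) = insert (A, B) ((\<lambda>(E, D). (E, Graft D B)) ` cosplits A)"

lemma finite_splits [simp]: "finite (splits x)" "finite (cosplits x)"
  by (induction x) auto

lemma splits_internal: "(E, D) \<in> splits x \<Longrightarrow> internal x = Suc (internal E + internal D)"
  by (induction x arbitrary: E D) auto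

lemma splits_le: "(E, D) \<in> splits x \<Longrightarrow> tamari_le (Graft E D) x"
proof (induction x arbitrary: E D)
  case (Graft A B)
  then show ?case
    by (auto intro: tamari_le_trans[OF tamari_le_rotate tamari_le_graft[OF tamari_le_refl]])
qed simp

text \<open>Cutting the right spine of \<open>x\<close>, and then that of the remaining part
  \<open>D\<close>, amounts to one cut of \<open>x\<close> further down. Its left part dominates
  \<open>Graft E E'\<close> because reassociating to the left goes down.\<close>

lemma splits_trans:
  "(E, D) \<in> splits x \<Longrightarrow> (E', D') \<in> splits D \<Longrightarrow>
    \<exists>F. (F, D') \<in> splits x \<and> tamari_le (Graft E E') F"
proof (induction x arbitrary: E)
  case (Graft A B)
  consider "E = A" "D = B" | G where "E = Graft A G" "(G, D) \<in> splits B"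
    using Graft.prems(1) by auto
  then show ?case
  proof cases
    case 1
    then show ?thesis using Graft.prems(2) by (force intro: exI[of _ "Graft A E'"])
  next
    case 2
    then obtain F where F: "(F, D') \<in> splits B" "tamari_le (Graft G E') F"
      using Graft.IH(2) Graft.prems(2) by blast
    have "tamari_le (Graft E E') (Graft A F)"
      unfolding 2(1) by (rule tamari_le_trans[OF tamari_le_rotate tamari_le_graft]) (simp_all add: F)
    then show ?thesis using F by (intro exI[of _ "Graft A F"]) force
  qed
qed simp

text \<open>This presents the trees below \<open>x\<close> as a union of products of down-sets. The
  hard direction is an induction on the size of \<open>x\<close>, with an inner one along the moves.
  A move at the root breaks up the old right subtree \<open>Graft B D\<close>; this lies below the
  smaller tree \<open>F\<close>, which the outer hypothesis splits again.\<close>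

lemma tamari_le_graft_iff:
  "tamari_le (Graft C D) x \<longleftrightarrow> (\<exists>(E, F) \<in> splits x. tamari_le C E \<and> tamari_le D F)"
proof
  show "\<exists>(E, F) \<in> splits x. tamari_le C E \<and> tamari_le D F \<Longrightarrow> tamari_le (Graft C D) x"
    using splits_le tamari_le_graft tamari_le_trans by blast
  show "tamari_le (Graft C D) x \<Longrightarrow> \<exists>(E, F) \<in> splits x. tamari_le C E \<and> tamari_le D F"
  proof (induction "internal x" arbitrary: x C D rule: less_induct)
    case less
    have "tamari_move\<^sup>*\<^sup>* x (Graft C D)" using less.prems by (simp add: tamari_le_def)
    then show ?case
    proof (induction "Graft C D" arbitrary: C D rule: rtranclp_induct)
      case base
      then show ?case by (force intro: bexI[of _ "(C, D)"])
    next
      case (step y)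
      from step.hyps(2) show ?case
      proof (cases rule: tamari_move.cases)
        case (root A B)
        obtain E F where EF: "(E, F) \<in> splits x" "tamari_le A E" "tamari_le (Graft B D) F"
          using step.hyps(3)[OF root(1)] by blast
        then obtain E' F' where E': "(E', F') \<in> splits F" "tamari_le B E'" "tamari_le D F'"
          using less.hyps[of F B D] splits_internal[OF EF(1)] by auto
        obtain G where "(G, F') \<in> splits x" "tamari_le (Graft E E') G"
          using splits_trans[OF EF(1) E'(1)] by blast
        moreover from this have "tamari_le C G"
          using root EF E' tamari_le_graft tamari_le_trans by blast
        ultimately show ?thesis using E' by blast
      next
        case (left l)
        then have "tamari_le C l" by (auto simp: tamari_le_def)
        then show ?thesis using step.hyps(3)[OF left(1)] tamari_le_trans by blast
      next
        case (right r)
        then have "tamari_le D r" by (auto simp: tamari_le_def)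
        then show ?thesis using step.hyps(3)[OF right(1)] tamari_le_trans by blast
      qed
    qed
  qed
qed

text \<open>Reflection reverses the Tamari order, so it turns the description of down-sets by
  \<open>splits\<close> into one of up-sets by \<open>cosplits\<close>.\<close>

fun mirror :: "pbtree \<Rightarrow> pbtree" where
  "mirror Triv = Triv"
| "mirror (Graft l r) = Graft (mirror r) (mirror l)"

lemma mirror_mirror [simp]: "mirror (mirror t) = t"
  by (induction t) simp_all

lemma tamari_le_mirror: "tamari_le (mirror x) (mirror y) \<longleftrightarrow> tamari_le y x"
proof -
  have m: "tamari_move a b \<Longrightarrow> tamari_move (mirror b) (mirror a)" for a b
    by (induction rule: tamari_move.induct) (auto intro: tamari_move.intros)
  have "tamari_move\<^sup>*\<^sup>* a b \<Longrightarrow> tamari_move\<^sup>*\<^sup>* (mirror b) (mirror a)" for a b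
    by (induction rule: rtranclp_induct) (auto dest: m intro: converse_rtranclp_into_rtranclp)
  from this[of x y] this[of "mirror y" "mirror x"] show ?thesis
    by (auto simp: tamari_le_def)
qed

lemma cosplits_mirror: "cosplits x = (\<lambda>(E, D). (mirror D, mirror E)) ` splits (mirror x)"
  by (induction x) (auto simp: image_image case_prod_beta image_iff)

lemma cosplits_internal: "(E, D) \<in> cosplits x \<Longrightarrow> internal x = Suc (internal E + internal D)"
  by (induction x arbitrary: E D) auto

lemma tamari_ge_graft_iff:
  "tamari_le x (Graft C D) \<longleftrightarrow> (\<exists>(E, F) \<in> cosplits x. tamari_le E C \<and> tamari_le F D)"
proof -
  have "tamari_le x (Graft C D) \<longleftrightarrow> tamari_le (Graft (mirror D) (mirror C)) (mirror x)"
    using tamari_le_mirror[of "Graft C D" x] by simp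
  also have "\<dots> \<longleftrightarrow> (\<exists>(E, F) \<in> splits (mirror x). tamari_le (mirror F) C \<and> tamari_le (mirror E) D)"
    unfolding tamari_le_graft_iff
    using tamari_le_mirror[of D "mirror _"] tamari_le_mirror[of C "mirror _"] by auto
  finally show ?thesis unfolding cosplits_mirror by (simp add: case_prod_beta conj_commute)
qed

text \<open>The left parts cut off along the right spine have different sizes, and comparable trees
  have equal size. So the products belonging to different splits are disjoint.\<close>

lemma splits_inj:
  "(E, D) \<in> splits x \<Longrightarrow> (E', D') \<in> splits x \<Longrightarrow> internal E = internal E' \<Longrightarrow> E = E' \<and> D = D'"
  by (induction x arbitrary: E E') auto

lemma cosplits_inj:
  "(E, D) \<in> cosplits x \<Longrightarrow> (E', D') \<in> cosplits x \<Longrightarrow> internal D = internal D' \<Longrightarrow> E = E' \<and> D = D'"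
  by (induction x arbitrary: D D') auto

lemma Yset_0: "Yset 0 = {Triv}"
  unfolding Yset_def by (auto elim: internal.elims)

lemma Yset_Suc: "Yset (Suc n) = (\<Union>k\<le>n. (\<lambda>(l, r). Graft l r) ` (Yset k \<times> Yset (n - k)))"
  (is "?L = ?R")
proof
  show "?L \<subseteq> ?R"
  proof
    fix t assume "t \<in> ?L"
    then obtain l r where "t = Graft l r" "internal l + internal r = n"
      by (cases t) (auto simp: Yset_def)
    then show "t \<in> ?R" by (auto simp: Yset_def intro!: bexI[of _ "internal l"])
  qed
qed (auto simp: Yset_def)

lemma finite_Yset [simp]: "finite (Yset n)"
proof (induction n rule: less_induct)
  case (less n)
  then show ?case by (cases n) (auto simp: Yset_0 Yset_Suc)
qed

section \<open>Sums of tree elements over down-sets and up-sets\<close>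

definition downset :: "pbtree \<Rightarrow> pbtree set" where "downset x = {y. tamari_le y x}"
definition upset :: "pbtree \<Rightarrow> pbtree set" where "upset x = {y. tamari_le x y}"

lemma finite_downset [simp]: "finite (downset x)" "finite (upset x)"
  by (rule finite_subset[OF _ finite_Yset[of "internal x"]],
      auto simp: downset_def upset_def Yset_def dest: tamari_le_internal)+

lemma downset_Triv: "downset Triv = {Triv}" "upset Triv = {Triv}"
  using Yset_0 by (force simp: downset_def upset_def Yset_def dest: tamari_le_internal)+

text \<open>These are the elements \<open>u y\<close> of the overview, and \<open>eventree\<close>
  gives the \<open>e y\<close>. The factor belonging to the left subtree is
  \<open>eventree l\<close>, so that a sum over a product of down-sets becomes a sum of
  \<open>e\<close> times a sum of \<open>u\<close>.\<close>

fun oddtree :: "pbtree \<Rightarrow> walg" where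
  "oddtree Triv = 1"
| "oddtree (Graft l r) = opn * ((-1) ^ internal l * rot (oddtree l)) * cls * oddtree r"

definition eventree :: "pbtree \<Rightarrow> walg" where
  "eventree t = (-1) ^ internal t * rot (oddtree t)"

text \<open>The common value of the two sums. It is the image of the injective at \<open>x\<close>
  if the simple at \<open>y\<close> goes to \<open>oddtree y\<close>, and of the projective at
  \<open>x\<close> if it goes to \<open>eventree y\<close>.\<close>

fun projtree :: "pbtree \<Rightarrow> walg" where
  "projtree Triv = 1"
| "projtree (Graft l r) = (-1) ^ internal l * (der (projtree l * cls) * cls * projtree r)"

lemma oddtree_in_span: "oddtree t \<in> dyck_span (internal t)"
  by (induction t) (auto simp: one_in_span intro!: graft_in_span dyck_span_sign rot_in_span)

lemma eventree_in_span: "eventree t \<in> dyck_span (internal t)"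
  unfolding eventree_def by (intro dyck_span_sign rot_in_span oddtree_in_span)

lemma projtree_in_span: "projtree t \<in> dyck_span (internal t)"
proof (induction t)
  case (Graft l r)
  then show ?case
    using ternary_in_span[OF Graft.IH(1) one_in_span Graft.IH(2)] by (auto intro!: dyck_span_sign)
qed (simp add: one_in_span)

text \<open>Stated for an arbitrary family \<open>F\<close> so that it serves down-sets and up-sets
  alike: both are disjoint unions of products, and \<open>oddtree\<close> is multiplicative along a
  graft.\<close>

lemma sum_oddtree_splits:
  assumes "finite P" "\<And>x. finite (F x)"
    and "\<And>C D. Graft C D \<in> S \<longleftrightarrow> (\<exists>(E, G) \<in> P. C \<in> F E \<and> D \<in> F G)"
    and "Triv \<notin> S"
    and "\<And>E G E' G' C D. (E, G) \<in> P \<Longrightarrow> (E', G') \<in> P \<Longrightarrow> C \<in> F E \<Longrightarrow> C \<in> F E' \<Longrightarrow>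
      D \<in> F G \<Longrightarrow> D \<in> F G' \<Longrightarrow> (E, G) = (E', G')"
  shows "(\<Sum>y\<in>S. oddtree y) = (\<Sum>(E, G)\<in>P. opn * (\<Sum>C\<in>F E. eventree C) * cls * (\<Sum>D\<in>F G. oddtree D))"
proof -
  let ?g = "\<lambda>(C, D). Graft C D"
  have S: "S = (\<Union>p\<in>P. ?g ` (F (fst p) \<times> F (snd p)))"
  proof (rule Set.set_eqI)
    fix y show "y \<in> S \<longleftrightarrow> y \<in> (\<Union>p\<in>P. ?g ` (F (fst p) \<times> F (snd p)))"
      using assms(3,4) by (cases y) (force simp: case_prod_beta)+
  qed
  have inj: "inj_on (\<lambda>x. Graft (fst x) (snd x)) X" for X by (auto simp: inj_on_def)
  have "(\<Sum>y\<in>S. oddtree y) = (\<Sum>p\<in>P. \<Sum>y\<in>?g ` (F (fst p) \<times> F (snd p)). oddtree y)"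
    unfolding S by (rule sum.UNION_disjoint) (use assms in fastforce)+
  also have "\<dots> = (\<Sum>p\<in>P. \<Sum>(C, D)\<in>F (fst p) \<times> F (snd p). opn * eventree C * cls * oddtree D)"
    by (simp add: sum.reindex[OF inj] case_prod_beta eventree_def)
  also have "\<dots> = (\<Sum>(E, G)\<in>P. opn * (\<Sum>C\<in>F E. eventree C) * cls * (\<Sum>D\<in>F G. oddtree D))"
  proof -
    have P: "(\<Sum>(C, D)\<in>X \<times> Y. opn * eventree C * cls * oddtree D) =
        opn * (\<Sum>C\<in>X. eventree C) * cls * (\<Sum>D\<in>Y. oddtree D)" for X Y
      unfolding sum.cartesian_product[symmetric] sum_product[symmetric]
      by (simp add: sum_distrib_left[symmetric] sum_distrib_right[symmetric])
    show ?thesis unfolding P by (simp add: case_prod_beta)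
  qed
  finally show ?thesis .
qed

lemma sum_oddtree_downset:
  assumes "x \<noteq> Triv"
  shows "(\<Sum>y\<in>downset x. oddtree y) = (\<Sum>(E, G)\<in>splits x.
    opn * (\<Sum>C\<in>downset E. eventree C) * cls * (\<Sum>D\<in>downset G. oddtree D))"
proof (rule sum_oddtree_splits)
  show "Triv \<notin> downset x"
    using assms tamari_le_internal[of Triv x] by (cases x) (auto simp: downset_def)
  fix E G E' G' C D
  assume "(E, G) \<in> splits x" "(E', G') \<in> splits x" "C \<in> downset E" "C \<in> downset E'"
  then show "(E, G) = (E', G')"
    using splits_inj by (auto simp: downset_def dest!: tamari_le_internal)
qed (use finite_downset(1) in \<open>auto simp: downset_def tamari_le_graft_iff\<close>)

lemma sum_oddtree_upset:
  assumes "x \<noteq> Triv"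
  shows "(\<Sum>y\<in>upset x. oddtree y) = (\<Sum>(E, G)\<in>cosplits x.
    opn * (\<Sum>C\<in>upset E. eventree C) * cls * (\<Sum>D\<in>upset G. oddtree D))"
proof (rule sum_oddtree_splits)
  show "Triv \<notin> upset x"
    using assms tamari_le_internal[of x Triv] by (cases x) (auto simp: upset_def)
  fix E G E' G' C D
  assume "(E, G) \<in> cosplits x" "(E', G') \<in> cosplits x" "D \<in> upset G" "D \<in> upset G'"
  then show "(E, G) = (E', G')"
    using cosplits_inj by (auto simp: upset_def dest!: tamari_le_internal)
qed (use finite_downset(2) in \<open>auto simp: upset_def tamari_ge_graft_iff\<close>)

lemma sum_eventree:
  assumes "\<And>y. y \<in> S \<Longrightarrow> internal y = n"
  shows "(\<Sum>y\<in>S. eventree y) = (-1) ^ n * rot (\<Sum>y\<in>S. oddtree y)"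
  using assms by (simp add: eventree_def rot_sum sum_distrib_left)

lemma sum_eventree_downset:
  "(\<Sum>y\<in>downset x. eventree y) = (-1) ^ internal x * rot (\<Sum>y\<in>downset x. oddtree y)"
  by (rule sum_eventree) (auto simp: downset_def dest: tamari_le_internal)

lemma sum_eventree_upset:
  "(\<Sum>y\<in>upset x. eventree y) = (-1) ^ internal x * rot (\<Sum>y\<in>upset x. oddtree y)"
  by (rule sum_eventree) (auto simp: upset_def dest: tamari_le_internal)

lemma sum_trees_in_span:
  "(\<Sum>y\<in>downset x. eventree y) \<in> dyck_span (internal x)"
  "(\<Sum>y\<in>downset x. oddtree y) \<in> dyck_span (internal x)"
  "(\<Sum>y\<in>upset x. eventree y) \<in> dyck_span (internal x)"
  "(\<Sum>y\<in>upset x. oddtree y) \<in> dyck_span (internal x)"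
  using eventree_in_span oddtree_in_span
  by (auto intro!: dyck_span_sum simp: downset_def upset_def dest!: tamari_le_internal) metis+

lemma sum_eventree_downset_splits:
  assumes "internal x = Suc m"
  shows "(\<Sum>y\<in>downset x. eventree y) = (-1) ^ m * (\<Sum>(E, G)\<in>splits x.
    der ((\<Sum>C\<in>downset E. eventree C) * cls) * (\<Sum>D\<in>downset G. oddtree D) * cls)"
proof -
  have "x \<noteq> Triv" using assms by auto
  have "(\<Sum>y\<in>downset x. eventree y) = (-1) ^ Suc m * rot (\<Sum>(E, G)\<in>splits x.
      opn * (\<Sum>C\<in>downset E. eventree C) * cls * (\<Sum>D\<in>downset G. oddtree D))"
    unfolding sum_eventree_downset[of x] sum_oddtree_downset[OF \<open>x \<noteq> Triv\<close>] assms ..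
  then show ?thesis
    by (simp add: rot_sum case_prod_beta rot_graft[OF sum_trees_in_span(1,2)] sum_negf)
qed

text \<open>The splits of \<open>Graft A B\<close> are \<open>(A, B)\<close> and the splits of
  \<open>B\<close> with \<open>A\<close> grafted on; for the latter the hypothesis covers
  \<open>Graft A E\<close>. Half of the terms of its derivative add up to the negative of the
  \<open>(A, B)\<close> term, the other half is the corresponding sum for \<open>B\<close>.\<close>

lemma sum_eventree_downset_eq: "(\<Sum>y\<in>downset x. eventree y) = projtree x"
proof (induction "internal x" arbitrary: x rule: less_induct)
  case less
  show ?case
  proof (cases x)
    case Triv
    then show ?thesis by (simp add: downset_Triv eventree_def)
  next
    case (Graft A B)
    let ?Qe = "\<lambda>x. \<Sum>y\<in>downset x. eventree y" and ?Qo = "\<lambda>x. \<Sum>y\<in>downset x. oddtree y"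
    let ?a = "internal A" and ?b = "internal B"
    let ?u = "der (projtree A * cls)"
    have A: "?Qe A = projtree A" and B: "?Qe B = projtree B"
      using less[of A] less[of B] Graft by auto
    have u: "sgnaut ?u = - ((-1) ^ ?a * ?u)"
      using sgnaut_span[OF projtree_in_span[of A]]
      by (cases "even ?a") (auto simp: sgnaut_der)
    have E: "der (?Qe (Graft A E) * cls) = - (?u * (opn * ?Qe E * cls + cls * der (?Qe E * cls)))"
      if "(E, D) \<in> splits B" for E D
    proof -
      have "internal (Graft A E) < internal x" "internal E < internal x"
        using Graft splits_internal[OF that] by auto
      then have "?Qe (Graft A E) = (-1) ^ ?a * (?u * cls * ?Qe E)"
        using less[of "Graft A E"] less[of E] by simp
      then have "der (?Qe (Graft A E) * cls) = (-1) ^ ?a * der (?u * (cls * (?Qe E * cls)))"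
        by (cases "even ?a") (simp_all add: mult.assoc)
      also have "der (?u * (cls * (?Qe E * cls))) =
          sgnaut ?u * (opn * (?Qe E * cls) + cls * der (?Qe E * cls))"
        by (subst der_mult) (simp add: der_Cons)
      finally show ?thesis unfolding u by (cases "even ?a") (simp_all add: mult.assoc)
    qed
    have "?Qe x = (-1) ^ (?a + ?b) * (\<Sum>(E, G)\<in>splits x. der (?Qe E * cls) * ?Qo G * cls)"
      by (rule sum_eventree_downset_splits) (simp add: Graft)
    also have "(\<Sum>(E, G)\<in>splits x. der (?Qe E * cls) * ?Qo G * cls) =
        der (?Qe A * cls) * ?Qo B * cls +
        (\<Sum>(E, G)\<in>splits B. der (?Qe (Graft A E) * cls) * ?Qo G * cls)"
    proof -
      have "(A, B) \<notin> (\<lambda>(E, D). (Graft A E, D)) ` splits B" by auto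
      moreover have "inj_on (\<lambda>x. (Graft A (fst x), snd x)) (splits B)" by (auto simp: inj_on_def)
      ultimately show ?thesis
        by (simp add: Graft sum.reindex case_prod_beta)
    qed
    also have "(\<Sum>(E, G)\<in>splits B. der (?Qe (Graft A E) * cls) * ?Qo G * cls) =
        (\<Sum>(E, G)\<in>splits B. - (?u * (opn * ?Qe E * cls * ?Qo G) * cls) -
           ?u * cls * (der (?Qe E * cls) * ?Qo G * cls))"
      by (rule sum.cong) (auto simp: E algebra_simps)
    also have "\<dots> = - (?u * (\<Sum>(E, G)\<in>splits B. opn * ?Qe E * cls * ?Qo G) * cls) -
           ?u * cls * (\<Sum>(E, G)\<in>splits B. der (?Qe E * cls) * ?Qo G * cls)"
      by (simp add: case_prod_beta sum_subtractf sum_negf sum_distrib_left sum_distrib_right)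
    finally have *: "?Qe x = (-1) ^ (?a + ?b) * (?u * ?Qo B * cls +
        (- (?u * (\<Sum>(E, G)\<in>splits B. opn * ?Qe E * cls * ?Qo G) * cls) -
           ?u * cls * (\<Sum>(E, G)\<in>splits B. der (?Qe E * cls) * ?Qo G * cls)))"
      by (simp only: A)
    show ?thesis
    proof (cases B)
      case Triv
      then show ?thesis using * Graft by (simp add: downset_Triv)
    next
      case (Graft B1 B2)
      then obtain m where m: "?b = Suc m" by auto
      have "?Qo B = (\<Sum>(E, G)\<in>splits B. opn * ?Qe E * cls * ?Qo G)"
        using Graft by (intro sum_oddtree_downset) auto
      moreover have "(\<Sum>(E, G)\<in>splits B. der (?Qe E * cls) * ?Qo G * cls) = (-1) ^ m * projtree B"
        using sum_eventree_downset_splits[OF m] B by (cases "even m") auto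
      ultimately have "?Qe x = (-1) ^ (?a + ?b) * - (?u * cls * ((-1) ^ m * projtree B))"
        using * by simp
      also have "\<dots> = (-1) ^ ?a * (?u * cls * projtree B)"
        unfolding m by (cases "even m"; cases "even ?a") simp_all
      finally show ?thesis using \<open>x = Graft A B\<close> by simp
    qed
  qed
qed

text \<open>The dual induction along the left spine. The hypothesis covers \<open>Graft D B\<close>,
  and the Leibniz rule produces a multiple of \<open>rot (projtree A)\<close> that cancels the
  contribution of \<open>(A, B)\<close>.\<close>

lemma sum_oddtree_upset_eq: "(\<Sum>y\<in>upset x. oddtree y) = projtree x"
proof (induction "internal x" arbitrary: x rule: less_induct)
  case less
  show ?case
  proof (cases x)
    case Triv
    then show ?thesis by (simp add: downset_Triv)
  next
    case (Graft A B)
    let ?Qe = "\<lambda>x. \<Sum>y\<in>upset x. eventree y" and ?Qo = "\<lambda>x. \<Sum>y\<in>upset x. oddtree y"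
    let ?a = "internal A" and ?b = "internal B"
    have A: "?Qo A = projtree A" and B: "?Qo B = projtree B"
      using less[of A] less[of B] Graft by auto
    have D: "?Qo D = projtree D" "?Qo (Graft D B) = projtree (Graft D B)"
      if "(E, D) \<in> cosplits A" for E D
      using less[of D] less[of "Graft D B"] Graft cosplits_internal[OF that] by auto
    have Qe: "?Qe A = (-1) ^ ?a * rot (projtree A)" unfolding sum_eventree_upset A ..
    have "?Qo x = (\<Sum>(E, G)\<in>cosplits x. opn * ?Qe E * cls * ?Qo G)"
      using Graft by (intro sum_oddtree_upset) auto
    also have "\<dots> = opn * ?Qe A * cls * ?Qo B +
        (\<Sum>(E, G)\<in>cosplits A. opn * ?Qe E * cls * ?Qo (Graft G B))"
    proof -
      have "(A, B) \<notin> (\<lambda>(E, D). (E, Graft D B)) ` cosplits A" by auto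
      moreover have "inj_on (\<lambda>x. (fst x, Graft (snd x) B)) (cosplits A)" by (auto simp: inj_on_def)
      ultimately show ?thesis
        by (simp add: Graft sum.reindex case_prod_beta)
    qed
    also have "(\<Sum>(E, G)\<in>cosplits A. opn * ?Qe E * cls * ?Qo (Graft G B)) =
        (\<Sum>(E, G)\<in>cosplits A. (-1) ^ ?a * (der (opn * ?Qe E * cls * ?Qo G * cls) * cls * projtree B)
           + (-1) ^ ?a * (opn * (der (?Qe E * cls) * ?Qo G * cls) * cls * projtree B))"
    proof (rule sum.cong[OF refl], clarify)
      fix E G assume EG: "(E, G) \<in> cosplits A"
      have a: "?a = Suc (internal E + internal G)" using cosplits_internal[OF EG] by simp
      have s: "sgnaut (?Qe E) = (-1) ^ internal E * ?Qe E"
        by (rule sgnaut_span) (rule sum_trees_in_span)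
      have d: "der (opn * ?Qe E * cls * ?Qo G * cls) =
          - (opn * (der (?Qe E * cls) * ?Qo G * cls + sgnaut (?Qe E) * cls * der (?Qo G * cls)))"
        using der_Cons(1)[of "(?Qe E * cls) * (?Qo G * cls)"] der_mult[of "?Qe E * cls" "?Qo G * cls"]
        by (simp add: mult.assoc)
      show "opn * ?Qe E * cls * ?Qo (Graft G B) =
          (-1) ^ ?a * (der (opn * ?Qe E * cls * ?Qo G * cls) * cls * projtree B)
           + (-1) ^ ?a * (opn * (der (?Qe E * cls) * ?Qo G * cls) * cls * projtree B)"
        unfolding d unfolding D[OF EG] a s
        by (cases "even (internal E)"; cases "even (internal G)") (simp_all add: algebra_simps)
    qed
    also have "\<dots> = (-1) ^ ?a * (der ((\<Sum>(E, G)\<in>cosplits A. opn * ?Qe E * cls * ?Qo G) * cls) * cls * projtree B)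
         + (-1) ^ ?a * (opn * (\<Sum>(E, G)\<in>cosplits A. der (?Qe E * cls) * ?Qo G * cls) * cls * projtree B)"
      by (simp add: case_prod_beta sum.distrib sum_distrib_left sum_distrib_right der_sum)
    finally have *: "?Qo x = opn * ?Qe A * cls * ?Qo B +
        ((-1) ^ ?a * (der ((\<Sum>(E, G)\<in>cosplits A. opn * ?Qe E * cls * ?Qo G) * cls) * cls * projtree B)
         + (-1) ^ ?a * (opn * (\<Sum>(E, G)\<in>cosplits A. der (?Qe E * cls) * ?Qo G * cls) * cls * projtree B))" .
    show ?thesis
    proof (cases A)
      case Triv
      then show ?thesis using * Graft B by (simp add: downset_Triv eventree_def)
    next
      case (Graft A1 A2)
      then have S: "(\<Sum>(E, G)\<in>cosplits A. opn * ?Qe E * cls * ?Qo G) = projtree A"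
        using sum_oddtree_upset[of A] A by simp
      have "rot (\<Sum>(E, G)\<in>cosplits A. opn * ?Qe E * cls * ?Qo G) =
          - (\<Sum>(E, G)\<in>cosplits A. der (?Qe E * cls) * ?Qo G * cls)"
        by (simp add: rot_sum case_prod_beta rot_graft[OF sum_trees_in_span(3,4)] sum_negf)
      then have R: "(\<Sum>(E, G)\<in>cosplits A. der (?Qe E * cls) * ?Qo G * cls) = - rot (projtree A)"
        unfolding S by simp
      show ?thesis using * Qe B \<open>x = Graft A B\<close> unfolding S R
        by (cases "even ?a") simp_all
    qed
  qed
qed

section \<open>Traces on free abelian groups\<close>

abbreviation frags :: "'a set \<Rightarrow> ('a \<Rightarrow>\<^sub>0 int) set" where
  "frags S \<equiv> {x. Poly_Mapping.keys x \<subseteq> S}"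

definition additive_on_frags :: "(('a \<Rightarrow>\<^sub>0 int) \<Rightarrow> ('b \<Rightarrow>\<^sub>0 int)) \<Rightarrow> bool" where
  "additive_on_frags f \<longleftrightarrow> (\<forall>x y. f (x - y) = f x - f y)"

lemma additive_on_fragsD:
  assumes "additive_on_frags f"
  shows "f (x - y) = f x - f y" "f 0 = 0" "f (- x) = - f x" "f (x + y) = f x + f y"
proof -
  show d: "f (x - y) = f x - f y" for x y using assms by (simp add: additive_on_frags_def)
  show z: "f 0 = 0" using d[of 0 0] by simp
  show m: "f (- x) = - f x" for x using d[of 0 x] z by simp
  show "f (x + y) = f x + f y" using d[of x "- y"] m[of y] by simp
qed

lemma additive_sum: "additive_on_frags f \<Longrightarrow> f (sum g A) = (\<Sum>i\<in>A. f (g i))"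
  by (induction A rule: infinite_finite_induct) (simp_all add: additive_on_fragsD)

lemma additive_sign: "additive_on_frags f \<Longrightarrow> f ((-1) ^ k * x) = (-1) ^ k * f x" for f :: "walg \<Rightarrow> walg"
  by (cases "even k") (simp_all add: additive_on_fragsD)

lemma additive_on_frags_compose:
  "additive_on_frags f \<Longrightarrow> additive_on_frags g \<Longrightarrow> additive_on_frags (\<lambda>x. g (f x))"
  by (simp add: additive_on_frags_def)

lemma additive_on_frags_pow: "additive_on_frags f \<Longrightarrow> additive_on_frags (f ^^ k)"
  for f :: "('a \<Rightarrow>\<^sub>0 int) \<Rightarrow> ('a \<Rightarrow>\<^sub>0 int)"
  by (induction k) (simp_all add: additive_on_frags_def)

lemma additive_frag_extend: "additive_on_frags (frag_extend f)"
  by (simp add: additive_on_frags_def frag_extend_diff)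

lemma frags_closed:
  "0 \<in> frags S" "x \<in> frags S \<Longrightarrow> y \<in> frags S \<Longrightarrow> x - y \<in> frags S"
  "x \<in> frags S \<Longrightarrow> y \<in> frags S \<Longrightarrow> x + y \<in> frags S" "x \<in> frags S \<Longrightarrow> - x \<in> frags S"
  using keys_diff[of x y] keys_add[of x y] by auto

lemma frags_sum: "(\<And>i. i \<in> A \<Longrightarrow> f i \<in> frags S) \<Longrightarrow> sum f A \<in> frags S"
proof (induction A rule: infinite_finite_induct)
  case (insert a A)
  then show ?case using frags_closed(3)[of "f a" S "sum f A"] by simp
qed auto

lemma frags_sign: "x \<in> frags S \<Longrightarrow> (-1) ^ k * x \<in> frags S" for x :: walg
  by (cases "even k") auto

lemma frags_additiveI:
  assumes "additive_on_frags f" "\<And>a. a \<in> S \<Longrightarrow> f (frag_of a) \<in> frags T" "x \<in> frags S"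
  shows "f x \<in> frags T"
  using assms(3) unfolding mem_Collect_eq
proof (induction x rule: frag_induction)
  case (diff a b)
  then show ?case using frags_closed(2)[of "f a" T "f b"] assms(1) by (simp add: additive_on_fragsD)
qed (use assms in \<open>simp_all add: additive_on_fragsD\<close>)

lemma frags_additive_eqI:
  assumes "additive_on_frags f" "additive_on_frags g"
    "\<And>a. a \<in> S \<Longrightarrow> f (frag_of a) = g (frag_of a)" "x \<in> frags S"
  shows "f x = g x"
  by (rule frag_additive_eqI[of x S]) (use assms in \<open>simp_all add: additive_on_fragsD\<close>)

lemma lookup_additive:
  assumes "additive_on_frags f" "finite S" "x \<in> frags S"
  shows "Poly_Mapping.lookup (f x) b = (\<Sum>a\<in>S. Poly_Mapping.lookup x a * Poly_Mapping.lookup (f (frag_of a)) b)"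
  by (rule frag_additive_eqI[of x S])
    (use assms in \<open>auto simp: additive_on_fragsD lookup_minus algebra_simps sum_subtractf
      if_distrib[of "\<lambda>c. c * _"] cong: if_cong\<close>)

text \<open>Reading off only the coefficient at \<open>a\<close> makes this the trace of the
  compression of \<open>f\<close> to the span of \<open>S\<close>.\<close>

definition frag_trace :: "'a set \<Rightarrow> (('a \<Rightarrow>\<^sub>0 int) \<Rightarrow> ('a \<Rightarrow>\<^sub>0 int)) \<Rightarrow> int" where
  "frag_trace S f = (\<Sum>a\<in>S. Poly_Mapping.lookup (f (frag_of a)) a)"

lemma frag_trace_cong: "(\<And>a. a \<in> S \<Longrightarrow> f (frag_of a) = g (frag_of a)) \<Longrightarrow> frag_trace S f = frag_trace S g"
  by (simp add: frag_trace_def)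

lemma frag_trace_linear:
  "frag_trace S (\<lambda>x. f x + g x) = frag_trace S f + frag_trace S g"
  "frag_trace S (\<lambda>x. - f x) = - frag_trace S f"
  "frag_trace S (\<lambda>x. \<Sum>i\<in>A. h i x) = (\<Sum>i\<in>A. frag_trace S (h i))"
  by (simp_all add: frag_trace_def lookup_add sum.distrib sum_negf lookup_sum sum.swap[of _ A])

text \<open>The two spans may have different ranks. That is how a trace passes from words to Dyck
  words, and from one number of openers to the next.\<close>

lemma frag_trace_commute:
  assumes "finite S" "finite T" "additive_on_frags f" "additive_on_frags g"
    and "\<And>a. a \<in> S \<Longrightarrow> f (frag_of a) \<in> frags T" "\<And>b. b \<in> T \<Longrightarrow> g (frag_of b) \<in> frags S"
  shows "frag_trace S (\<lambda>x. g (f x)) = frag_trace T (\<lambda>x. f (g x))"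
proof -
  have "frag_trace S (\<lambda>x. g (f x)) =
      (\<Sum>a\<in>S. \<Sum>b\<in>T. Poly_Mapping.lookup (f (frag_of a)) b * Poly_Mapping.lookup (g (frag_of b)) a)"
    unfolding frag_trace_def by (intro sum.cong refl lookup_additive assms)
  also have "\<dots> = (\<Sum>b\<in>T. \<Sum>a\<in>S. Poly_Mapping.lookup (g (frag_of b)) a * Poly_Mapping.lookup (f (frag_of a)) b)"
    by (subst sum.swap) (simp add: mult.commute)
  also have "\<dots> = frag_trace T (\<lambda>x. f (g x))"
    unfolding frag_trace_def by (intro sum.cong refl lookup_additive[symmetric] assms)
  finally show ?thesis .
qed

text \<open>Rows will be words and columns pairs of a tree and a shift, hence the arbitrary index
  sets. The entries move to the rationals, since over a field a one-sided inverse of a square matrix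
  is two-sided.\<close>

lemma square_left_inverse:
  fixes a b :: "_ \<Rightarrow> _ \<Rightarrow> int"
  assumes "finite I" "finite J" "card I = card J"
    and inv: "\<And>j j'. j \<in> J \<Longrightarrow> j' \<in> J \<Longrightarrow> (\<Sum>i\<in>I. b j i * a i j') = (if j = j' then 1 else 0)"
    and "i \<in> I" "i' \<in> I"
  shows "(\<Sum>j\<in>J. a i j * b j i') = (if i = i' then 1 else 0)"
proof -
  let ?m = "card I"
  obtain e where e: "bij_betw e {..<?m} I"
    using ex_bij_betw_nat_finite[OF \<open>finite I\<close>] by (auto simp: atLeast0LessThan)
  obtain d where d: "bij_betw d {..<?m} J"
    using ex_bij_betw_nat_finite[OF \<open>finite J\<close>] assms(3) by (auto simp: atLeast0LessThan)
  define A where "A = mat ?m ?m (\<lambda>(k, l). rat_of_int (a (e k) (d l)))"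
  define B where "B = mat ?m ?m (\<lambda>(k, l). rat_of_int (b (d k) (e l)))"
  have A: "A \<in> carrier_mat ?m ?m" and B: "B \<in> carrier_mat ?m ?m" by (simp_all add: A_def B_def)
  have "B * A = 1\<^sub>m ?m"
  proof (rule eq_matI)
    fix k l assume "k < dim_row (1\<^sub>m ?m :: rat mat)" "l < dim_col (1\<^sub>m ?m :: rat mat)"
    then have kl: "k < ?m" "l < ?m" by simp_all
    have "(B * A) $$ (k, l) = (\<Sum>r<?m. rat_of_int (b (d k) (e r) * a (e r) (d l)))"
      using kl by (simp add: A_def B_def scalar_prod_def atLeast0LessThan)
    also have "\<dots> = rat_of_int (\<Sum>i\<in>I. b (d k) i * a i (d l))"
      using sum.reindex_bij_betw[OF e, of "\<lambda>i. rat_of_int (b (d k) i * a i (d l))"] by simp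
    also have "\<dots> = rat_of_int (if d k = d l then 1 else 0)"
      using kl d by (subst inv) (auto simp: bij_betw_def simp del: of_int_sum of_int_mult)
    also have "\<dots> = (1\<^sub>m ?m) $$ (k, l)"
      using kl d by (auto simp: bij_betw_def inj_on_def)
    finally show "(B * A) $$ (k, l) = (1\<^sub>m ?m) $$ (k, l)" .
  qed (simp_all add: A_def B_def)
  then have AB: "A * B = 1\<^sub>m ?m" by (rule mat_mult_left_right_inverse[OF B A])
  obtain k where "k < ?m" "i = e k" using e assms(5) by (auto simp: bij_betw_def)
  moreover obtain l where "l < ?m" "i' = e l" using e assms(6) by (auto simp: bij_betw_def)
  ultimately have kl: "k < ?m" "l < ?m" "i = e k" "i' = e l" by simp_all
  have AB': "(A * B) $$ (k, l) = rat_of_int (if k = l then 1 else 0)"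
    unfolding AB using kl by simp
  have "(A * B) $$ (k, l) = (\<Sum>r<?m. rat_of_int (a (e k) (d r) * b (d r) (e l)))"
    using kl by (simp add: A_def B_def scalar_prod_def atLeast0LessThan)
  also have "\<dots> = rat_of_int (\<Sum>j\<in>J. a (e k) j * b j (e l))"
    using sum.reindex_bij_betw[OF d, of "\<lambda>j. rat_of_int (a (e k) j * b j (e l))"] by simp
  finally have "rat_of_int (\<Sum>j\<in>J. a (e k) j * b j (e l)) = rat_of_int (if k = l then 1 else 0)"
    using AB' by (simp only:)
  then have "(\<Sum>j\<in>J. a (e k) j * b j (e l)) = (if k = l then 1 else 0)"
    by (simp only: of_int_eq_iff)
  moreover have "k = l \<longleftrightarrow> i = i'" using kl e by (auto simp: bij_betw_def inj_on_def)
  ultimately show ?thesis using kl by (auto split: if_splits)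
qed

section \<open>Words with a given number of openers\<close>

abbreviation opens :: "bool list \<Rightarrow> nat" where "opens w \<equiv> count_list w True"
abbreviation closes :: "bool list \<Rightarrow> nat" where "closes w \<equiv> count_list w False"

definition words :: "nat \<Rightarrow> nat \<Rightarrow> bool list set" where
  "words m i = {w. length w = m \<and> opens w = i}"

lemma opens_closes: "opens w + closes w = length w"
  by (induction w) auto

lemma finite_words [simp]: "finite (words m i)"
proof -
  have "words m i \<subseteq> {w. set w \<subseteq> UNIV \<and> length w = m}" by (auto simp: words_def)
  then show ?thesis by (rule finite_subset) (rule finite_lists_length_eq, simp)
qed

lemma words_Suc: "words (Suc m) i =
    (if i = 0 then {} else (#) True ` words m (i - 1)) \<union> (#) False ` words m i"
  (is "?L = ?R")
proof (rule Set.set_eqI)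
  fix w show "w \<in> ?L \<longleftrightarrow> w \<in> ?R"
    by (cases w) (auto simp: words_def image_iff)
qed

lemma card_words: "card (words m i) = m choose i"
proof (induction m arbitrary: i)
  case 0
  have "words 0 i = (if i = 0 then {[]} else {})" by (auto simp: words_def)
  then show ?case by simp
next
  case (Suc m)
  have "card ((#) True ` words m k \<union> (#) False ` words m i) = card (words m k) + card (words m i)" for k
    by (subst card_Un_disjoint) (auto simp: card_image)
  then show ?case
    using Suc by (cases i) (auto simp: words_Suc card_image)
qed

lemma additive_maps: "additive_on_frags rot" "additive_on_frags der" "additive_on_frags sgnaut"
  by (simp_all add: additive_on_frags_def)

lemma frag_of_Cons_mult: "opn * frag_of w = frag_of (True # w)" "cls * frag_of w = frag_of (False # w)"
  by (subst frag_of_Cons, simp)+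

lemma additive_mult: "additive_on_frags (\<lambda>x. y * x)" "additive_on_frags (\<lambda>x. x * y)" for y :: walg
  by (simp_all add: additive_on_frags_def algebra_simps)

lemma mult_Cons_frags:
  assumes "x \<in> frags S"
  shows "opn * x \<in> frags ((#) True ` S)" "cls * x \<in> frags ((#) False ` S)"
proof -
  show "opn * x \<in> frags ((#) True ` S)"
    by (rule frags_additiveI[OF additive_mult(1) _ assms]) (simp add: frag_of_Cons_mult keys_frag_of)
  show "cls * x \<in> frags ((#) False ` S)"
    by (rule frags_additiveI[OF additive_mult(1) _ assms]) (simp add: frag_of_Cons_mult keys_frag_of)
qed

lemma frags_mono: "x \<in> frags S \<Longrightarrow> S \<subseteq> T \<Longrightarrow> x \<in> frags T"
  by auto

lemma der_word: "w \<in> words m i \<Longrightarrow> der (frag_of w) \<in> frags (words m (Suc i))"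
proof (induction w arbitrary: m i)
  case Nil
  then show ?case by (simp add: frag_of_Nil)
next
  case (Cons b w)
  then obtain m' where m: "m = Suc m'" by (auto simp: words_def)
  show ?case
  proof (cases b)
    case True
    with Cons.prems m obtain i' where i: "i = Suc i'" "w \<in> words m' i'" by (auto simp: words_def)
    have "- (opn * der (frag_of w)) \<in> frags ((#) True ` words m' (Suc i'))"
      by (intro frags_closed mult_Cons_frags Cons.IH i)
    then have "- (opn * der (frag_of w)) \<in> frags (words m (Suc i))"
      by (rule frags_mono) (auto simp: words_def m i)
    then show ?thesis using True by (simp add: frag_of_Cons der_Cons)
  next
    case False
    with Cons.prems m have i: "w \<in> words m' i" by (auto simp: words_def)
    have "cls * der (frag_of w) \<in> frags ((#) False ` words m' (Suc i))"
      by (intro mult_Cons_frags Cons.IH i)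
    then have "cls * der (frag_of w) \<in> frags (words m (Suc i))"
      by (rule frags_mono) (auto simp: words_def m i)
    moreover have "opn * frag_of w \<in> frags (words m (Suc i))"
      using i by (auto simp: frag_of_Cons_mult keys_frag_of words_def m)
    ultimately have "opn * frag_of w + cls * der (frag_of w) \<in> frags (words m (Suc i))"
      by (intro frags_closed)
    then show ?thesis using False by (simp add: frag_of_Cons der_Cons)
  qed
qed

lemma der_frags: "x \<in> frags (words m i) \<Longrightarrow> der x \<in> frags (words m (Suc i))"
  using frags_additiveI[OF additive_maps(2) der_word] .

text \<open>In the exterior algebra this is the interior product with the first coordinate. It is a
  contracting homotopy for \<open>der\<close> on nonempty words; there \<open>contract o der\<close>
  projects along the image of \<open>der\<close> onto the span of the words that begin with a
  closer.\<close>

fun contractw :: "bool list \<Rightarrow> walg" where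
  "contractw [] = 0"
| "contractw (b # w) = (if b then cls * frag_of w else 0)"

definition contract :: "walg \<Rightarrow> walg" where
  "contract = frag_extend contractw"

lemma additive_contract: "additive_on_frags contract"
  by (simp add: contract_def additive_frag_extend)

lemma contract_Cons: "contract (opn * x) = cls * x" "contract (cls * x) = 0"
proof -
  have "contract (opn * frag_of w) = cls * frag_of w" "contract (cls * frag_of w) = 0" for w
    by (simp_all only: frag_of_Cons_mult contract_def frag_extend_of)
      (simp_all add: frag_of_Cons_mult)
  note * = this
  note a = additive_on_fragsD[OF additive_contract]
  show "contract (opn * x) = cls * x"
    by (rule frag_additive_eqI[of x UNIV]) (simp_all add: * a algebra_simps)
  show "contract (cls * x) = 0"
    by (rule frag_additive_eqI[of x UNIV]) (simp_all add: * a algebra_simps)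
qed

lemma homotopy_word: "w \<noteq> [] \<Longrightarrow> contract (der (frag_of w)) + der (contract (frag_of w)) = frag_of w"
  by (cases w) (auto simp: frag_of_Cons der_Cons contract_Cons additive_on_fragsD[OF additive_contract])

lemma homotopy:
  assumes "x \<in> frags (words (Suc m) i)"
  shows "contract (der x) + der (contract x) = x"
  by (rule frag_additive_eqI[of x "words (Suc m) i"])
    (use assms in \<open>auto simp: additive_on_fragsD[OF additive_contract] words_def intro!: homotopy_word\<close>)

lemma contract_word:
  "w \<in> words (Suc m) (Suc i) \<Longrightarrow> contract (frag_of w) \<in> frags ((#) False ` words m i)"
  "w \<in> words (Suc m) 0 \<Longrightarrow> contract (frag_of w) = 0"
proof -
  assume w: "w \<in> words (Suc m) (Suc i)"
  then obtain b v where bv: "w = b # v" by (cases w) (auto simp: words_def)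
  then have "v \<in> words m i" if b using w that by (simp add: words_def)
  then show "contract (frag_of w) \<in> frags ((#) False ` words m i)"
    unfolding contract_def frag_extend_of bv contractw.simps frag_of_Cons_mult
    by (simp add: keys_frag_of)
next
  assume w: "w \<in> words (Suc m) 0"
  then obtain b v where bv: "w = b # v" by (cases w) (auto simp: words_def)
  then have "\<not> b" using w by (auto simp: words_def)
  then show "contract (frag_of w) = 0"
    unfolding contract_def frag_extend_of bv contractw.simps by simp
qed

lemma contract_frags:
  "x \<in> frags (words (Suc m) (Suc i)) \<Longrightarrow> contract x \<in> frags ((#) False ` words m i)"
  using frags_additiveI[OF additive_contract contract_word(1)] .

lemma contract_frags': "x \<in> frags (words m (Suc i)) \<Longrightarrow> contract x \<in> frags (words m i)"
proof (cases m)
  case 0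
  then have "words m (Suc i) = {}" by (auto simp: words_def)
  then show "x \<in> frags (words m (Suc i)) \<Longrightarrow> contract x \<in> frags (words m i)"
    by (simp add: additive_on_fragsD[OF additive_contract])
next
  case (Suc k)
  assume "x \<in> frags (words m (Suc i))"
  then have "contract x \<in> frags ((#) False ` words k i)" using contract_frags Suc by blast
  then show "contract x \<in> frags (words m i)"
    by (rule frags_mono) (auto simp: words_def Suc)
qed

lemma contract_frags_0: "x \<in> frags (words m 0) \<Longrightarrow> contract x = 0"
proof (cases m)
  case 0
  have "contract (frag_of []) = 0" by (simp add: contract_def)
  then show "x \<in> frags (words m 0) \<Longrightarrow> contract x = 0"
    using frags_additive_eqI[of contract "\<lambda>_. 0" "words m 0" x] 0 additive_contract
    by (auto simp: words_def additive_on_frags_def)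
next
  case (Suc k)
  then show "x \<in> frags (words m 0) \<Longrightarrow> contract x = 0"
    using frags_additive_eqI[of contract "\<lambda>_. 0" "words m 0" x] additive_contract contract_word(2)
    by (auto simp: additive_on_frags_def)
qed

section \<open>Signed rotation of words\<close>

text \<open>Moving an opener behind \<open>w\<close> costs one sign per opener of \<open>w\<close>,
  as for anticommuting vectors. With this sign, rotation commutes with \<open>der\<close>.\<close>

fun cycw :: "bool list \<Rightarrow> walg" where
  "cycw [] = 1"
| "cycw (b # w) = (if b then sgnaut (frag_of w) * opn else frag_of w * cls)"

definition cyc :: "walg \<Rightarrow> walg" where "cyc = frag_extend cycw"

lemma additive_cyc: "additive_on_frags cyc"
  by (simp add: cyc_def additive_frag_extend)

lemma cyc_Cons: "cyc (opn * x) = sgnaut x * opn" "cyc (cls * x) = x * cls"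
proof -
  have "cyc (opn * frag_of w) = sgnaut (frag_of w) * opn" "cyc (cls * frag_of w) = frag_of w * cls" for w
    by (simp_all only: frag_of_Cons_mult cyc_def frag_extend_of) simp_all
  note * = this
  note a = additive_on_fragsD[OF additive_cyc]
  show "cyc (opn * x) = sgnaut x * opn"
    by (rule frag_additive_eqI[of x UNIV]) (simp_all add: * a algebra_simps)
  show "cyc (cls * x) = x * cls"
    by (rule frag_additive_eqI[of x UNIV]) (simp_all add: * a algebra_simps)
qed

lemma cyc_der: "cyc (der x) = der (cyc x)"
proof (rule frag_additive_eqI[where x = x and S = UNIV])
  fix w :: "bool list"
  note a = additive_on_fragsD[OF additive_cyc]
  show "cyc (der (frag_of w)) = der (cyc (frag_of w))"
  proof (cases w)
    case Nil
    have "cyc 1 = 1" using frag_extend_of[of cycw "[]"] by (simp add: cyc_def frag_of_Nil)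
    then show ?thesis using Nil by (simp add: a frag_of_Nil)
  next
    case (Cons b v)
    then show ?thesis
      by (cases b) (simp_all add: frag_of_Cons der_Cons cyc_Cons a der_mult sgnaut_der)
  qed
qed (simp_all add: additive_on_fragsD[OF additive_cyc])

lemma cyc_pow_der: "(cyc ^^ k) (der x) = der ((cyc ^^ k) x)"
  by (induction k) (simp_all add: cyc_der)

text \<open>Two blocks of anticommuting letters are exchanged. For \<open>v = []\<close> the sign is
  trivial, so a full turn is the identity.\<close>

lemma cyc_pow_append:
  "(cyc ^^ length u) (frag_of (u @ v)) = (-1) ^ (opens u * opens v) * frag_of (v @ u)"
proof (induction u arbitrary: v)
  case (Cons b u)
  have "cyc (frag_of (b # u @ v)) = (-1) ^ (if b then opens u + opens v else 0) * frag_of (u @ v @ [b])"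
  proof (cases b)
    case True
    then show ?thesis
      using cyc_Cons(1)[of "frag_of (u @ v)"]
      by (simp add: frag_of_mult sgnaut_frag_of opn_def mult.assoc)
  next
    case False
    then show ?thesis
      using cyc_Cons(2)[of "frag_of (u @ v)"] by (simp add: frag_of_mult cls_def)
  qed
  then have "(cyc ^^ length (b # u)) (frag_of ((b # u) @ v)) =
      (-1) ^ (if b then opens u + opens v else 0) *
      ((-1) ^ (opens u * opens (v @ [b])) * frag_of ((v @ [b]) @ u))"
    using Cons[of "v @ [b]"] additive_sign[OF additive_on_frags_pow[OF additive_cyc]]
    by (simp add: funpow_swap1[symmetric] funpow_Suc_right del: funpow.simps)
  also have "\<dots> = (-1) ^ (opens (b # u) * opens v) * frag_of (v @ b # u)"
    by (simp add: minus_one_power_iff)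
  finally show ?case .
qed simp

lemma cyc_pow_word:
  assumes "w \<in> words m i" "k \<le> m"
  shows "(cyc ^^ k) (frag_of w) = (-1) ^ (opens (take k w) * opens (drop k w)) * frag_of (drop k w @ take k w)"
  using cyc_pow_append[of "take k w" "drop k w"] assms by (simp add: words_def min_absorb2)

lemma cyc_pow_frags: "x \<in> frags (words m i) \<Longrightarrow> (cyc ^^ k) x \<in> frags (words m i)"
proof (induction k)
  case (Suc k)
  have "cyc (frag_of w) \<in> frags (words m i)" if "w \<in> words m i" for w
  proof (cases w)
    case Nil
    then show ?thesis using that by (simp add: cyc_def frag_of_Nil[symmetric] keys_frag_of)
  next
    case (Cons b v)
    have "drop 1 w @ take 1 w \<in> words m i"
      using that Cons by (auto simp: words_def)
    then have *: "frag_of (drop 1 w @ take 1 w) \<in> frags (words m i)" by (simp add: keys_frag_of)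
    have "1 \<le> m" using that Cons by (auto simp: words_def)
    have "(cyc ^^ 1) (frag_of w) \<in> frags (words m i)"
      unfolding cyc_pow_word[OF that \<open>1 \<le> m\<close>] by (rule frags_sign[OF *])
    then show ?thesis by simp
  qed
  from frags_additiveI[OF additive_cyc this Suc.IH[OF Suc.prems]] show ?case by simp
qed simp

lemma cyc_period: "x \<in> frags (words m i) \<Longrightarrow> (cyc ^^ m) x = x"
  using frags_additive_eqI[of "cyc ^^ m" "\<lambda>x. x" "words m i" x]
    additive_on_frags_pow[OF additive_cyc, of m] cyc_pow_word[of _ m i m]
  by (auto simp: additive_on_frags_def words_def)

lemma cyc_pow_mod: "x \<in> frags (words m i) \<Longrightarrow> (cyc ^^ k) x = (cyc ^^ (k mod m)) x"
proof -
  assume x: "x \<in> frags (words m i)"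
  have "(cyc ^^ (m * q)) x = x" for q
    by (induction q) (simp_all add: funpow_add cyc_period[OF x])
  then have "(cyc ^^ (k mod m + m * (k div m))) x = (cyc ^^ (k mod m)) x"
    by (simp only: funpow_add o_apply)
  then show ?thesis by simp
qed

section \<open>Words without unmatched openers\<close>

text \<open>The condition on all suffixes says that every opener is matched by a later
  closer.\<close>

fun suffix_ballot :: "bool list \<Rightarrow> bool" where
  "suffix_ballot [] \<longleftrightarrow> True"
| "suffix_ballot (b # w) \<longleftrightarrow> suffix_ballot w \<and> opens (b # w) \<le> closes (b # w)"

fun forest_word :: "pbtree list \<Rightarrow> bool list" where
  "forest_word [] = []"
| "forest_word [t] = dyck t"
| "forest_word (t # ts) = dyck t @ False # forest_word ts"

lemma dyck_balanced: "opens (dyck t) = internal t" "closes (dyck t) = internal t"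
  by (induction t) auto

lemma suffix_ballot_counts: "suffix_ballot w \<Longrightarrow> opens w \<le> closes w"
  by (cases w) auto

lemma suffix_ballot_dyck: "suffix_ballot v \<Longrightarrow> suffix_ballot (dyck t @ v)"
proof (induction t arbitrary: v)
  case (Graft l r)
  have 1: "suffix_ballot (dyck r @ v)" using Graft by blast
  then have 2: "suffix_ballot (False # dyck r @ v)"
    using suffix_ballot_counts[OF 1] by simp
  then have 3: "suffix_ballot (dyck l @ False # dyck r @ v)" using Graft by blast
  show ?case using 3 suffix_ballot_counts[OF Graft.prems] by (simp add: dyck_balanced)
qed simp

lemma suffix_ballot_drop: "suffix_ballot (u @ v) \<Longrightarrow> suffix_ballot v"
  by (induction u) auto

text \<open>The unmatched closers separate the Dyck factors, so there is one factor more than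
  unmatched closers. A new opener in front uses up the first separator and joins the first two
  trees.\<close>

lemma suffix_ballot_forest:
  "suffix_ballot w \<Longrightarrow> \<exists>ts. w = forest_word ts \<and> length ts = Suc (closes w - opens w)"
proof (induction w)
  case Nil
  then show ?case by (intro exI[of _ "[Triv]"]) simp
next
  case (Cons b w)
  then obtain ts where ts: "w = forest_word ts" "length ts = Suc (closes w - opens w)" by auto
  then obtain t us where tus: "ts = t # us" by (cases ts) auto
  show ?case
  proof (cases b)
    case False
    have eq: "False # w = forest_word (Triv # ts)" using ts tus by simp
    have le: "opens w \<le> closes w" using Cons.prems suffix_ballot_counts by auto
    show ?thesis
    proof (intro exI conjI)
      show "b # w = forest_word (Triv # ts)" using False eq by simp
      show "length (Triv # ts) = Suc (closes (b # w) - opens (b # w))"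
        using False ts(2) le by (simp add: Suc_diff_le)
    qed
  next
    case True
    then have "opens w < closes w" using Cons.prems by auto
    then obtain u vs where us: "us = u # vs" using ts tus by (cases us) auto
    have eq: "True # w = forest_word (Graft t u # vs)"
      using ts tus us by (cases vs) auto
    show ?thesis
    proof (intro exI conjI)
      show "b # w = forest_word (Graft t u # vs)" using True eq by simp
      show "length (Graft t u # vs) = Suc (closes (b # w) - opens (b # w))"
        using True ts(2) \<open>opens w < closes w\<close> tus us by simp
    qed
  qed
qed

text \<open>Turning a closer into an opener can only increase the excess of openers in a
  suffix.\<close>

lemma der_unmatched:
  "\<not> suffix_ballot w \<Longrightarrow> der (frag_of w) \<in> frags {v. \<not> suffix_ballot v}"
proof (induction w)
  case (Cons b w)
  have keys: "x \<in> frags {v. \<not> suffix_ballot v} \<Longrightarrow> opn * x \<in> frags {v. \<not> suffix_ballot v}"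
    "x \<in> frags {v. \<not> suffix_ballot v} \<Longrightarrow> cls * x \<in> frags {v. \<not> suffix_ballot v}" for x
    by (rule frags_mono[OF mult_Cons_frags(1)], assumption, force)
      (rule frags_mono[OF mult_Cons_frags(2)], assumption, force)
  show ?case
  proof (cases "suffix_ballot w")
    case False
    then have "opn * frag_of w \<in> frags {v. \<not> suffix_ballot v}" by (intro keys) (simp add: keys_frag_of)
    moreover have "cls * der (frag_of w) \<in> frags {v. \<not> suffix_ballot v}"
      "- (opn * der (frag_of w)) \<in> frags {v. \<not> suffix_ballot v}"
      using Cons.IH[OF False] by (auto intro!: keys frags_closed simp del: mem_Collect_eq)
    ultimately show ?thesis
      by (cases b) (simp_all only: frag_of_Cons der_Cons if_True if_False frags_closed(3))
  next
    case True
    then have b: b and le: "closes w < opens (True # w)"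
      using Cons.prems suffix_ballot_counts[OF True] by (cases b; simp)+
    have "- (opn * der (frag_of w)) \<in> frags ((#) True ` words (length w) (Suc (opens w)))"
      by (intro frags_closed mult_Cons_frags der_frags) (simp add: keys_frag_of words_def)
    then have "- (opn * der (frag_of w)) \<in> frags {v. \<not> suffix_ballot v}"
    proof (rule frags_mono, safe)
      fix v assume v: "v \<in> words (length w) (Suc (opens w))" "suffix_ballot (True # v)"
      then have "opens v + closes v = opens w + closes w" "opens v = Suc (opens w)"
        using opens_closes[of v] opens_closes[of w] by (simp_all add: words_def)
      then show False using v(2) le by simp
    qed
    then show ?thesis using b by (simp only: frag_of_Cons der_Cons if_True)
  qed
qed simp

section \<open>Gluing two trees along their roots\<close>

definition glue_word :: "pbtree \<times> pbtree \<Rightarrow> bool list" where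
  "glue_word p = dyck (fst p) @ False # dyck (snd p) @ [False]"

lemma inj_glue_word: "inj glue_word"
proof (rule injI)
  fix p q assume "glue_word p = glue_word q"
  then have "dyck (fst p) @ False # dyck (snd p) @ [False] = dyck (fst q) @ False # dyck (snd q) @ [False]"
    by (simp add: glue_word_def)
  from dyck_prefix[OF this] show "p = q"
    using dyck_prefix[of "snd p" "[]" "snd q" "[]"] by (simp add: prod_eq_iff)
qed

text \<open>A matched word of length \<open>2 * n + 2\<close> with \<open>n\<close> openers has the
  form \<open>X c Y c Z\<close>; only those with trivial \<open>Z\<close> are kept. The value is the
  pair of glued trees from \<open>rot_digon\<close>, chosen so that the image of \<open>der\<close>
  is killed.\<close>

definition glue :: "walg \<Rightarrow> walg" where
  "glue = frag_extend (\<lambda>w. if w \<in> range glue_word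
     then rot (dy (fst (inv_into UNIV glue_word w))) * dy (snd (inv_into UNIV glue_word w)) else 0)"

lemma additive_glue: "additive_on_frags glue"
  by (simp add: glue_def additive_frag_extend)

lemma glue_word_eq: "frag_of (glue_word (X, Y)) = dy X * cls * dy Y * cls"
  by (simp add: glue_word_def dy_def cls_def frag_of_mult)

lemma glue_eq_0: "w \<notin> range glue_word \<Longrightarrow> glue (frag_of w) = 0"
  by (simp add: glue_def)

lemma glue_mult:
  assumes "x \<in> dyck_span a" "y \<in> dyck_span b"
  shows "glue (x * cls * y * cls) = rot x * y"
  using assms(1)
proof (induction x rule: dyck_span_induct)
  case (tree t)
  show ?case using assms(2)
  proof (induction y rule: dyck_span_induct)
    case (tree u)
    show ?case unfolding glue_word_eq[symmetric] by (simp add: glue_def inj_glue_word)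
  qed (simp_all add: algebra_simps additive_on_fragsD[OF additive_glue])
qed (simp_all add: algebra_simps additive_on_fragsD[OF additive_glue])

lemma glue_unmatched: "x \<in> frags {v. \<not> suffix_ballot v} \<Longrightarrow> glue x = 0"
proof (rule frags_additive_eqI[OF additive_glue, of "\<lambda>_. 0"])
  fix w assume "w \<in> {v. \<not> suffix_ballot v}"
  moreover have "suffix_ballot (glue_word p)" for p
    unfolding glue_word_def by (rule suffix_ballot_dyck) (use suffix_ballot_dyck[of "[False]" "snd p"]
      suffix_ballot_counts[of "dyck (snd p) @ [False]"] in \<open>simp add: dyck_balanced\<close>)
  ultimately show "glue (frag_of w) = 0" by (intro glue_eq_0) auto
qed (simp_all add: additive_on_frags_def)

lemma glue_trailing_tree:
  assumes "z \<in> dyck_span (Suc m)"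
  shows "glue (dy X * cls * dy Y * cls * z) = 0"
  using assms
proof (induction z rule: dyck_span_induct)
  case (tree t)
  have "dyck X @ False # dyck Y @ False # dyck t \<notin> range glue_word"
  proof
    assume "dyck X @ False # dyck Y @ False # dyck t \<in> range glue_word"
    then obtain p where p: "dyck X @ False # dyck Y @ False # dyck t =
      dyck (fst p) @ False # dyck (snd p) @ False # []" by (auto simp: glue_word_def)
    from dyck_prefix[OF p] have "dyck Y @ False # dyck t = dyck (snd p) @ False # []" by simp
    from dyck_prefix[OF this] have "t = Triv" by (cases t) auto
    with tree show False by simp
  qed
  then show ?case using glue_eq_0 by (simp add: dy_def cls_def frag_of_mult)
qed (simp_all add: algebra_simps additive_on_fragsD[OF additive_glue])

lemma glue_trailing_opener:
  assumes "w \<in> words (Suc (2 * m)) (Suc m)"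
  shows "glue (frag_of v * frag_of w) = 0"
proof (rule glue_unmatched)
  have "closes w < opens w" using assms opens_closes[of w] by (auto simp: words_def)
  then have "\<not> suffix_ballot (v @ w)"
    using suffix_ballot_drop suffix_ballot_counts by (meson not_le)
  then show "frag_of v * frag_of w \<in> frags {v. \<not> suffix_ballot v}"
    by (simp add: frag_of_mult keys_frag_of)
qed

lemma sgnaut_dy: "sgnaut (dy t) = (-1) ^ internal t * dy t"
  by (rule sgnaut_span) (simp add: dy_in_span)

text \<open>A word without unmatched opener has four surplus closers here, hence five trees.
  Deriving in \<open>D c E\<close> leaves an unmatched opener, and deriving in \<open>C c\<close> a
  nontrivial last tree. The terms from \<open>A c\<close> and \<open>B c\<close> cancel by
  \<open>rot_ternary\<close> if \<open>E\<close> is trivial, and vanish otherwise.\<close>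

lemma glue_der:
  assumes "x \<in> frags (words (2 * n + 4) n)"
  shows "glue (der x) = 0"
proof (rule frags_additive_eqI[OF _ _ _ assms, of _ "\<lambda>_. 0"])
  show "additive_on_frags (\<lambda>x. glue (der x))"
    by (rule additive_on_frags_compose[OF additive_maps(2) additive_glue])
  show "additive_on_frags (\<lambda>_. 0 :: walg)" by (simp add: additive_on_frags_def)
  fix w assume w: "w \<in> words (2 * n + 4) n"
  note glue_additive = additive_on_fragsD[OF additive_glue]
  show "glue (der (frag_of w)) = 0"
  proof (cases "suffix_ballot w")
    case False
    then show ?thesis by (intro glue_unmatched der_unmatched)
  next
    case True
    have "closes w - opens w = 4" using w opens_closes[of w] by (auto simp: words_def)
    then obtain ts where "w = forest_word ts" "length ts = 5"
      using suffix_ballot_forest[OF True] by auto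
    then obtain A B C D E where "w = forest_word [A, B, C, D, E]"
      by (auto simp: length_Suc_conv eval_nat_numeral)
    then have w_eq: "frag_of w = (dy A * cls) * ((dy B * cls) * ((dy C * cls) * (dy D * cls * dy E)))"
      by (simp add: dy_def cls_def frag_of_mult)
    let ?a = "internal A" and ?b = "internal B" and ?c = "internal C"
    note span = dy_in_span[OF refl]
    let ?T1 = "der (dy A * cls) * dy B * cls * dy C" and ?T2 = "der (dy B * cls) * dy C * cls * dy D"
      and ?T3 = "der (dy C * cls) * dy D * cls * dy E"
    have T1: "?T1 \<in> dyck_span (Suc (?a + ?b + ?c))"
      and T2: "?T2 \<in> dyck_span (Suc (?b + ?c + internal D))"
      and T3: "?T3 \<in> dyck_span (Suc (?c + internal D + internal E))"
      by (intro ternary_in_span span)+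
    have der_w: "der (frag_of w) = ?T1 * cls * dy D * cls * dy E
        + (-1) ^ ?a * (dy A * cls * ?T2 * cls * dy E)
        + (-1) ^ (?a + ?b) * (dy A * cls * dy B * cls * ?T3)
        + (-1) ^ (?a + ?b + ?c) * (dy A * cls * dy B * cls * dy C * cls * der (dy D * cls * dy E))"
      unfolding w_eq der_mult[of "dy A * cls"] der_mult[of "dy B * cls"] der_mult[of "dy C * cls"]
      by (cases "even ?a"; cases "even ?b"; cases "even ?c") (simp_all add: sgnaut_dy algebra_simps)
    have g3: "glue (dy A * cls * dy B * cls * ?T3) = 0"
      by (rule glue_trailing_tree[OF T3])
    have g4: "glue (dy A * cls * dy B * cls * dy C * cls * der (dy D * cls * dy E)) = 0"
    proof (rule frags_additive_eqI[where
          f = "\<lambda>z. glue (dy A * cls * dy B * cls * dy C * cls * z)" and g = "\<lambda>_. 0"])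
      let ?m = "internal D + internal E"
      show "der (dy D * cls * dy E) \<in> frags (words (Suc (2 * ?m)) (Suc ?m))"
      proof (rule der_frags)
        have "dy D * cls * dy E = frag_of (dyck D @ False # dyck E)"
          by (simp add: dy_def cls_def frag_of_mult)
        then show "dy D * cls * dy E \<in> frags (words (Suc (2 * ?m)) ?m)"
          using opens_closes[of "dyck D"] opens_closes[of "dyck E"]
          by (simp add: keys_frag_of words_def dyck_balanced)
      qed
      fix v assume v: "v \<in> words (Suc (2 * ?m)) (Suc ?m)"
      have "dy A * cls * dy B * cls * dy C * cls =
          frag_of (dyck A @ False # dyck B @ False # dyck C @ [False])"
        by (simp add: dy_def cls_def frag_of_mult)
      then show "glue (dy A * cls * dy B * cls * dy C * cls * frag_of v) = 0"
        using glue_trailing_opener[OF v] by simp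
    qed (auto simp: additive_on_frags_def glue_additive right_diff_distrib)
    have "glue (der (frag_of w)) = glue (?T1 * cls * dy D * cls * dy E)
        + (-1) ^ ?a * glue (dy A * cls * ?T2 * cls * dy E)"
      unfolding der_w by (simp only: glue_additive additive_sign[OF additive_glue] g3 g4) simp
    also have "\<dots> = 0"
    proof (cases E)
      case Triv
      have "glue (?T1 * cls * dy D * cls) = rot ?T1 * dy D"
        by (rule glue_mult[OF T1 span])
      also have "rot ?T1 = - (rot (sgnaut (dy A)) * der (dy B * cls) * dy C * cls)"
        by (rule rot_ternary[OF span span span])
      also have "\<dots> * dy D = - ((-1) ^ ?a * (rot (dy A) * ?T2))"
        by (simp only: sgnaut_dy rot_sign) (simp add: mult.assoc)
      also have "rot (dy A) * ?T2 = glue (dy A * cls * ?T2 * cls)"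
        by (rule glue_mult[OF span T2, symmetric])
      finally show ?thesis using Triv by (simp add: dy_simps)
    next
      case (Graft E1 E2)
      have E: "dy E \<in> dyck_span (Suc (internal E1 + internal E2))" by (rule dy_in_span) (simp add: Graft)
      have "glue (x * cls * dy Y * cls * dy E) = 0" if "x \<in> dyck_span k" for x k Y
        using that
        by (induction x rule: dyck_span_induct)
          (simp_all add: algebra_simps glue_additive glue_trailing_tree[OF E, unfolded mult.assoc])
      from this[OF T1] have "glue (?T1 * cls * dy D * cls * dy E) = 0" .
      moreover have "glue (dy X * cls * y * cls * dy E) = 0" if "y \<in> dyck_span k" for y k X
        using that
        by (induction y rule: dyck_span_induct)
          (simp_all add: algebra_simps glue_additive glue_trailing_tree[OF E, unfolded mult.assoc])
      from this[OF T2] have "glue (dy A * cls * ?T2 * cls * dy E) = 0" .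
      ultimately show ?thesis by simp
    qed
    finally show ?thesis .
  qed
qed

lemma dy_cls_cls_frags: "x \<in> dyck_span n \<Longrightarrow> x * cls * cls \<in> frags (words (2 * n + 2) n)"
proof (induction x rule: dyck_span_induct)
  case (tree t)
  have "dy t * cls * cls = frag_of (dyck t @ [False, False])"
    by (simp add: dy_def cls_def frag_of_mult)
  then show ?case
    using tree opens_closes[of "dyck t"] by (simp add: keys_frag_of words_def dyck_balanced)
next
  case (diff x y)
  have "(x - y) * cls * cls = x * cls * cls - y * cls * cls" by (simp add: algebra_simps)
  then show ?case using frags_closed(2)[OF diff] by simp
qed simp

text \<open>Turning \<open>t c c\<close> by 0 or by -1 gives the pairs \<open>(t, Triv)\<close> and
  \<open>(Triv, t)\<close>. A turn in between cuts \<open>t\<close> into \<open>u v\<close> and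
  gives \<open>v c c u\<close>; as a word of two trees it would force \<open>v\<close> to be Dyck,
  and then \<open>u\<close> to be empty.\<close>

lemma glue_cyc_word:
  assumes "internal t = n" "k < 2 * n + 2"
  shows "glue ((cyc ^^ k) (dy t * cls * cls)) =
    (if k = 0 then rot (dy t) else if k = 2 * n + 1 then dy t else 0)"
proof -
  let ?w = "dyck t @ [False, False]"
  have w: "dy t * cls * cls = frag_of ?w" by (simp add: dy_def cls_def frag_of_mult)
  have len: "length (dyck t) = 2 * n"
    using opens_closes[of "dyck t"] assms(1) by (simp add: dyck_balanced)
  have ww: "?w \<in> words (2 * n + 2) n" using len assms by (simp add: words_def dyck_balanced)
  consider "k = 0" | "k = 2 * n + 1" | "0 < k" "k \<le> 2 * n" using assms(2) by linarith
  then show ?thesis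
  proof cases
    case 1
    then show ?thesis
      using glue_mult[OF dy_in_span one_in_span, of t n] assms(1) by simp
  next
    case 2
    have "(cyc ^^ k) (frag_of ?w) = frag_of (False # dyck t @ [False])"
      using cyc_pow_append[of "dyck t @ [False]" "[False]"] len 2 by simp
    also have "\<dots> = 1 * cls * dy t * cls" by (simp add: dy_def cls_def frag_of_mult)
    finally show ?thesis
      using 2 w glue_mult[OF one_in_span dy_in_span, of t n] assms(1) by simp
  next
    case 3
    let ?u = "take k (dyck t)" and ?v = "drop k (dyck t)"
    have uv: "?u @ ?v = dyck t" by simp
    have "(cyc ^^ k) (frag_of ?w) = (-1) ^ (opens ?u * opens (?v @ [False, False])) *
        frag_of (?v @ [False, False] @ ?u)"
      using cyc_pow_append[of ?u "?v @ [False, False]"] 3 len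
      unfolding append_assoc[symmetric] uv by (simp add: min_absorb2)
    moreover have "?v @ [False, False] @ ?u \<notin> range glue_word"
    proof
      assume "?v @ [False, False] @ ?u \<in> range glue_word"
      then obtain p where p: "?v @ False # False # ?u = glue_word p" by auto
      have "suffix_ballot (dyck (snd p) @ [False])" by (rule suffix_ballot_dyck) simp
      then have "suffix_ballot (glue_word p)" unfolding glue_word_def
        by (intro suffix_ballot_dyck) (auto simp: dyck_balanced)
      then have "suffix_ballot ((?v @ [False, False]) @ ?u)" using p by simp
      then have u: "opens ?u \<le> closes ?u"
        using suffix_ballot_drop suffix_ballot_counts by blast
      have "suffix_ballot (dyck t @ [])" by (rule suffix_ballot_dyck) simp
      then have "suffix_ballot (?u @ ?v)" using uv by simp
      then have v: "suffix_ballot ?v" by (rule suffix_ballot_drop)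
      \<comment> \<open>\<open>?u\<close> has at most as many openers as closers and
        \<open>t\<close> is balanced, so \<open>?v\<close> is balanced too and is a single
        tree.\<close>
      have "opens ?u + opens ?v = closes ?u + closes ?v"
        using arg_cong[OF uv, of opens] arg_cong[OF uv, of closes]
        unfolding count_list_append dyck_balanced by simp
      then have "closes ?v - opens ?v = 0" using u suffix_ballot_counts[OF v] by linarith
      with suffix_ballot_forest[OF v] obtain ts where "?v = forest_word ts" "length ts = 1" by auto
      then obtain V where "?v = dyck V" by (auto simp: length_Suc_conv)
      then have "dyck V @ False # (dyck Triv @ False # ?u) =
          dyck (fst p) @ False # (dyck (snd p) @ False # [])"
        using p by (simp add: glue_word_def)
      from dyck_prefix[OF this] have "dyck Triv @ False # ?u = dyck (snd p) @ False # []" by simp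
      from dyck_prefix[OF this] have "?u = []" by simp
      then show False using 3 len by simp
    qed
    ultimately show ?thesis
      using 3 by (simp add: w additive_sign[OF additive_glue] glue_eq_0)
  qed
qed

lemma glue_cyc:
  assumes "x \<in> dyck_span n" "k < 2 * n + 2"
  shows "glue ((cyc ^^ k) (x * cls * cls)) =
    (if k = 0 then rot x else if k = 2 * n + 1 then x else 0)"
  using assms(1)
proof (induction x rule: dyck_span_induct)
  case (tree t)
  then show ?case using glue_cyc_word assms(2) by simp
next
  case (diff x y)
  have "(x - y) * cls * cls = x * cls * cls - y * cls * cls" by (simp add: algebra_simps)
  then show ?case using diff
    by (simp add: additive_on_fragsD[OF additive_on_frags_pow[OF additive_cyc]]
        additive_on_fragsD[OF additive_glue])
qed (simp add: additive_on_fragsD[OF additive_on_frags_pow[OF additive_cyc]]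
        additive_on_fragsD[OF additive_glue])

lemma glue_frags: "x \<in> frags (words (2 * n + 2) n) \<Longrightarrow> glue x \<in> dyck_span n"
  unfolding dyck_span_def
proof (rule frags_additiveI[OF additive_glue])
  fix w assume w: "w \<in> words (2 * n + 2) n"
  have "glue (frag_of w) \<in> dyck_span n"
  proof (cases "w \<in> range glue_word")
    case True
    then obtain X Y where XY: "w = glue_word (X, Y)" by auto
    have n: "n = internal X + internal Y" using w by (simp add: XY glue_word_def words_def dyck_balanced)
    have "rot (dy X) * dy Y \<in> dyck_span n"
    proof (cases X)
      case Triv
      then show ?thesis using n by (simp add: dy_simps dy_in_span)
    next
      case (Graft l r)
      then show ?thesis
        using n ternary_in_span[OF dy_in_span[OF refl] dy_in_span[OF refl] dy_in_span[OF refl], of l r Y]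
        by (simp add: dyck_span_closed)
    qed
    then show ?thesis
      unfolding XY glue_word_eq using glue_mult[OF dy_in_span[OF refl] dy_in_span[OF refl]] by simp
  qed (simp add: glue_eq_0 dyck_span_closed)
  then show "glue (frag_of w) \<in> frags (dyck ` Yset n)" by (simp add: dyck_span_def)
qed

section \<open>The number of trees\<close>

lemma card_Yset_Suc: "card (Yset (Suc n)) = (\<Sum>k\<le>n. card (Yset k) * card (Yset (n - k)))"
proof -
  have inj: "inj_on (\<lambda>(l, r). Graft l r) X" for X by (auto simp: inj_on_def)
  have "card (Yset (Suc n)) = (\<Sum>k\<le>n. card ((\<lambda>(l, r). Graft l r) ` (Yset k \<times> Yset (n - k))))"
    unfolding Yset_Suc by (rule card_UN_disjoint) (simp_all, auto simp: Yset_def)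
  then show ?thesis by (simp add: card_image[OF inj] card_cartesian_product)
qed

text \<open>The series \<open>Y = 1 - 2 x T\<close> is a square root of \<open>1 - 4 x\<close>, and
  the recursion consists of the coefficients of \<open>(1 - 4 x) Y' = - 2 Y\<close>.\<close>

lemma card_Yset_rec: "(n + 2) * card (Yset (Suc n)) = (4 * n + 2) * card (Yset n)"
proof -
  define T :: "rat fps" where "T = Abs_fps (\<lambda>n. of_nat (card (Yset n)))"
  have T_nth: "fps_nth T k = of_nat (card (Yset k))" for k by (simp add: T_def)
  have TT_nth: "fps_nth (T * T) k = of_nat (card (Yset (Suc k)))" for k
    by (simp add: fps_mult_nth T_nth card_Yset_Suc atLeast0AtMost)
  have T: "T = 1 + fps_X * T\<^sup>2"
  proof (rule fps_ext)
    fix n show "fps_nth T n = fps_nth (1 + fps_X * T\<^sup>2) n"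
      by (cases n) (simp_all add: T_nth TT_nth Yset_0 power2_eq_square)
  qed
  define Y where "Y = 1 - 2 * fps_X * T"
  have "Y\<^sup>2 = 1 - 4 * fps_X * (T - fps_X * T\<^sup>2)"
    by (simp add: Y_def power2_eq_square algebra_simps)
  also have "T - fps_X * T\<^sup>2 = 1" using T by (metis add_diff_cancel_right')
  finally have Y2: "Y\<^sup>2 = 1 - 4 * fps_X" by simp
  have "fps_deriv (Y\<^sup>2) = - 4" unfolding Y2 by simp
  then have "2 * (Y * fps_deriv Y) = - 4" by (simp add: power2_eq_square algebra_simps)
  then have "2 * (Y * fps_deriv Y) * Y = - 4 * Y" by simp
  then have "2 * (fps_deriv Y * Y\<^sup>2) = 2 * (- 2 * Y)" by (simp add: power2_eq_square algebra_simps)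
  then have "fps_deriv Y * Y\<^sup>2 = - 2 * Y" by (subst (asm) mult_left_cancel) simp_all
  then have E: "fps_deriv Y - 4 * (fps_X * fps_deriv Y) = - 2 * Y" unfolding Y2 by (simp add: algebra_simps)
  have nth: "fps_nth Y (Suc k) = - 2 * of_nat (card (Yset k))" for k
    by (simp add: Y_def T_def mult.assoc numeral_fps_const fps_mult_left_const_nth)
  have "fps_nth (fps_deriv Y - 4 * (fps_X * fps_deriv Y)) (Suc n) = fps_nth (- 2 * Y) (Suc n)"
    unfolding E ..
  then have "of_nat (n + 2) * fps_nth Y (Suc (Suc n)) - 4 * (of_nat (n + 1) * fps_nth Y (Suc n)) =
      - 2 * fps_nth Y (Suc n)"
    by (simp add: numeral_fps_const fps_mult_left_const_nth flip: fps_const_neg)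
  then have "rat_of_nat ((n + 2) * card (Yset (Suc n))) = rat_of_nat ((4 * n + 2) * card (Yset n))"
    unfolding nth by (simp add: algebra_simps)
  then show ?thesis by (simp only: of_nat_eq_iff)
qed

lemma central_binomial: "(n + 1) * card (Yset n) = (2 * n) choose n"
proof (induction n)
  case 0 then show ?case by (simp add: Yset_0)
next
  case (Suc n)
  have 1: "Suc n * ((2 * Suc n) choose Suc n) = (2 * n + 2) * ((2 * n + 1) choose n)"
    using Suc_times_binomial_eq[of "2 * n + 1" n] by (simp add: mult.commute)
  have 2: "Suc n * ((2 * n + 1) choose n) = (2 * n + 1) * ((2 * n) choose n)"
    using Suc_times_binomial_eq[of "2 * n" n] binomial_symmetric[of "Suc n" "2 * n + 1"]
    by (simp add: mult.commute)
  have "Suc n * (Suc n * ((2 * Suc n) choose Suc n)) = (2 * n + 2) * ((2 * n + 1) * ((2 * n) choose n))"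
    unfolding 1 using 2 by (metis mult.left_commute)
  also have "\<dots> = (2 * n + 2) * ((2 * n + 1) * ((n + 1) * card (Yset n)))" using Suc by simp
  also have "\<dots> = (n + 1) * ((n + 1) * ((4 * n + 2) * card (Yset n)))" by (simp add: algebra_simps)
  also have "\<dots> = Suc n * (Suc n * ((n + 2) * card (Yset (Suc n))))" unfolding card_Yset_rec[symmetric] by simp
  finally show ?case by (simp only: mult_cancel1) simp
qed

lemma card_Yset: "card (Yset n) = catalan n"
  unfolding catalan_def central_binomial[symmetric]
  by (rule nonzero_mult_div_cancel_left[symmetric]) simp

text \<open>The right side counts the words that begin with a closer, the left side the basis of
  \<open>2 * n + 1\<close> copies of the Dyck span: the equality of ranks behind the decomposition
  of the cokernel.\<close>

lemma card_Yset_binomial: "(2 * n + 1) * card (Yset n) = (2 * n + 1) choose n"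
proof -
  have "Suc n * ((2 * n + 1) choose n) = (2 * n + 1) * ((2 * n) choose n)"
    using Suc_times_binomial_eq[of "2 * n" n] binomial_symmetric[of "Suc n" "2 * n + 1"]
    by (simp add: mult.commute)
  also have "\<dots> = Suc n * ((2 * n + 1) * card (Yset n))"
    unfolding central_binomial[symmetric] by (simp add: algebra_simps)
  finally show ?thesis by (simp only: mult_cancel1) simp
qed

section \<open>Comparison with the exterior power\<close>

text \<open>With \<open>N = 2 * n + 2\<close>, the words of length \<open>N\<close> with \<open>n\<close> openers span the \<open>n\<close>-th exterior power
  of the permutation representation of the cyclic group of order \<open>N\<close>, and \<open>der\<close> is the multiplication by the
  sum of the basis vectors. The maps below identify the cokernel of \<open>der\<close> with \<open>2 * n + 1\<close> copies of
  \<open>dyck_span n\<close>.\<close>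

definition unglue :: "nat \<Rightarrow> nat \<Rightarrow> walg \<Rightarrow> walg" where
  "unglue n k x = (\<Sum>l=k..2 * n. (-1) ^ (l - k) * (rot ^^ (l - k)) (glue ((cyc ^^ (2 * n + 1 - l)) x)))"

definition embed :: "nat \<Rightarrow> walg \<Rightarrow> walg" where
  "embed k x = contract (der ((cyc ^^ k) (x * cls * cls)))"

lemma additive_signed: "additive_on_frags f \<Longrightarrow> additive_on_frags (\<lambda>x. (-1) ^ k * f x)"
  for f :: "('a \<Rightarrow>\<^sub>0 int) \<Rightarrow> walg"
  by (simp add: additive_on_frags_def right_diff_distrib)

lemma additive_sum_map: "(\<And>i. i \<in> A \<Longrightarrow> additive_on_frags (f i)) \<Longrightarrow> additive_on_frags (\<lambda>x. \<Sum>i\<in>A. f i x)"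
  by (simp add: additive_on_frags_def sum_subtractf)

lemma additive_unglue: "additive_on_frags (unglue n k)"
  unfolding unglue_def
  by (intro additive_sum_map additive_signed
      additive_on_frags_compose[OF _ additive_on_frags_pow[OF additive_maps(1)]]
      additive_on_frags_compose[OF additive_on_frags_pow[OF additive_cyc] additive_glue])

lemma additive_embed: "additive_on_frags (embed k)"
proof -
  have "additive_on_frags (\<lambda>x :: walg. x * cls * cls)"
    by (simp add: additive_on_frags_def left_diff_distrib)
  then show ?thesis
    unfolding embed_def
    by (intro additive_on_frags_compose[OF _ additive_contract] additive_on_frags_compose[OF _ additive_maps(2)]
        additive_on_frags_compose[OF _ additive_on_frags_pow[OF additive_cyc]])
qed

lemma unglue_frags: "x \<in> frags (words (2 * n + 2) n) \<Longrightarrow> unglue n k x \<in> dyck_span n"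
  unfolding unglue_def
  by (intro dyck_span_sum dyck_span_sign rot_pow_in_span glue_frags cyc_pow_frags)

lemma unglue_der:
  assumes "x \<in> frags (words (2 * n + 4) n)"
  shows "unglue (Suc n) k (der x) = 0"
proof -
  have "glue ((cyc ^^ j) (der x)) = 0" for j
    unfolding cyc_pow_der by (rule glue_der) (rule cyc_pow_frags[OF assms])
  then show ?thesis by (simp add: unglue_def rot_pow_linear)
qed

text \<open>The two arguments differ by an element of the image of \<open>der\<close>, which
  rotation preserves and \<open>unglue\<close> kills.\<close>

lemma unglue_contract_der:
  assumes "x \<in> frags (words (2 * n + 2) n)"
  shows "unglue n k ((cyc ^^ m) (contract (der x))) = unglue n k ((cyc ^^ m) x)"
proof -
  have "contract (der x) = x - der (contract x)"
    using homotopy[of x "2 * n + 1" n] assms by (simp add: algebra_simps)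
  then have *: "unglue n k ((cyc ^^ m) (contract (der x))) =
      unglue n k ((cyc ^^ m) x) - unglue n k (der ((cyc ^^ m) (contract x)))"
    by (simp add: additive_on_fragsD[OF additive_on_frags_pow[OF additive_cyc]]
        additive_on_fragsD[OF additive_unglue] cyc_pow_der)
  show ?thesis
  proof (cases n)
    case 0
    then have "contract x = 0" using contract_frags_0 assms by simp
    then show ?thesis using * by (simp add: additive_on_fragsD[OF additive_on_frags_pow[OF additive_cyc]]
        additive_on_fragsD[OF additive_unglue])
  next
    case (Suc i)
    have eq: "2 * n + 2 = 2 * i + 4" using Suc by simp
    have "contract x \<in> frags (words (2 * n + 2) i)" by (rule contract_frags') (use assms Suc in simp)
    then have "(cyc ^^ m) (contract x) \<in> frags (words (2 * i + 4) i)"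
      unfolding eq by (rule cyc_pow_frags)
    then show ?thesis using * Suc unglue_der by simp
  qed
qed

text \<open>After a turn by \<open>2 * n + 1 - l\<close>, \<open>glue\<close> sees the shift
  \<open>l\<close> as the identity and the shift \<open>l + 1\<close> as \<open>rot\<close>. The
  alternating sum in \<open>unglue\<close> inverts this bidiagonal pattern. It stops at
  \<open>l = 2 * n\<close>, which leaves one uncancelled term for the shift
  \<open>2 * n + 1\<close>.\<close>

lemma unglue_cyc:
  assumes "x \<in> dyck_span n" "k \<le> 2 * n" "p < k + (2 * n + 2)"
  shows "unglue n k ((cyc ^^ p) (x * cls * cls)) =
    (if p = k then x else if p = 2 * n + 1 then (-1) ^ (2 * n - k) * (rot ^^ (p - k)) x else 0)"
proof -
  let ?N = "2 * n + 2"
  have xw: "x * cls * cls \<in> frags (words ?N n)" by (rule dy_cls_cls_frags[OF assms(1)])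
  have *: "glue ((cyc ^^ (2 * n + 1 - l)) ((cyc ^^ p) (x * cls * cls))) =
      (if p = Suc l then rot x else 0) + (if p = l then x else 0)" if l: "k \<le> l" "l \<le> 2 * n" for l
  proof -
    let ?a = "2 * n + 1 - l + p"
    have "glue ((cyc ^^ (2 * n + 1 - l)) ((cyc ^^ p) (x * cls * cls))) = glue ((cyc ^^ ?a) (x * cls * cls))"
      by (simp only: funpow_add o_apply)
    also have "\<dots> = glue ((cyc ^^ (?a mod ?N)) (x * cls * cls))"
      using cyc_pow_mod[OF xw, of ?a] by (simp only:)
    also have "\<dots> = (if ?a mod ?N = 0 then rot x else if ?a mod ?N = 2 * n + 1 then x else 0)"
      by (rule glue_cyc[OF assms(1)]) simp
    finally have e: "glue ((cyc ^^ (2 * n + 1 - l)) ((cyc ^^ p) (x * cls * cls))) =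
      (if ?a mod ?N = 0 then rot x else if ?a mod ?N = 2 * n + 1 then x else 0)" .
    \<comment> \<open>Less than two full turns, so reduction modulo \<open>?N\<close> subtracts
      \<open>?N\<close> at most once; the bound on \<open>p\<close> excludes a coincidence after
      wrapping around.\<close>
    have "?a < 2 * ?N" using assms(3) l by arith
    have "0 < ?a" using l by linarith
    consider "?a < ?N" | "?N \<le> ?a" "?a < 2 * ?N" using \<open>?a < 2 * ?N\<close> by linarith
    then have "?a mod ?N = 0 \<longleftrightarrow> p = Suc l" "?a mod ?N = 2 * n + 1 \<longleftrightarrow> p = l"
    proof (atomize(full), cases)
      case 1
      then have "?a mod ?N = ?a" by simp
      then show "(?a mod ?N = 0 \<longleftrightarrow> p = Suc l) \<and> (?a mod ?N = 2 * n + 1 \<longleftrightarrow> p = l)"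
        using 1 \<open>0 < ?a\<close> l by linarith
    next
      case 2
      then have "?a mod ?N = ?a - ?N" by (simp add: mod_if)
      then show "(?a mod ?N = 0 \<longleftrightarrow> p = Suc l) \<and> (?a mod ?N = 2 * n + 1 \<longleftrightarrow> p = l)"
        using 2 l assms(3) by linarith
    qed
    then show ?thesis unfolding e by auto
  qed
  have "unglue n k ((cyc ^^ p) (x * cls * cls)) =
      (\<Sum>l=k..2 * n. (-1) ^ (l - k) * (rot ^^ (l - k)) ((if p = Suc l then rot x else 0) + (if p = l then x else 0)))"
    unfolding unglue_def by (intro sum.cong refl) (simp only: * atLeastAtMost_iff)
  also have "\<dots> = (\<Sum>l=k..2 * n. (if p = Suc l then (-1) ^ (p - 1 - k) * (rot ^^ (p - k)) x else 0) +
      (if l = p then (-1) ^ (p - k) * (rot ^^ (p - k)) x else 0))"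
    by (intro sum.cong refl)
      (auto simp: rot_pow_linear Suc_diff_le funpow_swap1)
  also have "\<dots> = (\<Sum>l=k..2 * n. (if p = Suc l then (-1) ^ (p - 1 - k) * (rot ^^ (p - k)) x else 0)) +
      (if k \<le> p \<and> p \<le> 2 * n then (-1) ^ (p - k) * (rot ^^ (p - k)) x else 0)"
    by (simp add: sum.distrib)
  also have "(\<Sum>l=k..2 * n. (if p = Suc l then (-1) ^ (p - 1 - k) * (rot ^^ (p - k)) x else 0)) =
      (if k < p \<and> p \<le> 2 * n + 1 then (-1) ^ (p - 1 - k) * (rot ^^ (p - k)) x else 0)"
  proof (cases p)
    case (Suc q)
    then show ?thesis by (auto simp: Suc_le_eq less_Suc_eq_le)
  qed simp
  finally have *: "unglue n k ((cyc ^^ p) (x * cls * cls)) =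
     (if k < p \<and> p \<le> 2 * n + 1 then (-1) ^ (p - 1 - k) * (rot ^^ (p - k)) x else 0) +
     (if k \<le> p \<and> p \<le> 2 * n then (-1) ^ (p - k) * (rot ^^ (p - k)) x else 0)" .
  consider "p < k" | "p = k" | "k < p" "p \<le> 2 * n" | "p = 2 * n + 1" | "2 * n + 1 < p" by linarith
  then show ?thesis
  proof cases
    case 3
    then have "p - k = Suc (p - 1 - k)" by simp
    then have "(-1 :: walg) ^ (p - k) = - ((-1) ^ (p - 1 - k))" by (simp only: power_Suc) simp
    then show ?thesis unfolding * using 3 by simp
  qed (use * assms(2) in auto)
qed

lemma unglue_embed:
  assumes "x \<in> dyck_span n" "k \<le> 2 * n" "l \<le> 2 * n"
  shows "unglue n l (embed k x) = (if l = k then x else 0)"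
proof -
  have "unglue n l (embed k x) = unglue n l ((cyc ^^ k) (x * cls * cls))"
    unfolding embed_def
    using unglue_contract_der[OF cyc_pow_frags[OF dy_cls_cls_frags[OF assms(1)]], of l 0 k] by simp
  also have "\<dots> = (if l = k then x else 0)"
    using unglue_cyc[OF assms(1,3), of k] assms(2) by auto
  finally show ?thesis .
qed

lemma embed_frags:
  assumes "x \<in> dyck_span n"
  shows "embed k x \<in> frags ((#) False ` words (2 * n + 1) n)"
  unfolding embed_def
  using contract_frags[of "der ((cyc ^^ k) (x * cls * cls))" "2 * n + 1" n]
    der_frags[OF cyc_pow_frags[OF dy_cls_cls_frags[OF assms]]] by simp

text \<open>By \<open>unglue_embed\<close> one composite of the matrices of \<open>unglue\<close>
  and \<open>embed\<close> is the identity. The ranks agree, so the other composite is the identity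
  as well, which replaces a spanning argument for the shifted copies.\<close>

lemma contract_der_eq_sum:
  assumes "x \<in> frags (words (2 * n + 2) n)"
  shows "contract (der x) = (\<Sum>k\<le>2 * n. embed k (unglue n k x))"
proof -
  let ?I = "(#) False ` words (2 * n + 1) n" and ?J = "Yset n \<times> {..2 * n}"
  let ?D = "dyck ` Yset n"
  define a where "a i j = Poly_Mapping.lookup (embed (snd j) (dy (fst j))) i" for i and j :: "pbtree \<times> nat"
  define b where "b j i = Poly_Mapping.lookup (unglue n (snd j) (frag_of i)) (dyck (fst j))"
    for i and j :: "pbtree \<times> nat"
  have subset: "?I \<subseteq> words (2 * n + 2) n" by (auto simp: words_def)
  have "card ?I = (2 * n + 1) choose n" by (simp add: card_image card_words)
  moreover have "card ?J = (2 * n + 1) * card (Yset n)" by (simp add: card_cartesian_product)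
  ultimately have card: "card ?I = card ?J" by (simp only: card_Yset_binomial)
  have "(\<Sum>i\<in>?I. b j i * a i j') = (if j = j' then 1 else 0)" if "j \<in> ?J" "j' \<in> ?J" for j j'
  proof -
    obtain s l t k where j: "j = (s, l)" "j' = (t, k)" by (cases j, cases j') auto
    have t: "dy t \<in> dyck_span n" and lk: "l \<le> 2 * n" "k \<le> 2 * n"
      using that j by (auto simp: Yset_def intro: dy_in_span)
    have "(\<Sum>i\<in>?I. b j i * a i j') = Poly_Mapping.lookup (unglue n l (embed k (dy t))) (dyck s)"
      using lookup_additive[OF additive_unglue _ embed_frags[OF t], of n l k "dyck s"]
      by (simp add: a_def b_def j mult.commute)
    also have "\<dots> = (if l = k \<and> s = t then 1 else 0)"
      unfolding unglue_embed[OF t lk(2,1)] using inj_dyck by (simp add: dy_def inj_eq)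
    finally show ?thesis using j by auto
  qed
  note inv = square_left_inverse[OF _ _ card this]
  have "(\<lambda>y. y) y = (\<lambda>y. \<Sum>k\<le>2 * n. embed k (unglue n k y)) y" if "y \<in> frags ?I" for y
  proof (rule frags_additive_eqI[OF _ _ _ that])
    show "additive_on_frags (\<lambda>y :: walg. y)" by (simp add: additive_on_frags_def)
    show "additive_on_frags (\<lambda>y. \<Sum>k\<le>2 * n. embed k (unglue n k y))"
      by (intro additive_sum_map additive_on_frags_compose[OF additive_unglue additive_embed])
    fix i' assume i': "i' \<in> ?I"
    then have "frag_of i' \<in> frags (words (2 * n + 2) n)" using subset by (auto simp: keys_frag_of)
    note u = unglue_frags[OF this]
    show "frag_of i' = (\<Sum>k\<le>2 * n. embed k (unglue n k (frag_of i')))"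
    proof (rule poly_mapping_eqI)
      fix i
      show "Poly_Mapping.lookup (frag_of i') i =
        Poly_Mapping.lookup (\<Sum>k\<le>2 * n. embed k (unglue n k (frag_of i'))) i"
      proof (cases "i \<in> ?I")
        case True
        have "Poly_Mapping.lookup (embed k (unglue n k (frag_of i'))) i =
            (\<Sum>t\<in>Yset n. a i (t, k) * b (t, k) i')" for k
          using lookup_additive[OF additive_embed _ u[unfolded dyck_span_def], of k k i]
          by (simp add: sum.reindex[OF inj_on_subset[OF inj_dyck]] a_def b_def dy_def mult.commute)
        then have "Poly_Mapping.lookup (\<Sum>k\<le>2 * n. embed k (unglue n k (frag_of i'))) i =
            (\<Sum>j\<in>?J. a i j * b j i')"
          by (simp add: lookup_sum sum.cartesian_product[symmetric] case_prod_beta)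
            (subst sum.swap, simp add: sum.cartesian_product case_prod_beta)
        also have "\<dots> = (if i = i' then 1 else 0)" by (rule inv) (use True i' in auto)
        finally show ?thesis by auto
      next
        case False
        have "(\<Sum>k\<le>2 * n. embed k (unglue n k (frag_of i'))) \<in> frags ?I"
          by (intro frags_sum embed_frags u)
        then show ?thesis using False i' by (auto simp: in_keys_iff)
      qed
    qed
  qed
  moreover have "contract (der x) \<in> frags ?I"
    using contract_frags[of "der x" "2 * n + 1" n] der_frags[OF assms] by simp
  ultimately have "contract (der x) = (\<Sum>k\<le>2 * n. embed k (unglue n k (contract (der x))))" by blast
  also have "\<dots> = (\<Sum>k\<le>2 * n. embed k (unglue n k x))"
    using unglue_contract_der[OF assms, of _ 0] by simp
  finally show ?thesis .
qed

text \<open>Rotation by \<open>m\<close> takes the copy \<open>k\<close> to the shift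
  \<open>k + m\<close>. This meets the copy \<open>k\<close> again only if
  \<open>k + m = 2 * n + 1\<close>, through the extra term of \<open>unglue_cyc\<close>.\<close>

lemma trace_rot_pow:
  assumes "0 < m" "m < 2 * n + 2"
  shows "frag_trace (words (2 * n + 2) n) (\<lambda>x. (cyc ^^ m) (contract (der x))) =
    - frag_trace (dyck ` Yset n) (\<lambda>x. (-1) ^ m * (rot ^^ m) x)"
proof -
  let ?W = "words (2 * n + 2) n" and ?D = "dyck ` Yset n"
  have w: "frag_of w \<in> frags ?W" if "w \<in> ?W" for w using that by (simp add: keys_frag_of)
  have d: "frag_of v \<in> dyck_span n" if "v \<in> ?D" for v
    using that by (auto simp: dyck_span_def keys_frag_of)
  have cyc_embed: "(cyc ^^ m) (embed k x) \<in> frags ?W" if "x \<in> dyck_span n" for x k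
  proof (rule cyc_pow_frags)
    show "embed k x \<in> frags ?W"
      by (rule frags_mono[OF embed_frags[OF that]]) (auto simp: words_def)
  qed
  have "frag_trace ?W (\<lambda>x. (cyc ^^ m) (contract (der x))) =
      frag_trace ?W (\<lambda>x. \<Sum>k\<le>2 * n. (cyc ^^ m) (embed k (unglue n k x)))"
    by (rule frag_trace_cong)
      (simp add: contract_der_eq_sum[OF w] additive_sum[OF additive_on_frags_pow[OF additive_cyc]])
  also have "\<dots> = (\<Sum>k\<le>2 * n. frag_trace ?W (\<lambda>x. (cyc ^^ m) (embed k (unglue n k x))))"
    by (rule frag_trace_linear)
  also have "\<dots> = (\<Sum>k\<le>2 * n. frag_trace ?D (\<lambda>x. unglue n k ((cyc ^^ m) (embed k x))))"
  proof (rule sum.cong[OF refl], rule frag_trace_commute)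
    fix k
    show "additive_on_frags (\<lambda>x. (cyc ^^ m) (embed k x))"
      by (rule additive_on_frags_compose[OF additive_embed additive_on_frags_pow[OF additive_cyc]])
    show "unglue n k (frag_of w) \<in> frags ?D" if "w \<in> ?W" for w
      using unglue_frags[OF w[OF that]] by (simp add: dyck_span_def)
    show "(cyc ^^ m) (embed k (frag_of v)) \<in> frags ?W" if "v \<in> ?D" for v
      by (rule cyc_embed[OF d[OF that]])
  qed (simp_all add: additive_unglue)
  also have "\<dots> = (\<Sum>k\<le>2 * n. if k = 2 * n + 1 - m
      then - frag_trace ?D (\<lambda>x. (-1) ^ m * (rot ^^ m) x) else 0)"
  proof (rule sum.cong[OF refl])
    fix k assume "k \<in> {..2 * n}"
    then have k: "k \<le> 2 * n" by simp
    have *: "unglue n k ((cyc ^^ m) (embed k x)) =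
      (if k = 2 * n + 1 - m then - ((-1) ^ m * (rot ^^ m) x) else 0)" if "x \<in> dyck_span n" for x
    proof -
      have "unglue n k ((cyc ^^ m) (embed k x)) = unglue n k ((cyc ^^ (m + k)) (x * cls * cls))"
        unfolding embed_def funpow_add o_apply
        by (rule unglue_contract_der[OF cyc_pow_frags[OF dy_cls_cls_frags[OF that]]])
      also have "\<dots> = (if m + k = 2 * n + 1 then (-1) ^ (2 * n - k) * (rot ^^ m) x else 0)"
        using unglue_cyc[OF that k, of "m + k"] assms unfolding diff_add_inverse2 by simp
      also have "\<dots> = (if k = 2 * n + 1 - m then - ((-1) ^ m * (rot ^^ m) x) else 0)"
      proof (cases "m + k = 2 * n + 1")
        case True
        then have "m = Suc (2 * n - k)" using k by simp
        then have "(-1 :: walg) ^ m = - ((-1) ^ (2 * n - k))" by (simp only: power_Suc) simp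
        then show ?thesis using True by auto
      next
        case False
        then show ?thesis using assms by auto
      qed
      finally show ?thesis .
    qed
    show "frag_trace ?D (\<lambda>x. unglue n k ((cyc ^^ m) (embed k x))) =
      (if k = 2 * n + 1 - m then - frag_trace ?D (\<lambda>x. (-1) ^ m * (rot ^^ m) x) else 0)"
    proof (cases "k = 2 * n + 1 - m")
      case True
      have "frag_trace ?D (\<lambda>x. unglue n k ((cyc ^^ m) (embed k x))) =
        frag_trace ?D (\<lambda>x. - ((-1) ^ m * (rot ^^ m) x))"
        by (rule frag_trace_cong, subst *[OF d]) (simp_all add: True)
      then show ?thesis using True by (simp add: frag_trace_linear)
    next
      case False
      then have "frag_trace ?D (\<lambda>x. unglue n k ((cyc ^^ m) (embed k x))) = frag_trace ?D (\<lambda>x. 0)"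
        by (intro frag_trace_cong, subst *[OF d]) simp_all
      then show ?thesis using False by (simp add: frag_trace_def)
    qed
  qed
  also have "\<dots> = - frag_trace ?D (\<lambda>x. (-1) ^ m * (rot ^^ m) x)"
    using assms by simp
  finally show ?thesis .
qed

section \<open>Traces of rotations on words\<close>

text \<open>\<open>contract o der\<close> and \<open>der o contract\<close> are complementary
  projections. Moving \<open>contract\<close> around the trace turns the second one, for
  \<open>i + 1\<close> openers, into the first one for \<open>i\<close>, hence the alternating
  sum.\<close>

lemma trace_contract_der:
  "frag_trace (words (Suc M) n) (\<lambda>x. (cyc ^^ m) (contract (der x))) =
    (\<Sum>i\<le>n. (-1) ^ (n - i) * frag_trace (words (Suc M) i) (cyc ^^ m))"
proof (induction n)
  have cp: "additive_on_frags (cyc ^^ m)" by (rule additive_on_frags_pow[OF additive_cyc])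
  have split: "frag_trace (words (Suc M) i) (cyc ^^ m) =
      frag_trace (words (Suc M) i) (\<lambda>x. (cyc ^^ m) (contract (der x))) +
      frag_trace (words (Suc M) i) (\<lambda>x. (cyc ^^ m) (der (contract x)))" for i
  proof -
    have "frag_trace (words (Suc M) i) (cyc ^^ m) = frag_trace (words (Suc M) i)
       (\<lambda>x. (cyc ^^ m) (contract (der x)) + (cyc ^^ m) (der (contract x)))"
    proof (rule frag_trace_cong)
      fix w assume "w \<in> words (Suc M) i"
      then have "contract (der (frag_of w)) + der (contract (frag_of w)) = frag_of w"
        by (intro homotopy[of _ M i]) (simp add: keys_frag_of)
      then show "(cyc ^^ m) (frag_of w) =
        (cyc ^^ m) (contract (der (frag_of w))) + (cyc ^^ m) (der (contract (frag_of w)))"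
        by (simp only: additive_on_fragsD(4)[OF cp, symmetric])
    qed
    then show ?thesis by (simp add: frag_trace_linear)
  qed
  {
    case 0
    have "frag_trace (words (Suc M) 0) (\<lambda>x. (cyc ^^ m) (der (contract x))) =
      frag_trace (words (Suc M) 0) (\<lambda>x. 0)"
      by (rule frag_trace_cong) (simp add: contract_word(2) additive_on_fragsD[OF cp])
    then show ?case using split[of 0] by (simp add: frag_trace_def)
  next
    case (Suc n)
    have "frag_trace (words (Suc M) (Suc n)) (\<lambda>x. (cyc ^^ m) (der (contract x))) =
      frag_trace (words (Suc M) n) (\<lambda>x. contract ((cyc ^^ m) (der x)))"
    proof (rule frag_trace_commute)
      show "contract (frag_of w) \<in> frags (words (Suc M) n)" if "w \<in> words (Suc M) (Suc n)" for w
        by (rule contract_frags') (use that in \<open>simp add: keys_frag_of\<close>)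
      show "(cyc ^^ m) (der (frag_of w)) \<in> frags (words (Suc M) (Suc n))" if "w \<in> words (Suc M) n" for w
        by (rule cyc_pow_frags[OF der_word[OF that]])
      show "additive_on_frags (\<lambda>x. (cyc ^^ m) (der x))"
        by (rule additive_on_frags_compose[OF additive_maps(2) cp])
    qed (simp_all add: additive_contract)
    also have "\<dots> = frag_trace (words (Suc M) n) (\<lambda>x. contract (der ((cyc ^^ m) x)))"
      by (simp add: cyc_pow_der)
    also have "\<dots> = frag_trace (words (Suc M) n) (\<lambda>x. (cyc ^^ m) (contract (der x)))"
    proof (rule frag_trace_commute)
      show "(cyc ^^ m) (frag_of w) \<in> frags (words (Suc M) n)" if "w \<in> words (Suc M) n" for w
        by (rule cyc_pow_frags) (use that in \<open>simp add: keys_frag_of\<close>)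
      show "contract (der (frag_of w)) \<in> frags (words (Suc M) n)" if "w \<in> words (Suc M) n" for w
        by (rule contract_frags'[OF der_word[OF that]])
      show "additive_on_frags (\<lambda>x. contract (der x))"
        by (rule additive_on_frags_compose[OF additive_maps(2) additive_contract])
    qed (simp_all add: cp)
    finally have "frag_trace (words (Suc M) (Suc n)) (\<lambda>x. (cyc ^^ m) (contract (der x))) =
      frag_trace (words (Suc M) (Suc n)) (cyc ^^ m) -
      (\<Sum>i\<le>n. (-1) ^ (n - i) * frag_trace (words (Suc M) i) (cyc ^^ m))"
      using split[of "Suc n"] Suc.IH by simp
    also have "\<dots> = (\<Sum>i\<le>Suc n. (-1) ^ (Suc n - i) * frag_trace (words (Suc M) i) (cyc ^^ m))"
      by (simp add: Suc_diff_le flip: sum_negf)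
    finally show ?case .
  }
qed

lemma trace_cyc_pow:
  assumes "m \<le> N"
  shows "frag_trace (words N i) (cyc ^^ m) =
    (\<Sum>w | w \<in> words N i \<and> drop m w @ take m w = w. (-1) ^ (opens (take m w) * opens (drop m w)))"
proof -
  have "Poly_Mapping.lookup ((-1) ^ k * frag_of v) w = (if v = w then (-1) ^ k else 0)"
    for k and v w :: "bool list"
    by (cases "even k") auto
  then have "frag_trace (words N i) (cyc ^^ m) = (\<Sum>w\<in>words N i.
      if drop m w @ take m w = w then (-1) ^ (opens (take m w) * opens (drop m w)) else 0)"
    unfolding frag_trace_def by (intro sum.cong refl) (simp add: cyc_pow_word[OF _ assms])
  then show ?thesis by (simp add: sum.inter_filter[symmetric] cong: conj_cong)
qed

lemma commuting_power:
  "z @ v = v @ z \<Longrightarrow> length v = k * length z \<Longrightarrow> v = concat (replicate k z)"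
proof (induction k arbitrary: v)
  case (Suc k)
  have "take (length z) v = take (length z) (v @ z)" using Suc.prems(2) by simp
  also have "\<dots> = z" unfolding Suc.prems(1)[symmetric] by simp
  finally have "take (length z) v = z" .
  then obtain v' where v': "v = z @ v'" by (metis append_take_drop_id)
  then have "z @ v' = v' @ z" "length v' = k * length z" using Suc.prems by auto
  then show ?case using Suc.IH v' by simp
qed simp

lemma length_concat_replicate: "length (concat (replicate k z)) = k * length z"
  by (induction k) auto

lemma opens_concat_replicate: "opens (concat (replicate k z)) = k * opens z"
  by (induction k) auto

text \<open>By Bezout, a word fixed by rotation by \<open>m\<close> is fixed by rotation by
  \<open>g\<close>; it then commutes with its prefix of length \<open>g\<close> and is a power of
  it.\<close>

lemma rotation_fixed_words:
  assumes "0 < m" "m < N"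
  defines "g \<equiv> gcd m N"
  shows "bij_betw (\<lambda>z. concat (replicate (N div g) z)) {z :: bool list. length z = g}
    {w. length w = N \<and> drop m w @ take m w = w}"
proof (rule bij_betw_imageI)
  let ?e = "N div g" and ?k = "m div g"
  have g: "0 < g" "g \<le> m" using assms by (auto simp: g_def intro: dvd_imp_le)
  have N: "?e * g = N" and m: "?k * g = m" by (simp_all add: g_def)
  have ke: "?k \<le> ?e" using assms(2) by (simp add: div_le_mono)
  have e: "0 < ?e" using N assms by (metis gr_zeroI mult_0 not_less_zero)
  have rep: "concat (replicate ?e z) = concat (replicate ?k z) @ concat (replicate (?e - ?k) z)" for z :: "bool list"
    using ke by (simp flip: concat_append replicate_add)
  have rep': "concat (replicate ?e z) = concat (replicate (?e - ?k) z) @ concat (replicate ?k z)" for z :: "bool list"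
    using ke by (simp flip: concat_append replicate_add)
  show "inj_on (\<lambda>z. concat (replicate ?e z)) {z :: bool list. length z = g}"
  proof (rule inj_onI)
    fix z z' :: "bool list"
    assume "z \<in> {z :: bool list. length z = g}" "z' \<in> {z :: bool list. length z = g}"
      "concat (replicate ?e z) = concat (replicate ?e z')"
    then show "z = z'" using e by (cases ?e) auto
  qed
  show "(\<lambda>z. concat (replicate ?e z)) ` {z :: bool list. length z = g} = {w. length w = N \<and> drop m w @ take m w = w}"
  proof (intro subset_antisym subsetI)
    fix w assume "w \<in> (\<lambda>z. concat (replicate ?e z)) ` {z :: bool list. length z = g}"
    then obtain z where z: "length z = g" and w: "w = concat (replicate ?e z)" by auto
    have len: "length (concat (replicate ?k z)) = m" using z m by (simp add: length_concat_replicate)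
    have "take m w = concat (replicate ?k z)" "drop m w = concat (replicate (?e - ?k) z)"
      unfolding w rep using len by simp_all
    then have "drop m w @ take m w = w" using rep' w by simp
    moreover have "length w = N" using w z N by (simp add: length_concat_replicate)
    ultimately show "w \<in> {w. length w = N \<and> drop m w @ take m w = w}" by simp
  next
    fix w :: "bool list" assume "w \<in> {w. length w = N \<and> drop m w @ take m w = w}"
    then have len: "length w = N" and fix_m: "rotate m w = w"
      using assms by (auto simp: rotate_drop_take)
    have "rotate (m * x) w = w" for x
      by (induction x) (simp_all add: fix_m flip: rotate_rotate)
    moreover obtain x y where xy: "m * x = N * y + g"
      using bezout_nat[of m N] assms(1) by (auto simp: g_def)
    ultimately have "rotate (N * y + g) w = w" by metis
    then have "rotate g w = w"
      using rotate_conv_mod[of "N * y + g" w] rotate_conv_mod[of g w] len by simp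
    then have "drop g w @ take g w = w" using g(2) assms(2) len by (simp add: rotate_drop_take)
    then have comm: "take g w @ drop g w = drop g w @ take g w" by simp
    have l: "length (take g w) = g" using g assms len by simp
    have "length (drop g w) = (?e - 1) * length (take g w)"
      using len l N by (simp add: diff_mult_distrib)
    from commuting_power[OF comm this]
    have "w = take g w @ concat (replicate (?e - 1) (take g w))" by (metis append_take_drop_id)
    also have "\<dots> = concat (replicate ?e (take g w))" using e by (cases ?e) auto
    finally show "w \<in> (\<lambda>z. concat (replicate ?e z)) ` {z :: bool list. length z = g}" using l by blast
  qed
qed

text \<open>Grouped by the number of openers, this is a truncated alternating sum of row
  \<open>g + 1\<close> of Pascal's triangle. Splitting by the first letter is Pascal's rule.\<close>

lemma alternating_word_sum:
  "(\<Sum>z | length z = Suc g \<and> opens z \<le> J. (-1) ^ opens z) = (-1) ^ J * int (g choose J)"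
proof -
  have fin: "finite {z :: bool list. length z = g \<and> P z}" for P g
  proof (rule finite_subset)
    show "finite {z. set z \<subseteq> (UNIV :: bool set) \<and> length z = g}" by (rule finite_lists_length_eq) simp
  qed auto
  have rec: "(\<Sum>z | length z = Suc g \<and> opens z \<le> J. (-1 :: int) ^ opens z) =
      (\<Sum>z | length z = g \<and> opens z \<le> J. (-1) ^ opens z) -
      (\<Sum>z | length z = g \<and> Suc (opens z) \<le> J. (-1) ^ opens z)" for g J
  proof -
    have "{z. length z = Suc g \<and> opens z \<le> J} =
        (#) False ` {z. length z = g \<and> opens z \<le> J} \<union> (#) True ` {z. length z = g \<and> Suc (opens z) \<le> J}"
      (is "?L = ?R")
    proof (rule Set.set_eqI)
      fix z show "z \<in> ?L \<longleftrightarrow> z \<in> ?R" by (cases z) (auto simp: image_iff)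
    qed
    moreover have "(\<Sum>z\<in>?R. (-1 :: int) ^ opens z) =
        (\<Sum>z\<in>(#) False ` {z. length z = g \<and> opens z \<le> J}. (-1) ^ opens z) +
        (\<Sum>z\<in>(#) True ` {z. length z = g \<and> Suc (opens z) \<le> J}. (-1) ^ opens z)"
      by (rule sum.union_disjoint) (auto intro!: finite_imageI fin)
    ultimately show ?thesis by (simp add: sum.reindex sum_negf)
  qed
  show ?thesis
  proof (induction g arbitrary: J)
    case 0
    have *: "{z :: bool list. length z = 0 \<and> opens z \<le> J} = {[]}" for J by auto
    have **: "{z :: bool list. length z = 0 \<and> Suc (opens z) \<le> J} = (if J = 0 then {} else {[]})" for J by auto
    show ?case unfolding rec * ** by (cases J) auto
  next
    case (Suc g)
    show ?case
    proof (cases J)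
      case 0
      then show ?thesis using Suc[of 0] by (subst rec) simp
    next
      case (Suc J')
      have "{z :: bool list. length z = Suc g \<and> Suc (opens z) \<le> J} = {z. length z = Suc g \<and> opens z \<le> J'}"
        using Suc by auto
      then show ?thesis using Suc.IH[of J] Suc.IH[of J'] \<open>J = Suc J'\<close>
        by (subst rec) (simp add: algebra_simps)
    qed
  qed
qed

text \<open>A fixed word is \<open>z\<close> repeated \<open>?e\<close> times, so at most
  \<open>n\<close> openers in it means at most \<open>n div ?e\<close> in \<open>z\<close>, and
  \<open>alternating_word_sum\<close> applies.\<close>

lemma alternating_trace_cyc:
  assumes "0 < m" "m < 2 * n + 2"
  defines "g \<equiv> gcd m (2 * n + 2)"
  shows "(\<Sum>i\<le>n. (-1) ^ (n - i) * frag_trace (words (2 * n + 2) i) (cyc ^^ m)) =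
    (-1) ^ (n + (g - 1) div 2) * int ((g - 1) choose ((g - 1) div 2))"
proof -
  let ?N = "2 * n + 2"
  let ?e = "?N div g" and ?k = "m div g"
  define F where "F = {w :: bool list. length w = ?N \<and> drop m w @ take m w = w}"
  have g: "0 < g" "g \<le> m" using assms by (auto simp: g_def intro: dvd_imp_le)
  have N: "?e * g = ?N" and m: "?k * g = m" by (simp_all add: g_def)
  have ke: "?k < ?e"
  proof -
    have "?k * g < ?e * g" unfolding N m using assms by simp
    then show ?thesis by simp
  qed
  have finF: "finite F"
  proof (rule finite_subset)
    show "finite {z. set z \<subseteq> (UNIV :: bool set) \<and> length z = ?N}" by (rule finite_lists_length_eq) simp
  qed (auto simp: F_def)
  let ?s = "\<lambda>w. (-1 :: int) ^ (opens (take m w) * opens (drop m w))"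
  have "(\<Sum>i\<le>n. (-1) ^ (n - i) * frag_trace (words ?N i) (cyc ^^ m)) =
      (\<Sum>i\<le>n. \<Sum>w | w \<in> F \<and> opens w = i. (-1) ^ (n - opens w) * ?s w)"
  proof (rule sum.cong[OF refl])
    fix i
    have "{w. w \<in> words ?N i \<and> drop m w @ take m w = w} = {w. w \<in> F \<and> opens w = i}"
      by (auto simp: words_def F_def)
    then show "(-1) ^ (n - i) * frag_trace (words ?N i) (cyc ^^ m) =
        (\<Sum>w | w \<in> F \<and> opens w = i. (-1) ^ (n - opens w) * ?s w)"
      using trace_cyc_pow[of m ?N i] assms by (simp add: sum_distrib_left)
  qed
  also have "\<dots> = (\<Sum>w\<in>(\<Union>i\<in>{..n}. {w. w \<in> F \<and> opens w = i}). (-1) ^ (n - opens w) * ?s w)"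
    by (rule sum.UNION_disjoint[symmetric]) (auto intro: finite_subset[OF _ finF])
  also have "(\<Union>i\<in>{..n}. {w. w \<in> F \<and> opens w = i}) = {w \<in> F. opens w \<le> n}" by auto
  also have "(\<Sum>w\<in>{w \<in> F. opens w \<le> n}. (-1) ^ (n - opens w) * ?s w) =
      (\<Sum>z | length z = g \<and> opens z \<le> n div ?e. (-1) ^ n * (-1) ^ opens z)"
  proof -
    have bij: "bij_betw (\<lambda>z. concat (replicate ?e z)) {z. length z = g} F"
      using rotation_fixed_words[OF assms(1,2)] by (simp add: F_def g_def)
    have le: "?e * o' \<le> n \<longleftrightarrow> o' \<le> n div ?e" for o'
      using ke by (simp add: less_eq_div_iff_mult_less_eq mult.commute)
    have "bij_betw (\<lambda>z. concat (replicate ?e z)) {z. length z = g \<and> opens z \<le> n div ?e}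
        {w \<in> F. opens w \<le> n}"
      unfolding bij_betw_def
    proof
      show "inj_on (\<lambda>z. concat (replicate ?e z)) {z. length z = g \<and> opens z \<le> n div ?e}"
        by (rule inj_on_subset[OF bij_betw_imp_inj_on[OF bij]]) auto
      have "F = (\<lambda>z. concat (replicate ?e z)) ` {z. length z = g}" using bij by (simp add: bij_betw_def)
      then show "(\<lambda>z. concat (replicate ?e z)) ` {z. length z = g \<and> opens z \<le> n div ?e} =
        {w \<in> F. opens w \<le> n}"
        using le by (auto simp: opens_concat_replicate)
    qed
    from sum.reindex_bij_betw[OF this, of "\<lambda>w. (-1) ^ (n - opens w) * ?s w"]
    have "(\<Sum>w\<in>{w \<in> F. opens w \<le> n}. (-1) ^ (n - opens w) * ?s w) =
      (\<Sum>z | length z = g \<and> opens z \<le> n div ?e.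
        (-1) ^ (n - opens (concat (replicate ?e z))) * ?s (concat (replicate ?e z)))" by (rule sym)
    also have "\<dots> =
      (\<Sum>z | length z = g \<and> opens z \<le> n div ?e. (-1) ^ n * (-1) ^ opens z)"
    proof (rule sum.cong[OF refl])
      fix z :: "bool list" assume "z \<in> {z. length z = g \<and> opens z \<le> n div ?e}"
      then have z: "length z = g" "?e * opens z \<le> n" using le by auto
      let ?w = "concat (replicate ?e z)"
      have rep: "?w = concat (replicate ?k z) @ concat (replicate (?e - ?k) z)"
        using ke by (simp flip: concat_append replicate_add)
      have len: "length (concat (replicate ?k z)) = m" using z m by (simp add: length_concat_replicate)
      have tw: "take m ?w = concat (replicate ?k z)" and dw: "drop m ?w = concat (replicate (?e - ?k) z)"
        unfolding rep using len by simp_all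
      \<comment> \<open>As \<open>?k\<close> and \<open>?e\<close> are not both even, the rotation
        sign and the alternating sign together depend only on the parity of
        \<open>n + opens z\<close>.\<close>
      have "coprime ?k ?e" using g(1) by (simp add: g_def div_gcd_coprime)
      then have cop: "odd ?k \<or> odd ?e" by (meson coprime_common_divisor odd_one)
      have "even (n - ?e * opens z + ?k * opens z * ((?e - ?k) * opens z)) \<longleftrightarrow> even (n + opens z)"
        using cop ke z by (auto simp: even_diff_nat)
      then show "(-1) ^ (n - opens ?w) * ?s ?w = (-1) ^ n * (-1) ^ opens z"
        unfolding tw dw opens_concat_replicate power_add[symmetric]
        by (simp add: minus_one_power_iff)
    qed
    finally show ?thesis .
  qed
  also have "\<dots> = (-1) ^ n * (\<Sum>z | length z = Suc (g - 1) \<and> opens z \<le> n div ?e. (-1) ^ opens z)"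
    using g(1) by (simp add: sum_distrib_left)
  also have "\<dots> = (-1) ^ n * ((-1) ^ (n div ?e) * int ((g - 1) choose (n div ?e)))"
    unfolding alternating_word_sum ..
  \<comment> \<open>From \<open>?e * g = 2 * n + 2\<close>: for \<open>g = 2 * h\<close>,
    \<open>n\<close> is one less than \<open>?e * h\<close>. For odd \<open>g = 2 * h + 1\<close>,
    \<open>?e\<close> is even and \<open>n\<close> exceeds \<open>?e * h\<close> by
    \<open>?e div 2 - 1\<close>.\<close>
  also have "n div ?e = (g - 1) div 2"
  proof (cases "even g")
    case True
    then obtain h where h: "g = 2 * h" by auto
    then have "Suc n = ?e * h" using N by simp
    moreover have "0 < h" using g h by simp
    ultimately have "n = ?e * (h - 1) + (?e - 1)" using ke by (cases h) auto
    then have "n div ?e = h - 1" using ke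
      by (metis (no_types) add_0_right diff_less div_less div_mult_self4 less_nat_zero_code
          less_numeral_extra(1) not_less_zero gr_zeroI)
    then show ?thesis using h by simp
  next
    case False
    then obtain h where h: "g = 2 * h + 1" by (auto elim: oddE)
    have "even (?e * g)" unfolding N by simp
    then obtain f where f: "?e = 2 * f" using False by auto
    have "2 * f * g = 2 * n + 2" using N unfolding f .
    then have "2 * Suc n = 2 * (f * (2 * h + 1))" unfolding h by (simp add: algebra_simps)
    then have n: "Suc n = f * (2 * h + 1)" by (metis mult_cancel1 zero_neq_numeral)
    have "0 < f" using ke f by simp
    with n have "n div (2 * f) = h" by (intro div_nat_eqI) (simp_all add: algebra_simps)
    then show ?thesis using h f by simp
  qed
  finally show ?thesis by (simp add: power_add mult.assoc)
qed

section \<open>Conjugacy of the Coxeter matrix with a signed rotation\<close>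

lemma extend_rot: "v \<in> frags (Yset n) \<Longrightarrow>
  rot (frag_extend oddtree v) = (-1) ^ n * frag_extend eventree v"
  by (rule frags_additive_eqI[of "\<lambda>v. rot (frag_extend oddtree v)" "\<lambda>v. (-1) ^ n * frag_extend eventree v"])
    (auto intro!: additive_on_frags_compose[OF additive_frag_extend additive_maps(1)]
      additive_signed additive_frag_extend simp: eventree_def Yset_def simp flip: power_add mult.assoc)

lemma oddtree_graft: "oddtree (Graft l r) = opn * eventree l * cls * oddtree r"
  by (simp add: eventree_def)

lemma extend_graft:
  assumes "u \<in> frags (Yset a)" "v \<in> frags (Yset b)"
  shows "\<exists>w \<in> frags (Yset (Suc (a + b))).
    opn * frag_extend eventree u * cls * frag_extend oddtree v = frag_extend oddtree w"
  using assms(1) unfolding mem_Collect_eq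
proof (induction u rule: frag_induction)
  case (one s)
  show ?case using assms(2) unfolding mem_Collect_eq
  proof (induction v rule: frag_induction)
    case (one t)
    show ?case
      by (rule bexI[of _ "frag_of (Graft s t)"])
        (use \<open>s \<in> Yset a\<close> \<open>t \<in> Yset b\<close> in \<open>simp_all add: oddtree_graft Yset_def keys_frag_of del: oddtree.simps\<close>)
  next
    case (diff x y)
    then obtain w w' where "w \<in> frags (Yset (Suc (a + b)))" "w' \<in> frags (Yset (Suc (a + b)))"
      "opn * frag_extend eventree (frag_of s) * cls * frag_extend oddtree x = frag_extend oddtree w"
      "opn * frag_extend eventree (frag_of s) * cls * frag_extend oddtree y = frag_extend oddtree w'"
      by blast
    then show ?case
      using frags_closed(2)[of w "Yset (Suc (a + b))" w']
      by (intro bexI[of _ "w - w'"]) (simp_all add: frag_extend_diff right_diff_distrib)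
  qed (auto intro: bexI[of _ 0])
next
  case (diff x y)
  then obtain w w' where "w \<in> frags (Yset (Suc (a + b)))" "w' \<in> frags (Yset (Suc (a + b)))"
    "opn * frag_extend eventree x * cls * frag_extend oddtree v = frag_extend oddtree w"
    "opn * frag_extend eventree y * cls * frag_extend oddtree v = frag_extend oddtree w'"
    by blast
  then show ?case
    using frags_closed(2)[of w "Yset (Suc (a + b))" w']
    by (intro bexI[of _ "w - w'"]) (simp_all add: frag_extend_diff right_diff_distrib left_diff_distrib)
qed (auto intro: bexI[of _ 0])

text \<open>As \<open>rot\<close> is invertible on Dyck spans, the left subtree can be expanded in
  rotated \<open>oddtree\<close> elements, that is, in \<open>eventree\<close> elements, which is
  what the recursion of \<open>oddtree\<close> asks for.\<close>

lemma oddtree_spans: "x \<in> dyck_span n \<Longrightarrow> \<exists>v \<in> frags (Yset n). x = frag_extend oddtree v"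
proof (induction n arbitrary: x rule: less_induct)
  case (less n)
  from less.prems show ?case
  proof (induction x rule: dyck_span_induct)
    case (tree t)
    show ?case
    proof (cases t)
      case Triv
      then show ?thesis using tree
        by (intro bexI[of _ "frag_of Triv"]) (simp_all add: dy_simps Yset_0 keys_frag_of)
    next
      case (Graft l r)
      let ?a = "internal l" and ?b = "internal r"
      have lt: "?a < n" "?b < n" using tree Graft by auto
      \<comment> \<open>The preimage of \<open>dy l\<close> under \<open>rot\<close>, whose period
        here is \<open>2 * ?a + 2\<close>.\<close>
      have "(rot ^^ (2 * ?a + 1)) (dy l) \<in> dyck_span ?a" by (intro rot_pow_in_span dy_in_span refl)
      then obtain u where u: "u \<in> frags (Yset ?a)" "(rot ^^ (2 * ?a + 1)) (dy l) = frag_extend oddtree u"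
        using less.IH[OF lt(1)] by blast
      have "dy l = rot ((rot ^^ (2 * ?a + 1)) (dy l))"
        using rot_period[OF dy_in_span[OF refl], of l] by simp
      then have l: "dy l = (-1) ^ ?a * frag_extend eventree u"
        unfolding u(2) extend_rot[OF u(1)] .
      obtain v where v: "v \<in> frags (Yset ?b)" "dy r = frag_extend oddtree v"
        using less.IH[OF lt(2) dy_in_span[OF refl]] by blast
      obtain w where w: "w \<in> frags (Yset (Suc (?a + ?b)))"
        "opn * frag_extend eventree u * cls * frag_extend oddtree v = frag_extend oddtree w"
        using extend_graft[OF u(1) v(1)] by blast
      have "dy t = (-1) ^ ?a * frag_extend oddtree w"
        unfolding Graft dy_simps l v(2) w(2)[symmetric] by (cases "even ?a") simp_all
      also have "\<dots> = frag_extend oddtree (if even ?a then w else - w)"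
        by (simp add: frag_extend_minus)
      finally show ?thesis
        using w(1) tree Graft by (intro bexI[of _ "if even ?a then w else - w"]) auto
    qed
  next
    case (diff x y)
    then obtain v w where "v \<in> frags (Yset n)" "w \<in> frags (Yset n)"
      "x = frag_extend oddtree v" "y = frag_extend oddtree w" by blast
    then show ?case
      using frags_closed(2)[of v "Yset n" w] by (intro bexI[of _ "v - w"]) (simp_all add: frag_extend_diff)
  qed (auto intro: bexI[of _ 0])
qed

definition mtrace :: "'a::semiring_1 mat \<Rightarrow> 'a" where
  "mtrace A = (\<Sum>i<dim_row A. A $$ (i, i))"

lemma mtrace_mult_commute:
  fixes A B :: "'a::comm_semiring_1 mat"
  assumes "A \<in> carrier_mat n m" "B \<in> carrier_mat m n"
  shows "mtrace (A * B) = mtrace (B * A)"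
proof -
  have "mtrace (A * B) = (\<Sum>i<n. \<Sum>j<m. A $$ (i, j) * B $$ (j, i))"
    using assms by (simp add: mtrace_def scalar_prod_def atLeast0LessThan)
  also have "\<dots> = (\<Sum>j<m. \<Sum>i<n. B $$ (j, i) * A $$ (i, j))"
    by (subst sum.swap) (simp add: mult.commute)
  also have "\<dots> = mtrace (B * A)"
    using assms by (simp add: mtrace_def scalar_prod_def atLeast0LessThan)
  finally show ?thesis .
qed

lemma int_mat_left_inverse:
  fixes A B :: "int mat"
  assumes "A \<in> carrier_mat n n" "B \<in> carrier_mat n n" "A * B = 1\<^sub>m n"
  shows "B * A = 1\<^sub>m n"
proof (rule eq_matI)
  fix i j assume "i < dim_row (1\<^sub>m n :: int mat)" "j < dim_col (1\<^sub>m n :: int mat)"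
  then have ij: "i < n" "j < n" by simp_all
  have inv: "(\<Sum>k\<in>{..<n}. A $$ (i, k) * B $$ (k, j)) = (if i = j then 1 else 0)"
    if "i \<in> {..<n}" "j \<in> {..<n}" for i j
    using arg_cong[OF assms(3), of "\<lambda>M. M $$ (i, j)"] that assms(1,2)
    by (simp add: scalar_prod_def atLeast0LessThan)
  have "(\<Sum>k\<in>{..<n}. B $$ (i, k) * A $$ (k, j)) = (if i = j then 1 else 0)"
    by (rule square_left_inverse[where I = "{..<n}" and b = "\<lambda>i j. A $$ (i, j)"]) (use inv ij in auto)
  with ij show "(B * A) $$ (i, j) = 1\<^sub>m n $$ (i, j)"
    using assms(1,2) by (simp add: scalar_prod_def atLeast0LessThan)
qed (use assms in simp_all)

text \<open>The columns of \<open>Z\<close> are the dimension vectors of the projectives, those of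
  its transpose belong to the injectives, so \<open>M\<close> is the Coxeter matrix. The identity of
  sums reads: \<open>E * Z\<close> equals \<open>B\<close> times the transpose of \<open>Z\<close>.
  As \<open>E\<close> is \<open>S * B\<close> up to sign, cancelling \<open>Z\<close> makes
  \<open>M\<close> conjugate to a signed \<open>S\<close>; \<open>B\<close> is invertible because
  the \<open>oddtree\<close> elements span.\<close>

lemma trace_coxeter_matrix:
  fixes M Y :: "int mat"
  assumes xs: "distinct xs" "set xs = Yset n"
  defines "c \<equiv> length xs"
  defines "Z \<equiv> mat c c (\<lambda>(i, j). if tamari_le (xs ! i) (xs ! j) then 1 else 0 :: int)"
  assumes M: "M \<in> carrier_mat c c" "M * Z = - transpose_mat Z"
    and Y: "Y \<in> carrier_mat c c" "Z * Y = 1\<^sub>m c"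
  shows "mtrace (M ^\<^sub>m k) = (-1) ^ (k * (n + 1)) * frag_trace (dyck ` Yset n) (rot ^^ k)"
proof -
  let ?lk = Poly_Mapping.lookup
  have xsY: "xs ! i \<in> Yset n" if "i < c" for i
    using nth_mem[of i xs] that unfolding c_def xs(2) .
  have nth_eq: "xs ! i = xs ! j \<longleftrightarrow> i = j" if "i < c" "j < c" for i j
    using nth_eq_iff_index_eq[OF xs(1), of i j] that unfolding c_def .
  have bij: "bij_betw (\<lambda>i. xs ! i) {..<c} (Yset n)"
    using bij_betw_nth[OF xs(1) _ xs(2)[symmetric], of "{..<c}"] unfolding c_def by simp
  have bijD: "bij_betw (\<lambda>i. dyck (xs ! i)) {..<c} (dyck ` Yset n)"
  proof -
    have "bij_betw dyck (Yset n) (dyck ` Yset n)"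
      by (rule inj_on_imp_bij_betw[OF inj_on_subset[OF inj_dyck]]) simp
    from bij_betw_trans[OF bij this] show ?thesis by (simp add: o_def)
  qed
  define B where "B = mat c c (\<lambda>(i, j). ?lk (oddtree (xs ! j)) (dyck (xs ! i)))"
  define E where "E = mat c c (\<lambda>(i, j). ?lk (eventree (xs ! j)) (dyck (xs ! i)))"
  define S where "S = mat c c (\<lambda>(i, j). ?lk (rot (dy (xs ! j))) (dyck (xs ! i)))"
  have car: "B \<in> carrier_mat c c" "E \<in> carrier_mat c c" "S \<in> carrier_mat c c" "Z \<in> carrier_mat c c"
    by (simp_all add: B_def E_def S_def Z_def)
  have span: "x \<in> frags (dyck ` Yset n)" if "x \<in> dyck_span n" for x
    using that by (simp add: dyck_span_def)
  have spanY: "oddtree (xs ! i) \<in> dyck_span n" "dy (xs ! i) \<in> dyck_span n" if "i < c" for i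
    using oddtree_in_span[of "xs ! i"] dy_in_span[of "xs ! i" n] xsY[OF that] by (auto simp: Yset_def)
  have expand: "?lk (f x) w = (\<Sum>k<c. ?lk (f (dy (xs ! k))) w * ?lk x (dyck (xs ! k)))"
    if "additive_on_frags f" "x \<in> dyck_span n" for f :: "walg \<Rightarrow> walg" and x w
  proof -
    have "?lk (f x) w = (\<Sum>v\<in>dyck ` Yset n. ?lk x v * ?lk (f (frag_of v)) w)"
      by (rule lookup_additive[OF that(1) _ span[OF that(2)]]) simp
    also have "\<dots> = (\<Sum>k<c. ?lk x (dyck (xs ! k)) * ?lk (f (frag_of (dyck (xs ! k)))) w)"
      by (rule sum.reindex_bij_betw[OF bijD, symmetric])
    finally show ?thesis by (simp add: dy_def mult.commute)
  qed
  obtain C where C: "C \<in> carrier_mat c c" "B * C = 1\<^sub>m c"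
  proof -
    have "\<forall>j\<in>{..<c}. \<exists>v. v \<in> frags (Yset n) \<and> dy (xs ! j) = frag_extend oddtree v"
      using oddtree_spans spanY(2) by blast
    then obtain v where v: "\<And>j. j < c \<Longrightarrow> v j \<in> frags (Yset n)"
      "\<And>j. j < c \<Longrightarrow> dy (xs ! j) = frag_extend oddtree (v j)"
      unfolding bchoice_iff by auto
    define C where "C = mat c c (\<lambda>(i, j). ?lk (v j) (xs ! i))"
    have "B * C = 1\<^sub>m c"
    proof (rule eq_matI)
      fix i j assume "i < dim_row (1\<^sub>m c :: int mat)" "j < dim_col (1\<^sub>m c :: int mat)"
      then have ij: "i < c" "j < c" by simp_all
      have "(B * C) $$ (i, j) = (\<Sum>k<c. ?lk (oddtree (xs ! k)) (dyck (xs ! i)) * ?lk (v j) (xs ! k))"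
        using ij by (simp add: B_def C_def scalar_prod_def atLeast0LessThan)
      also have "\<dots> = (\<Sum>t\<in>Yset n. ?lk (oddtree t) (dyck (xs ! i)) * ?lk (v j) t)"
        by (rule sum.reindex_bij_betw[OF bij])
      also have "\<dots> = ?lk (frag_extend oddtree (v j)) (dyck (xs ! i))"
        using lookup_additive[OF additive_frag_extend _ v(1)[OF ij(2)], of oddtree "dyck (xs ! i)"]
        by (simp add: mult.commute)
      also have "\<dots> = ?lk (dy (xs ! j)) (dyck (xs ! i))" using v(2)[OF ij(2)] by simp
      also have "\<dots> = 1\<^sub>m c $$ (i, j)"
        using ij inj_dyck nth_eq by (auto simp: dy_def inj_eq)
      finally show "(B * C) $$ (i, j) = 1\<^sub>m c $$ (i, j)" .
    qed (simp_all add: B_def C_def)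
    then show thesis by (intro that[of C]) (simp_all add: C_def)
  qed
  have CB: "C * B = 1\<^sub>m c" by (rule int_mat_left_inverse[OF car(1) C])
  have E: "E = (-1) ^ n \<cdot>\<^sub>m (S * B)"
  proof (rule eq_matI)
    fix i j assume "i < dim_row ((-1) ^ n \<cdot>\<^sub>m (S * B))" "j < dim_col ((-1) ^ n \<cdot>\<^sub>m (S * B))"
    then have ij: "i < c" "j < c" using car by auto
    have sgn: "?lk ((-1) ^ k * x) w = (-1) ^ k * ?lk x w" for k and x :: walg and w
      by (cases "even k") simp_all
    have "(S * B) $$ (i, j) = (\<Sum>k<c. ?lk (rot (dy (xs ! k))) (dyck (xs ! i)) * ?lk (oddtree (xs ! j)) (dyck (xs ! k)))"
      using ij by (simp add: B_def S_def scalar_prod_def atLeast0LessThan)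
    also have "\<dots> = ?lk (rot (oddtree (xs ! j))) (dyck (xs ! i))"
      using expand[OF additive_maps(1) spanY(1)[OF ij(2)]] by simp
    finally show "E $$ (i, j) = ((-1) ^ n \<cdot>\<^sub>m (S * B)) $$ (i, j)"
      using ij car xsY[OF ij(2)] by (simp add: E_def eventree_def sgn Yset_def)
  qed (use car in auto)
  have "E * Z = B * transpose_mat Z"
  proof (rule eq_matI)
    fix i j assume "i < dim_row (B * transpose_mat Z)" "j < dim_col (B * transpose_mat Z)"
    then have ij: "i < c" "j < c" using car by auto
    have j: "downset (xs ! j) \<subseteq> Yset n" "upset (xs ! j) \<subseteq> Yset n"
      using xsY[OF ij(2)] by (auto simp: downset_def upset_def Yset_def dest: tamari_le_internal)
    have "(E * Z) $$ (i, j) = (\<Sum>k<c. if xs ! k \<in> downset (xs ! j) then ?lk (eventree (xs ! k)) (dyck (xs ! i)) else 0)"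
      using ij by (simp add: E_def Z_def scalar_prod_def atLeast0LessThan downset_def if_distrib cong: if_cong)
    also have "\<dots> = (\<Sum>t\<in>Yset n. if t \<in> downset (xs ! j) then ?lk (eventree t) (dyck (xs ! i)) else 0)"
      by (rule sum.reindex_bij_betw[OF bij])
    also have "\<dots> = ?lk (\<Sum>t\<in>downset (xs ! j). eventree t) (dyck (xs ! i))"
      using j by (simp add: sum.inter_restrict[symmetric] lookup_sum Int_absorb1)
    also have "\<dots> = ?lk (\<Sum>t\<in>upset (xs ! j). oddtree t) (dyck (xs ! i))"
      by (simp only: sum_eventree_downset_eq sum_oddtree_upset_eq)
    also have "\<dots> = (\<Sum>t\<in>Yset n. if t \<in> upset (xs ! j) then ?lk (oddtree t) (dyck (xs ! i)) else 0)"
      using j by (simp add: sum.inter_restrict[symmetric] lookup_sum Int_absorb1)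
    also have "\<dots> = (\<Sum>k<c. if xs ! k \<in> upset (xs ! j) then ?lk (oddtree (xs ! k)) (dyck (xs ! i)) else 0)"
      by (rule sum.reindex_bij_betw[OF bij, symmetric])
    also have "\<dots> = (B * transpose_mat Z) $$ (i, j)"
      using ij by (simp add: B_def Z_def scalar_prod_def atLeast0LessThan upset_def if_distrib cong: if_cong)
    finally show "(E * Z) $$ (i, j) = (B * transpose_mat Z) $$ (i, j)" .
  qed (use car in auto)
  then have "B * M * Z = - (E * Z)"
    using M car by (simp add: assoc_mult_mat[of _ c c _ c _ c])
  also have "\<dots> = ((-1) ^ Suc n \<cdot>\<^sub>m (S * B)) * Z"
    unfolding E using car by (auto intro!: eq_matI)
  finally have BMZ: "B * M * Z * Y = ((-1) ^ Suc n \<cdot>\<^sub>m (S * B)) * Z * Y" by simp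
  have R: "X * Z * Y = X" if "X \<in> carrier_mat c c" for X
    using assoc_mult_mat[OF that car(4) Y(1)] Y(2) that by simp
  have BM: "B * M = (-1) ^ Suc n \<cdot>\<^sub>m (S * B)"
    using BMZ R[of "B * M"] R[of "(-1) ^ Suc n \<cdot>\<^sub>m (S * B)"] car M(1)
    by (simp only: mult_carrier_mat smult_carrier_mat)
  have pow: "B * M ^\<^sub>m k = (-1) ^ (k * (n + 1)) \<cdot>\<^sub>m (S ^\<^sub>m k * B)" for k
  proof (induction k)
    case 0
    then show ?case using car M by (auto intro!: eq_matI)
  next
    case (Suc k)
    have carp: "M ^\<^sub>m k \<in> carrier_mat c c" "S ^\<^sub>m k \<in> carrier_mat c c" using car M by simp_all
    have "B * M ^\<^sub>m Suc k = (B * M ^\<^sub>m k) * M"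
      using car M carp by (simp add: assoc_mult_mat[of _ c c _ c _ c])
    also have "\<dots> = (-1) ^ (k * (n + 1)) \<cdot>\<^sub>m (S ^\<^sub>m k * (B * M))"
    proof -
      have "((-1) ^ (k * (n + 1)) \<cdot>\<^sub>m (S ^\<^sub>m k * B)) * M = (-1) ^ (k * (n + 1)) \<cdot>\<^sub>m (S ^\<^sub>m k * B * M)"
        by (rule mult_smult_assoc_mat[of _ c c _ c]) (use car carp M(1) in \<open>auto intro!: mult_carrier_mat[of _ c c]\<close>)
      also have "S ^\<^sub>m k * B * M = S ^\<^sub>m k * (B * M)"
        by (rule assoc_mult_mat[OF carp(2) car(1) M(1)])
      finally show ?thesis unfolding Suc .
    qed
    also have "\<dots> = (-1) ^ (k * (n + 1)) \<cdot>\<^sub>m ((-1) ^ (n + 1) \<cdot>\<^sub>m (S ^\<^sub>m k * (S * B)))"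
      unfolding BM Suc_eq_plus1
      by (subst mult_smult_distrib[OF carp(2), of _ c]) (use car in \<open>auto intro!: mult_carrier_mat[of _ c c]\<close>)
    also have "\<dots> = (-1) ^ (Suc k * (n + 1)) \<cdot>\<^sub>m (S ^\<^sub>m Suc k * B)"
      using car carp by (auto intro!: eq_matI simp: power_add mult_ac assoc_mult_mat[of _ c c _ c _ c])
    finally show ?case .
  qed
  have S_pow: "(S ^\<^sub>m k) $$ (i, j) = ?lk ((rot ^^ k) (dy (xs ! j))) (dyck (xs ! i))" if "i < c" "j < c" for i j k
    using that
  proof (induction k arbitrary: i j)
    case 0
    then show ?case using inj_dyck nth_eq car by (auto simp: dy_def inj_eq)
  next
    case (Suc k)
    have "(S ^\<^sub>m Suc k) $$ (i, j) = (\<Sum>l<c. (S ^\<^sub>m k) $$ (i, l) * S $$ (l, j))"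
      using Suc.prems car by (simp add: scalar_prod_def atLeast0LessThan)
    also have "\<dots> = (\<Sum>l<c. ?lk ((rot ^^ k) (dy (xs ! l))) (dyck (xs ! i)) * ?lk (rot (dy (xs ! j))) (dyck (xs ! l)))"
      using Suc by (intro sum.cong) (simp_all add: S_def)
    also have "\<dots> = ?lk ((rot ^^ k) (rot (dy (xs ! j)))) (dyck (xs ! i))"
      using expand[OF additive_on_frags_pow[OF additive_maps(1)] rot_in_span[OF spanY(2)[OF Suc.prems(2)]]]
      by simp
    finally show ?case by (simp add: funpow_swap1)
  qed
  have carp: "M ^\<^sub>m k \<in> carrier_mat c c" "S ^\<^sub>m k \<in> carrier_mat c c" using car M by simp_all
  have "mtrace (M ^\<^sub>m k) = mtrace ((C * B) * M ^\<^sub>m k)" unfolding CB left_mult_one_mat[OF carp(1)] ..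
  also have "\<dots> = mtrace (C * (B * M ^\<^sub>m k))" using car C carp by (simp add: assoc_mult_mat[of _ c c _ c _ c])
  also have "\<dots> = mtrace ((B * M ^\<^sub>m k) * C)"
    by (rule mtrace_mult_commute[of _ c c]) (use car C carp in simp_all)
  also have "\<dots> = mtrace ((-1) ^ (k * (n + 1)) \<cdot>\<^sub>m (S ^\<^sub>m k * (B * C)))"
  proof -
    have "((-1) ^ (k * (n + 1)) \<cdot>\<^sub>m (S ^\<^sub>m k * B)) * C = (-1) ^ (k * (n + 1)) \<cdot>\<^sub>m (S ^\<^sub>m k * B * C)"
      by (rule mult_smult_assoc_mat[of _ c c _ c]) (use car carp C(1) in \<open>auto intro!: mult_carrier_mat[of _ c c]\<close>)
    also have "S ^\<^sub>m k * B * C = S ^\<^sub>m k * (B * C)"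
      by (rule assoc_mult_mat[OF carp(2) car(1) C(1)])
    finally show ?thesis unfolding pow by simp
  qed
  also have "\<dots> = (-1) ^ (k * (n + 1)) * mtrace (S ^\<^sub>m k)"
    unfolding C right_mult_one_mat[OF carp(2)] using car(3) by (simp add: mtrace_def sum_distrib_left)
  also have "mtrace (S ^\<^sub>m k) = (\<Sum>i<c. ?lk ((rot ^^ k) (dy (xs ! i))) (dyck (xs ! i)))"
    using car(3) S_pow by (simp add: mtrace_def)
  also have "\<dots> = frag_trace (dyck ` Yset n) (rot ^^ k)"
    unfolding frag_trace_def dy_def by (rule sum.reindex_bij_betw[OF bijD])
  finally show ?thesis .
qed

text \<open>If \<open>N\<close> divides \<open>k\<close>, the trace is the number of trees; it takes
  the stated form because \<open>lam N\<close> is \<open>(2 * n + 1) * catalan n\<close> up to sign.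
  Otherwise the count of fixed words applies to \<open>k mod N\<close>.\<close>

lemma trace_rot:
  fixes n k :: nat
  defines "N \<equiv> 2 * n + 2"
  shows "(-1) ^ (k * (n + 1)) * frag_trace (dyck ` Yset n) (rot ^^ k) =
    (if N dvd k then int N * int (catalan n) else 0) + (-1) ^ n * (-1) ^ (k * (n + 1)) * lam (gcd k N)"
proof -
  let ?D = "dyck ` Yset n"
  have rot_mod: "(rot ^^ k) x = (rot ^^ (k mod N)) x" if "x \<in> dyck_span n" for x
  proof -
    have "(rot ^^ (N * q)) x = x" for q
      by (induction q) (simp_all add: funpow_add rot_period[OF that, folded N_def])
    then have "(rot ^^ (k mod N + N * (k div N))) x = (rot ^^ (k mod N)) x"
      by (simp only: funpow_add o_apply)
    then show ?thesis by simp
  qed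
  have "frag_of w \<in> dyck_span n" if "w \<in> ?D" for w using that by (auto simp: dyck_span_def keys_frag_of)
  then have tr: "frag_trace ?D (rot ^^ k) = frag_trace ?D (rot ^^ (k mod N))"
    by (intro frag_trace_cong rot_mod)
  show ?thesis
  proof (cases "N dvd k")
    case True
    then have "even k" by (auto simp: N_def)
    have "frag_trace ?D (rot ^^ k) = int (catalan n)"
      unfolding tr using True inj_dyck
      by (simp add: frag_trace_def card_image[OF inj_on_subset[OF inj_dyck]] card_Yset)
    moreover have "lam N = (-1) ^ (n + 1) * int ((2 * n + 1) * catalan n)"
    proof -
      have "N choose 2 = (n + 1) * (2 * n + 1)" by (simp add: N_def choose_two)
      moreover have "(N - 1) div 2 = n" "N - 1 = 2 * n + 1" by (simp_all add: N_def)
      ultimately show ?thesis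
        unfolding lam_def card_Yset[symmetric] card_Yset_binomial
        by (simp add: minus_one_power_iff)
    qed
    moreover have "gcd k N = N" using True by (simp add: gcd_proj2_if_dvd_nat)
    moreover have "(-1 :: int) ^ (k * (n + 1)) = 1" using \<open>even k\<close> by simp
    moreover have "int N * int (catalan n) + (-1) ^ n * ((-1) ^ (n + 1) * int ((2 * n + 1) * catalan n)) =
        int (catalan n)"
      by (cases "even n") (simp_all add: N_def algebra_simps)
    ultimately show ?thesis
      using True by (simp only: if_True mult_1_left mult_1_right)
  next
    case False
    define m where "m = k mod N"
    have m: "0 < m" "m < 2 * n + 2" using False by (simp_all add: m_def N_def mod_greater_zero_iff_not_dvd)
    have gcd: "gcd m (2 * n + 2) = gcd k N"
      using gcd_red_nat[of k N] by (simp add: m_def N_def gcd.commute)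
    let ?g = "gcd k N"
    have "even (k mod N) \<longleftrightarrow> even k" by (simp add: N_def even_mod_2_iff dvd_mod_iff)
    then have par: "even m \<longleftrightarrow> even k" by (simp add: m_def)
    have parg: "even ?g \<longleftrightarrow> even k" by (simp add: N_def)
    have g: "0 < ?g" by (simp add: N_def)
    have "- frag_trace ?D (\<lambda>x. (-1) ^ m * (rot ^^ m) x) =
        (-1) ^ (n + (?g - 1) div 2) * int ((?g - 1) choose ((?g - 1) div 2))"
      using trace_rot_pow[OF m] trace_contract_der[of "2 * n + 1" n m] alternating_trace_cyc[OF m]
      unfolding gcd by simp
    moreover have "frag_trace ?D (\<lambda>x. (-1) ^ m * (rot ^^ m) x) = (-1) ^ m * frag_trace ?D (rot ^^ m)"
      by (cases "even m") (simp_all add: frag_trace_linear)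
    ultimately have "(-1) ^ m * frag_trace ?D (rot ^^ m) =
        - ((-1) ^ (n + (?g - 1) div 2) * int ((?g - 1) choose ((?g - 1) div 2)))" by simp
    then have 1: "frag_trace ?D (rot ^^ m) =
        (-1) ^ Suc (m + n + (?g - 1) div 2) * int ((?g - 1) choose ((?g - 1) div 2))"
      by (cases "even m") (simp_all add: power_add)
    \<comment> \<open>The sign of the word count against the sign in \<open>lam\<close>. As
      \<open>m\<close> and \<open>?g\<close> have equal parity, both depend on \<open>?g\<close>
      modulo 4; for residue 0 the truncated subtraction calls for \<open>?g\<close>
      positive.\<close>
    have "even (Suc (m + (?g - 1) div 2)) \<longleftrightarrow> even (?g choose 2)"
    proof -
      obtain q r where "?g = 4 * q + r" "r < 4"
        by (metis mod_less_divisor mult_div_mod_eq zero_less_numeral)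
      moreover then have "r = 0 \<or> r = 1 \<or> r = 2 \<or> r = 3" by auto
      moreover have "r = 0 \<longrightarrow> 0 < q" using calculation g by auto
      ultimately have "even (Suc (?g + (?g - 1) div 2)) \<longleftrightarrow> even (?g choose 2)"
      proof (elim disjE)
        assume "?g = 4 * q + r" "r = 0" "r = 0 \<longrightarrow> 0 < q"
        then obtain p where "?g = 4 * p + 4" by (metis Suc_pred' add.right_neutral mult_Suc_right add.commute)
        moreover from this have "?g choose 2 = (2 * p + 2) * (4 * p + 3)"
          by (simp add: choose_two algebra_simps)
        moreover have "(3 + 4 * p) div 2 = 2 * p + 1" by simp
        ultimately show ?thesis by simp
      next
        assume "?g = 4 * q + r" "r = 1"
        then have "?g = 4 * q + 1" by simp
        then show ?thesis by (simp add: choose_two)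
      next
        assume "?g = 4 * q + r" "r = 2"
        then have "?g = 4 * q + 2" by simp
        then show ?thesis by (simp add: choose_two)
      next
        assume "?g = 4 * q + r" "r = 3"
        then have "?g = 4 * q + 3" by simp
        then show ?thesis by (simp add: choose_two)
      qed
      then show ?thesis using par parg by simp
    qed
    then have "frag_trace ?D (rot ^^ m) = (-1) ^ n * lam ?g"
      unfolding 1 lam_def by (auto simp: minus_one_power_iff)
    then show ?thesis
      using False unfolding tr m_def[symmetric] by simp
  qed
qed

section \<open>Power sums of eigenvalues\<close>

lemma upper_triangular_pow:
  fixes B :: "'a::comm_ring_1 mat"
  assumes "B \<in> carrier_mat n n" "upper_triangular B"
  shows "i < n \<Longrightarrow> j < n \<Longrightarrow> j < i \<Longrightarrow> (B ^\<^sub>m k) $$ (i, j) = 0"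
    and "i < n \<Longrightarrow> (B ^\<^sub>m k) $$ (i, i) = (B $$ (i, i)) ^ k"
proof (induction k arbitrary: i j)
  case 0
  { case 1 then show ?case using assms by simp
  next case 2 then show ?case using assms by simp }
next
  case (Suc k)
  have e: "(B ^\<^sub>m Suc k) $$ (i, j) = (\<Sum>l<n. (B ^\<^sub>m k) $$ (i, l) * B $$ (l, j))" if "i < n" "j < n" for i j
    using that assms(1) by (simp add: scalar_prod_def atLeast0LessThan)
  have z: "B $$ (l, j) = 0" if "l < n" "j < l" for l j
    using assms that by (auto simp: upper_triangular_def)
  {
    case 1
    have "(B ^\<^sub>m k) $$ (i, l) * B $$ (l, j) = 0" if "l < n" for l
      using Suc(1)[of i l] z[of l j] 1 that by (cases "l < i") auto
    then show ?case unfolding e[OF 1(1,2)] by simp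
  next
    case 2
    have "(B ^\<^sub>m k) $$ (i, l) * B $$ (l, i) = (if l = i then (B $$ (i, i)) ^ Suc k else 0)" if "l < n" for l
      using Suc(1)[of i l] Suc(2)[of i] z[of l i] 2 that by (cases l i rule: linorder_cases) auto
    then have "(B ^\<^sub>m Suc k) $$ (i, i) = (\<Sum>l<n. if l = i then (B $$ (i, i)) ^ Suc k else 0)"
      unfolding e[OF 2 2] by (intro sum.cong) auto
    then show ?case using 2 by simp
  }
qed

lemma mtrace_pow_eq_power_sum:
  fixes A :: "complex mat"
  assumes A: "A \<in> carrier_mat n n"
  shows "mtrace (A ^\<^sub>m k) = (\<Sum>a\<in>#proots (char_poly A). a ^ k)"
proof -
  obtain es where es: "char_poly A = (\<Prod>a\<leftarrow>es. [:- a, 1:])" "length es = n"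
    using char_poly_factorized[OF A] by auto
  obtain B P Q where dec: "schur_decomposition A es = (B, P, Q)" by (cases "schur_decomposition A es") auto
  from schur_decomposition[OF A es(1) dec]
  have wit: "similar_mat_wit A B P Q" and ut: "upper_triangular B" and diag: "diag_mat B = es" by auto
  from similar_mat_witD2[OF A wit]
  have car: "B \<in> carrier_mat n n" "P \<in> carrier_mat n n" "Q \<in> carrier_mat n n" and QP: "Q * P = 1\<^sub>m n"
    by auto
  have Bk: "B ^\<^sub>m k \<in> carrier_mat n n" using car by simp
  have "mtrace (A ^\<^sub>m k) = mtrace (P * (B ^\<^sub>m k * Q))"
    unfolding similar_mat_wit_pow_id[OF wit] using car Bk by (simp add: assoc_mult_mat[of _ n n _ n _ n])
  also have "\<dots> = mtrace (B ^\<^sub>m k * Q * P)"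
    by (rule mtrace_mult_commute[of _ n n]) (use car Bk in \<open>auto intro!: mult_carrier_mat[of _ n n]\<close>)
  also have "B ^\<^sub>m k * Q * P = B ^\<^sub>m k"
    using car Bk QP by (simp add: assoc_mult_mat[of _ n n _ n _ n])
  also have "mtrace (B ^\<^sub>m k) = (\<Sum>i<n. (B $$ (i, i)) ^ k)"
    using car(1) upper_triangular_pow(2)[OF car(1) ut] by (simp add: mtrace_def)
  also have "\<dots> = (\<Sum>a\<leftarrow>diag_mat B. a ^ k)"
    using car by (simp add: diag_mat_def o_def interv_sum_list_conv_sum_set_nat atLeast0LessThan)
  also have "\<dots> = (\<Sum>a\<in>#mset es. a ^ k)"
    unfolding diag by (metis mset_map sum_mset_sum_list)
  also have "mset es = proots (char_poly A)"
    unfolding es(1)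
  proof (induction es)
    case (Cons e es)
    have "(\<Prod>a\<leftarrow>es. [:- a, 1:]) \<noteq> 0" by (auto simp: prod_list_zero_iff)
    then have "proots ([:- e, 1:] * (\<Prod>a\<leftarrow>es. [:- a, 1:])) = {#e#} + proots (\<Prod>a\<leftarrow>es. [:- a, 1:])"
      by (subst proots_mult) simp_all
    then show ?case using Cons by (simp del: mult_pCons_left)
  qed simp
  finally show ?thesis .
qed

text \<open>Testing against the polynomial that vanishes on \<open>S\<close> except at
  \<open>b\<close> isolates \<open>f b\<close>; this is the invertibility of the Vandermonde
  matrix.\<close>

lemma power_sums_unique:
  fixes f :: "complex \<Rightarrow> complex"
  assumes "finite S" "\<And>k. (\<Sum>a\<in>S. f a * a ^ k) = 0" "b \<in> S"
  shows "f b = 0"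
proof -
  define p where "p = (\<Prod>a\<in>S - {b}. [:- a, 1:])"
  have "(\<Sum>a\<in>S. f a * poly p a) = (\<Sum>i\<le>degree p. coeff p i * (\<Sum>a\<in>S. f a * a ^ i))"
    by (simp add: poly_altdef sum_distrib_left sum.swap[of _ S] mult_ac)
  also have "\<dots> = 0" by (simp add: assms(2))
  finally have "0 = (\<Sum>a\<in>S. f a * poly p a)" by simp
  also have "\<dots> = (\<Sum>a\<in>S. if a = b then f b * poly p b else 0)"
  proof (rule sum.cong[OF refl])
    fix a assume "a \<in> S"
    then show "f a * poly p a = (if a = b then f b * poly p b else 0)"
      using assms(1) by (auto simp: p_def poly_prod)
  qed
  also have "\<dots> = f b * poly p b" using assms(1,3) by simp
  finally have "f b * poly p b = 0" by simp
  moreover have "poly p b \<noteq> 0" using assms(1) by (auto simp: p_def poly_prod)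
  ultimately show ?thesis by simp
qed

section \<open>Moebius inversion\<close>

lemma moebius_mult_prime:
  assumes "prime p" "\<not> p dvd e" "0 < e"
  shows "moebius (p * e) = - moebius e"
proof -
  have cop: "coprime p e" using assms prime_imp_coprime by blast
  have sq: "squarefree (p * e) \<longleftrightarrow> squarefree e"
    using squarefree_mult_coprime[OF cop squarefree_prime[OF assms(1)]] squarefree_multD(2) by blast
  have "prime_factors (p * e) = insert p (prime_factors e)"
    using assms by (simp add: prime_factors_product prime_prime_factors)
  moreover have "p \<notin> prime_factors e" using assms(2) by auto
  ultimately show ?thesis unfolding moebius_def sq by simp
qed

text \<open>For a prime \<open>p\<close> dividing \<open>m\<close>, each divisor \<open>e\<close>
  prime to \<open>p\<close> is paired with \<open>p * e\<close>, and divisors that the square of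
  \<open>p\<close> divides contribute 0.\<close>

lemma sum_moebius_divisors:
  assumes "0 < m"
  shows "(\<Sum>e | e dvd m. moebius e) = (if m = 1 then 1 else 0)"
proof (cases "m = 1")
  case True
  then show ?thesis by (simp add: moebius_def)
next
  case False
  then obtain p where p: "prime p" "p dvd m" using prime_factor_nat by blast
  have p0: "0 < p" using p(1) prime_gt_0_nat by blast
  have fin: "finite {e. e dvd m}" using assms by simp
  let ?A = "{e. e dvd m \<and> \<not> p dvd e}"
  let ?B = "{e. e dvd m \<and> p dvd e}"
  have pos: "0 < e" if "e dvd m" for e using that assms by (auto intro: Nat.gr0I)
  have "(\<Sum>e | e dvd m. moebius e) = (\<Sum>e\<in>?A. moebius e) + (\<Sum>e\<in>?B. moebius e)"
    by (subst sum.union_disjoint[symmetric]) (auto intro: sum.cong finite_subset[OF _ fin])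
  also have "(\<Sum>e\<in>?B. moebius e) = (\<Sum>e\<in>(*) p ` ?A. moebius e)"
  proof (rule sum.mono_neutral_right)
    show "finite ?B" by (rule finite_subset[OF _ fin]) auto
    show "(*) p ` ?A \<subseteq> ?B"
      using p prime_imp_coprime[OF p(1)] by (auto intro: divides_mult)
    show "\<forall>e\<in>?B - (*) p ` ?A. moebius e = 0"
    proof
      fix e assume e: "e \<in> ?B - (*) p ` ?A"
      then obtain e' where e': "e = p * e'" by auto
      then have "e' dvd m" using e dvd_mult_right by blast
      then have "p dvd e'" using e e' by auto
      then have "p\<^sup>2 dvd e" unfolding e' power2_eq_square by (rule mult_dvd_mono[OF dvd_refl])
      then have "\<not> squarefree e" using p(1) by (auto simp: squarefree_def dest: spec[of _ p])
      then show "moebius e = 0" by (simp add: moebius_def)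
    qed
  qed
  also have "\<dots> = (\<Sum>e\<in>?A. moebius (p * e))"
    by (rule sum.reindex[unfolded o_def]) (use p0 in \<open>simp add: inj_on_def\<close>)
  also have "\<dots> = (\<Sum>e\<in>?A. - moebius e)"
    by (rule sum.cong) (use p(1) pos in \<open>auto intro: moebius_mult_prime\<close>)
  finally show ?thesis using False by (simp add: sum_negf)
qed

lemma moebius_inversion:
  assumes "0 < m"
  shows "(\<Sum>d | d dvd m. \<Sum>e | e dvd d. moebius e * f (d div e)) = (f m :: int)"
proof -
  have fin: "finite {d. d dvd k}" if "0 < k" for k :: nat using that by simp
  have pos: "0 < e" if "e dvd m" for e using that assms by (auto intro: Nat.gr0I)
  have "(\<Sum>d | d dvd m. \<Sum>e | e dvd d. moebius e * f (d div e)) =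
      (\<Sum>(d, e)\<in>(SIGMA d:{d. d dvd m}. {e. e dvd d}). moebius e * f (d div e))"
    by (rule sum.Sigma) (use assms pos in auto)
  also have "\<dots> = (\<Sum>(j, e)\<in>(SIGMA j:{j. j dvd m}. {e. e dvd m div j}). moebius e * f j)"
  proof (rule sum.reindex_bij_witness[where i = "\<lambda>(j, e). (j * e, e)" and j = "\<lambda>(d, e). (d div e, e)"])
    fix x assume "x \<in> (SIGMA d:{d. d dvd m}. {e. e dvd d})"
    then obtain d e where x: "x = (d, e)" "d dvd m" "e dvd d" by auto
    then obtain k l where kl: "d = e * k" "m = d * l" by (auto elim!: dvdE)
    have p: "0 < e" "0 < k" using assms kl by auto
    show "(case case x of (d, e) \<Rightarrow> (d div e, e) of (j, e) \<Rightarrow> (j * e, e)) = x" using x by simp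
    have "m = k * (e * l)" using kl by simp
    then have "m div k = e * l" "k dvd m" using p by simp_all
    then show "(case x of (d, e) \<Rightarrow> (d div e, e)) \<in> (SIGMA j:{j. j dvd m}. {e. e dvd m div j})"
      using x kl p by simp
    show "(case case x of (d, e) \<Rightarrow> (d div e, e) of (j, e) \<Rightarrow> moebius e * f j) =
      (case x of (d, e) \<Rightarrow> moebius e * f (d div e))" by (simp add: x)
  next
    fix y assume "y \<in> (SIGMA j:{j. j dvd m}. {e. e dvd m div j})"
    then obtain j e where y: "y = (j, e)" "j dvd m" "e dvd m div j" by auto
    then obtain k where k: "m = j * k" by (auto elim!: dvdE)
    have "0 < j" using assms k by simp
    then have "e dvd k" using y k by simp
    then have "0 < e" using assms k by (auto intro: Nat.gr0I)
    show "(case case y of (j, e) \<Rightarrow> (j * e, e) of (d, e) \<Rightarrow> (d div e, e)) = y"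
      using \<open>0 < e\<close> by (simp add: y)
    show "(case y of (j, e) \<Rightarrow> (j * e, e)) \<in> (SIGMA d:{d. d dvd m}. {e. e dvd d})"
      using \<open>e dvd k\<close> by (simp add: y k)
  qed
  also have "\<dots> = (\<Sum>j | j dvd m. \<Sum>e | e dvd m div j. moebius e * f j)"
    by (rule sum.Sigma[symmetric]) (use assms in \<open>auto elim!: dvdE\<close>)
  also have "\<dots> = (\<Sum>j | j dvd m. if j = m then f m else 0)"
  proof (rule sum.cong[OF refl])
    fix j assume "j \<in> {j. j dvd m}"
    then obtain k where k: "m = j * k" by auto
    then have jk: "0 < j" "0 < k" using assms by auto
    then have "(\<Sum>e | e dvd m div j. moebius e * f j) = (if k = 1 then 1 else 0) * f j"
      using sum_moebius_divisors[of k] k by (simp flip: sum_distrib_right)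
    then show "(\<Sum>e | e dvd m div j. moebius e * f j) = (if j = m then f m else 0)"
      using k jk by auto
  qed
  also have "\<dots> = f m" using assms by simp
  finally show ?thesis .
qed

section \<open>Roots of unity\<close>

lemma cis_root_pow:
  assumes "0 < d"
  shows "cis (2 * pi / real d) ^ k = 1 \<longleftrightarrow> d dvd k"
proof -
  let ?w = "cis (2 * pi / real d)"
  have wd: "?w ^ d = 1" using assms by (simp add: DeMoivre)
  have "?w ^ k = ?w ^ (k mod d)"
    using wd by (metis mult_1 power_add power_mult power_one mult_div_mod_eq)
  also have "\<dots> = cis (2 * pi * real (k mod d) / real d)" by (simp add: DeMoivre mult_ac)
  also have "\<dots> = 1 \<longleftrightarrow> k mod d = 0"
    using bij_betw_imp_inj_on[OF bij_betw_roots_unity[OF assms], THEN inj_onD, of "k mod d" 0] assms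
    by auto
  finally show ?thesis by auto
qed

lemma power_sum_roots_unity:
  assumes "0 < d"
  shows "(\<Sum>z | z ^ d = 1. z ^ k) = (if d dvd k then of_nat d else 0 :: complex)"
proof (cases "d dvd k")
  case True
  then obtain j where "k = d * j" by auto
  then have "(\<Sum>z | z ^ d = 1. z ^ k) = (\<Sum>z :: complex | z ^ d = 1. 1 :: complex)"
    by (intro sum.cong) (auto simp: power_mult)
  then show ?thesis using True card_roots_unity_eq[OF assms] by simp
next
  case False
  let ?w = "cis (2 * pi / real d)"
  have w: "?w ^ d = 1" "?w ^ k \<noteq> 1" using False cis_root_pow[OF assms] by auto
  have "bij_betw ((*) ?w) {z. z ^ d = 1} {z. z ^ d = 1}"
    by (rule bij_betwI[where g = "\<lambda>z. z / ?w"]) (auto simp: power_mult_distrib power_divide w(1))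
  from sum.reindex_bij_betw[OF this, of "\<lambda>z. z ^ k"]
  have "?w ^ k * (\<Sum>z | z ^ d = 1. z ^ k) = (\<Sum>z | z ^ d = 1. z ^ k)"
    by (simp add: power_mult_distrib sum_distrib_left)
  then show ?thesis using False w(2) by simp
qed

lemma power_sum_nth_roots:
  fixes \<eta> :: complex
  assumes "0 < d" "\<eta> \<noteq> 0"
  shows "(\<Sum>z | z ^ d = \<eta> ^ d. z ^ k) = (if d dvd k then of_nat d * \<eta> ^ k else 0)"
proof -
  have "bij_betw ((*) \<eta>) {z. z ^ d = 1} {z. z ^ d = \<eta> ^ d}"
    by (rule bij_betwI[where g = "\<lambda>z. z / \<eta>"]) (use assms in \<open>auto simp: power_mult_distrib power_divide\<close>)
  from sum.reindex_bij_betw[OF this, of "\<lambda>z. z ^ k"]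
  have "(\<Sum>z | z ^ d = \<eta> ^ d. z ^ k) = \<eta> ^ k * (\<Sum>z | z ^ d = 1. z ^ k)"
    by (simp add: power_mult_distrib sum_distrib_left)
  then show ?thesis using power_sum_roots_unity[OF assms(1), of k] by simp
qed

lemma order_monom_diff:
  fixes a \<eta> :: complex
  assumes "0 < d" "\<eta> \<noteq> 0"
  shows "order a (monom 1 d - [:\<eta>:]) = (if a ^ d = \<eta> then 1 else 0)"
proof (cases "a ^ d = \<eta>")
  case True
  have "coeff (monom 1 d - [:\<eta>:]) d = 1" using assms(1) by (cases d) auto
  then have "monom 1 d - [:\<eta>:] \<noteq> 0" by (metis coeff_0 zero_neq_one)
  moreover have "poly (monom 1 d - [:\<eta>:]) a = 0" using True by (simp add: poly_monom)
  moreover have "order a (pderiv (monom 1 d - [:\<eta>:])) = 0"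
  proof (rule order_0I)
    have "a \<noteq> 0" using True assms by (auto simp: power_0_left)
    then show "poly (pderiv (monom 1 d - [:\<eta>:])) a \<noteq> 0"
      using assms(1) by (simp add: pderiv_diff pderiv_monom pderiv_pCons poly_monom)
  qed
  ultimately show ?thesis using True by (simp add: order_pderiv)
next
  case False
  then show ?thesis by (simp add: order_0I poly_monom)
qed

lemma monic_poly_eqI:
  fixes p q :: "complex poly"
  assumes "lead_coeff p = 1" "lead_coeff q = 1" "\<And>a. order a p = order a q"
  shows "p = q"
proof -
  have "p \<noteq> 0" "q \<noteq> 0" using assms by auto
  then have "proots p = proots q" using assms(3) by (intro multiset_eqI) simp
  then show ?thesis
    using complex_poly_decompose_multiset[of p] complex_poly_decompose_multiset[of q] assms(1,2) by simp
qed

lemma monic_monom_diff: "0 < d \<Longrightarrow> lead_coeff (monom 1 d - [:c:] :: 'a::comm_ring_1 poly) = 1"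
proof -
  assume d: "0 < d"
  have "degree (monom (1 :: 'a) d - [:c:]) = d"
    using d by (subst diff_conv_add_uminus, subst degree_add_eq_left) (auto simp: degree_monom_eq)
  then show ?thesis using d by (cases d) auto
qed

lemma order_prod:
  fixes f :: "'i \<Rightarrow> complex poly"
  assumes "finite A" "\<And>i. i \<in> A \<Longrightarrow> f i \<noteq> 0"
  shows "order a (\<Prod>i\<in>A. f i) = (\<Sum>i\<in>A. order a (f i))"
  using assms by (induction A rule: finite_induct) (auto simp: order_mult)

lemma order_power: "p \<noteq> 0 \<Longrightarrow> order a (p ^ k) = k * order a (p :: complex poly)"
  by (induction k) (auto simp: order_mult)

section \<open>From power sums to the characteristic polynomial\<close>

lemma sum_mset_eq_sum_count:
  fixes f :: "'a \<Rightarrow> 'b::comm_semiring_1"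
  assumes "finite S" "set_mset M \<subseteq> S"
  shows "(\<Sum>a\<in>#M. f a) = (\<Sum>a\<in>S. of_nat (count M a) * f a)"
  using assms(2)
proof (induction M)
  case (add x M)
  have "(\<Sum>a\<in>S. of_nat (count (add_mset x M) a) * f a) =
      (\<Sum>a\<in>S. (if a = x then f x else 0) + of_nat (count M a) * f a)"
    by (rule sum.cong) (auto simp: algebra_simps)
  then show ?case using add assms(1) by (simp add: sum.distrib)
qed simp

text \<open>Positive and negative exponents stand on different sides, so the claim is an identity of
  polynomials, decided by root multiplicities. Weighting the roots of
  \<open>x ^ d = \<eta> ^ d\<close> by \<open>\<beta> d\<close> matches the given power sums,
  because Moebius inversion adds \<open>d * \<beta> d\<close> over the divisors of
  \<open>gcd k N\<close> to \<open>lam (gcd k N)\<close>.\<close>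

lemma poly_eq_of_power_sums:
  fixes P :: "int poly" and n :: nat
  defines "N \<equiv> 2 * n + 2"
  assumes monic: "lead_coeff P = 1"
    and sums: "\<And>k. (\<Sum>a\<in>#proots (of_int_poly P :: complex poly). a ^ k) =
      of_int ((if N dvd k then int N * int c else 0) + (-1) ^ n * (-1) ^ (k * (n + 1)) * lam (gcd k N))"
  shows "P * (\<Prod>d | d dvd N. (monom 1 d - [:(-1) ^ (d * (n + 1)):]) ^ nat ((-1) ^ (n + 1) * bnum d)) =
    (monom 1 N - 1) ^ c *
      (\<Prod>d | d dvd N. (monom 1 d - [:(-1) ^ (d * (n + 1)):]) ^ nat (- ((-1) ^ (n + 1) * bnum d)))"
proof -
  have N: "0 < N" "even N" by (simp_all add: N_def)
  have finN: "finite {d. d dvd N}" using N by simp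
  have posd: "0 < d" if "d dvd N" for d using that N by (auto intro: Nat.gr0I)
  define Q where "Q = (of_int_poly P :: complex poly)"
  have monicQ: "lead_coeff Q = 1" using monic by (simp add: Q_def)
  then have Q0: "Q \<noteq> 0" by auto
  define \<eta> where "\<eta> = (-1 :: complex) ^ (n + 1)"
  have \<eta>: "\<eta> \<noteq> 0" "\<eta> ^ N = 1" "\<eta> * \<eta> = 1"
    using N by (auto simp: \<eta>_def minus_one_power_iff)
  have \<eta>_even: "\<eta> ^ k = 1" if "even k" for k using that by (auto simp: \<eta>_def minus_one_power_iff)
  define s where "s d = (\<Sum>e | e dvd d. moebius e * lam (d div e))" for d
  define \<beta> where "\<beta> d = (of_int (s d) / of_nat d :: complex)" for d
  define R where "R = {z :: complex. z ^ N = 1}"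
  have finR: "finite R" unfolding R_def using N(1) by (rule finite_nth_roots)
  have Rd: "{z. z ^ d = \<eta> ^ d} \<subseteq> R" if "d dvd N" for d
  proof -
    obtain j where j: "N = d * j" using \<open>d dvd N\<close> by auto
    then have "z ^ N = \<eta> ^ N" if "z ^ d = \<eta> ^ d" for z using that by (simp add: power_mult)
    then show ?thesis unfolding R_def using \<eta> by auto
  qed
  have lam_eq: "(\<Sum>d | d dvd g. of_nat d * \<beta> d) = of_int (lam g)" if "0 < g" for g
  proof -
    have "(\<Sum>d | d dvd g. of_nat d * \<beta> d) = (\<Sum>d | d dvd g. of_int (s d))"
      by (rule sum.cong) (use that in \<open>auto simp: \<beta>_def\<close>)
    also have "\<dots> = of_int (\<Sum>d | d dvd g. s d)" by simp
    also have "(\<Sum>d | d dvd g. s d) = lam g" unfolding s_def by (rule moebius_inversion[OF that])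
    finally show ?thesis .
  qed
  define S where "S = set_mset (proots Q) \<union> R"
  have finS: "finite S" using finR by (simp add: S_def)
  \<comment> \<open>The multiplicity of \<open>a\<close> minus the predicted one; all its power sums
    vanish.\<close>
  define F where "F a = of_nat (order a Q) - (if a \<in> R then of_nat c else 0)
     - (-1) ^ n * (\<Sum>d | d dvd N. if a ^ d = \<eta> ^ d then \<beta> d else 0)" for a
  have sumF: "(\<Sum>a\<in>S. F a * a ^ k) = 0" for k
  proof -
    have 1: "(\<Sum>a\<in>S. of_nat (order a Q) * a ^ k) = (\<Sum>a\<in>#proots Q. a ^ k)"
    proof -
      have "(\<Sum>a\<in>#proots Q. a ^ k) = (\<Sum>a\<in>S. of_nat (count (proots Q) a) * a ^ k)"
        by (rule sum_mset_eq_sum_count[OF finS]) (simp add: S_def)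
      then show ?thesis using Q0 by simp
    qed
    have 2: "(\<Sum>a\<in>S. (if a \<in> R then of_nat c else 0) * a ^ k) = (if N dvd k then of_nat N * of_nat c else 0)"
    proof -
      have "(\<Sum>a\<in>S. (if a \<in> R then of_nat c else 0) * a ^ k) = (\<Sum>a\<in>R. of_nat c * a ^ k)"
        by (rule sum.mono_neutral_cong_right) (use finS in \<open>auto simp: S_def\<close>)
      then show ?thesis using power_sum_roots_unity[OF N(1), of k]
        by (simp add: R_def flip: sum_distrib_left)
    qed
    have 3: "(\<Sum>a\<in>S. (\<Sum>d | d dvd N. if a ^ d = \<eta> ^ d then \<beta> d else 0) * a ^ k) = \<eta> ^ k * of_int (lam (gcd k N))"
    proof -
      have "(\<Sum>a\<in>S. (\<Sum>d | d dvd N. if a ^ d = \<eta> ^ d then \<beta> d else 0) * a ^ k) =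
          (\<Sum>d | d dvd N. \<Sum>a\<in>S. (if a ^ d = \<eta> ^ d then \<beta> d else 0) * a ^ k)"
        by (simp only: sum_distrib_right) (rule sum.swap)
      also have "\<dots> = (\<Sum>d | d dvd N. \<beta> d * (\<Sum>a | a ^ d = \<eta> ^ d. a ^ k))"
      proof (rule sum.cong[OF refl])
        fix d assume "d \<in> {d. d dvd N}"
        then have "{z. z ^ d = \<eta> ^ d} \<subseteq> S" using Rd by (auto simp: S_def)
        then show "(\<Sum>a\<in>S. (if a ^ d = \<eta> ^ d then \<beta> d else 0) * a ^ k) = \<beta> d * (\<Sum>a | a ^ d = \<eta> ^ d. a ^ k)"
          unfolding sum_distrib_left by (intro sum.mono_neutral_cong_right finS) auto
      qed
      also have "\<dots> = (\<Sum>d | d dvd N. if d dvd k then \<eta> ^ k * (of_nat d * \<beta> d) else 0)"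
        by (rule sum.cong) (use posd \<eta> in \<open>auto simp: power_sum_nth_roots\<close>)
      also have "\<dots> = (\<Sum>d | d dvd N \<and> d dvd k. \<eta> ^ k * (of_nat d * \<beta> d))"
        using sum.inter_filter[OF finN, of "\<lambda>d. \<eta> ^ k * (of_nat d * \<beta> d)" "\<lambda>d. d dvd k", symmetric] by simp
      also have "{d. d dvd N \<and> d dvd k} = {d. d dvd gcd k N}" by auto
      also have "(\<Sum>d | d dvd gcd k N. \<eta> ^ k * (of_nat d * \<beta> d)) = \<eta> ^ k * of_int (lam (gcd k N))"
        using lam_eq[of "gcd k N"] N(1) by (simp flip: sum_distrib_left)
      finally show ?thesis .
    qed
    have "(\<Sum>a\<in>S. F a * a ^ k) = (\<Sum>a\<in>S. of_nat (order a Q) * a ^ k)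
      - (\<Sum>a\<in>S. (if a \<in> R then of_nat c else 0) * a ^ k)
      - (-1) ^ n * (\<Sum>a\<in>S. (\<Sum>d | d dvd N. if a ^ d = \<eta> ^ d then \<beta> d else 0) * a ^ k)"
    proof -
      have "(\<Sum>a\<in>S. (x a - y a - t * w a) * a ^ k) =
        (\<Sum>a\<in>S. x a * a ^ k) - (\<Sum>a\<in>S. y a * a ^ k) - t * (\<Sum>a\<in>S. w a * a ^ k)" for x y w and t :: complex
        by (simp add: left_diff_distrib sum_subtractf sum_distrib_left mult.assoc)
      then show ?thesis unfolding F_def .
    qed
    moreover have "of_int ((if N dvd k then int N * int c else 0) + (-1) ^ n * (-1) ^ (k * (n + 1)) * lam (gcd k N)) =
      (if N dvd k then of_nat N * of_nat c else 0) + (-1) ^ n * (\<eta> ^ k * of_int (lam (gcd k N)))"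
    proof -
      have "(-1 :: complex) ^ (k * (n + 1)) = \<eta> ^ k"
        unfolding \<eta>_def power_mult[symmetric] by (simp only: mult.commute)
      then show ?thesis
        by (simp only: of_int_add of_int_mult of_int_power of_int_minus of_int_1 mult.assoc) simp
    qed
    ultimately show ?thesis
      unfolding 1 2 3 sums[folded Q_def] by simp
  qed
  have F: "of_nat (order a Q) = (if a ^ N = 1 then of_nat c else 0)
     + (-1) ^ n * (\<Sum>d | d dvd N. if a ^ d = \<eta> ^ d then \<beta> d else 0)" for a
  proof (cases "a \<in> S")
    case True
    then have "F a = 0" using power_sums_unique[OF finS sumF] by blast
    then show ?thesis unfolding F_def by (simp add: R_def algebra_simps)
  next
    case False
    then have "order a Q = 0" "a ^ N \<noteq> 1" using Q0 by (auto simp: S_def R_def order_0I)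
    moreover have "\<not> a ^ d = \<eta> ^ d" if "d dvd N" for d using Rd[OF that] False by (auto simp: S_def)
    ultimately show ?thesis by simp
  qed
  \<comment> \<open>At \<open>?a\<close>, which is \<open>\<eta>\<close> times a primitive
    \<open>d\<close>-th root of unity, only the multiples \<open>e\<close> of \<open>d\<close>
    contribute to the multiplicity. As that is an integer, descending induction over the divisors
    applies. The exactness of the division in \<open>bnum\<close> rests on this.\<close>
  have \<beta>_int: "\<beta> d \<in> \<int>" if "d dvd N" for d
    using that
  proof (induction "N - d" arbitrary: d rule: less_induct)
    case less
    let ?a = "\<eta> * cis (2 * pi / real d)"
    have a: "?a ^ e = \<eta> ^ e \<longleftrightarrow> d dvd e" for e
      using cis_root_pow[OF posd[OF less.prems], of e] \<eta>(1) by (simp add: power_mult_distrib)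
    have "(-1) ^ n * (\<Sum>e | e dvd N. if ?a ^ e = \<eta> ^ e then \<beta> e else 0) \<in> \<int>"
    proof -
      have "(-1) ^ n * (\<Sum>e | e dvd N. if ?a ^ e = \<eta> ^ e then \<beta> e else 0) =
        of_int (int (order ?a Q) - (if ?a ^ N = 1 then int c else 0))"
        using F[of ?a] by (simp split: if_splits)
      then show ?thesis by (simp only: Ints_of_int)
    qed
    then have "(\<Sum>e | e dvd N. if d dvd e then \<beta> e else 0) \<in> \<int>"
      unfolding a by (cases "even n") auto
    also have "(\<Sum>e | e dvd N. if d dvd e then \<beta> e else 0) =
      \<beta> d + (\<Sum>e\<in>{e. e dvd N} - {d}. if d dvd e then \<beta> e else 0)"
      using less.prems finN by (subst sum.remove[of _ d]) auto
    finally have "\<beta> d + (\<Sum>e\<in>{e. e dvd N} - {d}. if d dvd e then \<beta> e else 0) \<in> \<int>" .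
    moreover have "(\<Sum>e\<in>{e. e dvd N} - {d}. if d dvd e then \<beta> e else 0) \<in> \<int>"
    proof (rule Ints_sum)
      fix e assume e: "e \<in> {e. e dvd N} - {d}"
      show "(if d dvd e then \<beta> e else 0) \<in> \<int>"
      proof (cases "d dvd e")
        case True
        moreover have "0 < e" "e \<noteq> d" using e posd by auto
        ultimately have "d < e" using dvd_imp_le le_neq_implies_less by metis
        moreover have "e \<le> N" using e N by (auto intro: dvd_imp_le)
        ultimately show ?thesis using less.hyps[of e] e True by auto
      qed simp
    qed
    ultimately show ?case by (metis Ints_diff add_diff_cancel_right')
  qed
  have \<beta>: "\<beta> d = of_int (bnum d)" if "d dvd N" for d
  proof -
    have "\<beta> d \<in> \<int>" by (rule \<beta>_int[OF that])
    then obtain j where "\<beta> d = of_int j" by (auto elim: Ints_cases)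
    then have "(of_int (s d) :: complex) = of_int (int d * j)"
      using posd[OF that] by (simp add: \<beta>_def field_simps)
    then have sd: "s d = int d * j" by (simp only: of_int_eq_iff)
    have "bnum d = s d div int d" by (simp add: bnum_def s_def)
    then have "bnum d = j" using posd[OF that] sd by simp
    then show ?thesis using \<open>\<beta> d = of_int j\<close> by simp
  qed
  let ?f = "\<lambda>d. monom 1 d - [:(-1) ^ (d * (n + 1)):]"
  let ?e = "\<lambda>d. (-1) ^ (n + 1) * bnum d"
  let ?L = "P * (\<Prod>d | d dvd N. ?f d ^ nat (?e d))"
  let ?R = "(monom 1 N - 1) ^ c * (\<Prod>d | d dvd N. ?f d ^ nat (- ?e d))"
  define g where "g d = (monom 1 d - [:\<eta> ^ d:] :: complex poly)" for d
  have g0: "lead_coeff (g d) = 1" "g d \<noteq> 0" if "d dvd N" for d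
  proof -
    show "lead_coeff (g d) = 1" unfolding g_def by (rule monic_monom_diff[OF posd[OF that]])
    then show "g d \<noteq> 0" by (metis coeff_0 zero_neq_one)
  qed
  have order_g: "order a (g d) = (if a ^ d = \<eta> ^ d then 1 else 0)" if "d dvd N" for d a
    unfolding g_def by (rule order_monom_diff) (use posd[OF that] \<eta>(1) in auto)
  have gf: "of_int_poly (?f d) = g d" for d
  proof -
    have "\<eta> ^ d = (-1) ^ (d * (n + 1))"
      unfolding \<eta>_def power_mult[symmetric] by (simp only: mult.commute)
    then show ?thesis by (simp add: g_def hom_distribs)
  qed
  have gN: "of_int_poly (monom 1 N - 1) = monom 1 N - [:1 :: complex:]"
    by (simp add: hom_distribs one_pCons)
  have L: "of_int_poly ?L = Q * (\<Prod>d | d dvd N. g d ^ nat (?e d))"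
    by (simp only: of_int_poly_hom.hom_mult of_int_poly_hom.hom_prod of_int_poly_hom.hom_power gf Q_def)
  have R: "of_int_poly ?R = (monom 1 N - [:1:]) ^ c * (\<Prod>d | d dvd N. g d ^ nat (- ?e d))"
    by (simp only: of_int_poly_hom.hom_mult of_int_poly_hom.hom_prod of_int_poly_hom.hom_power gf gN)
  have prod0: "(\<Prod>d | d dvd N. g d ^ k d) \<noteq> 0" for k using finN g0 by simp
  have order_prod_g: "order a (\<Prod>d | d dvd N. g d ^ k d) = (\<Sum>d | d dvd N. k d * (if a ^ d = \<eta> ^ d then 1 else 0))" for a k
    by (subst order_prod) (use finN g0 order_g in \<open>auto simp: order_power\<close>)
  have monN: "lead_coeff (monom 1 N - [:1 :: complex:]) = 1" by (rule monic_monom_diff[OF N(1)])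
  then have N0: "monom 1 N - [:1 :: complex:] \<noteq> 0" by (metis coeff_0 zero_neq_one)
  have "Q * (\<Prod>d | d dvd N. g d ^ nat (?e d)) = (monom 1 N - [:1:]) ^ c * (\<Prod>d | d dvd N. g d ^ nat (- ?e d))"
  proof (rule monic_poly_eqI)
    have lp: "lead_coeff (\<Prod>d | d dvd N. g d ^ k d) = 1" for k
      by (simp add: lead_coeff_prod lead_coeff_power g0)
    show "lead_coeff (Q * (\<Prod>d | d dvd N. g d ^ nat (?e d))) = 1"
      by (simp only: lead_coeff_mult monicQ lp mult_1)
    show "lead_coeff ((monom 1 N - [:1:]) ^ c * (\<Prod>d | d dvd N. g d ^ nat (- ?e d))) = 1"
      by (simp only: lead_coeff_mult lead_coeff_power monN lp mult_1 power_one)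
    fix a
    have h1: "order a Q + (\<Sum>d | d dvd N. nat (?e d) * (if a ^ d = \<eta> ^ d then 1 else 0)) =
      c * (if a ^ N = 1 then 1 else 0) + (\<Sum>d | d dvd N. nat (- ?e d) * (if a ^ d = \<eta> ^ d then 1 else 0))"
    proof -
      have "complex_of_int (int (order a Q)) = of_int ((if a ^ N = 1 then int c else 0)
          + (-1) ^ n * (\<Sum>d | d dvd N. if a ^ d = \<eta> ^ d then bnum d else 0))"
      proof -
        have "(\<Sum>d | d dvd N. if a ^ d = \<eta> ^ d then \<beta> d else 0) =
          of_int (\<Sum>d | d dvd N. if a ^ d = \<eta> ^ d then bnum d else 0)"
          unfolding of_int_sum by (rule sum.cong) (auto simp: \<beta>)
        then show ?thesis using F[of a] by simp
      qed
      then have "int (order a Q) = (if a ^ N = 1 then int c else 0)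
          + (-1) ^ n * (\<Sum>d | d dvd N. if a ^ d = \<eta> ^ d then bnum d else 0)"
        by (simp only: of_int_eq_iff)
      moreover have "(-1) ^ n * (\<Sum>d | d dvd N. if a ^ d = \<eta> ^ d then bnum d else 0) =
        int (\<Sum>d | d dvd N. nat (- ?e d) * (if a ^ d = \<eta> ^ d then 1 else 0)) -
        int (\<Sum>d | d dvd N. nat (?e d) * (if a ^ d = \<eta> ^ d then 1 else 0))"
        unfolding of_nat_sum sum_distrib_left sum_subtractf[symmetric]
        by (rule sum.cong) (auto simp: int_nat_eq)
      ultimately have "int (order a Q + (\<Sum>d | d dvd N. nat (?e d) * (if a ^ d = \<eta> ^ d then 1 else 0))) =
        int (c * (if a ^ N = 1 then 1 else 0) + (\<Sum>d | d dvd N. nat (- ?e d) * (if a ^ d = \<eta> ^ d then 1 else 0)))"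
        by simp
      then show ?thesis by (simp only: of_nat_eq_iff)
    qed
    have h2: "order a ((monom 1 N - [:1:]) ^ c) = c * (if a ^ N = 1 then 1 else 0)"
      using order_monom_diff[OF N(1), of 1 a] by (simp add: order_power[OF N0])
    have nz: "Q * (\<Prod>d | d dvd N. g d ^ nat (?e d)) \<noteq> 0"
      "(monom 1 N - [:1:]) ^ c * (\<Prod>d | d dvd N. g d ^ nat (- ?e d)) \<noteq> 0"
      using Q0 prod0 N0 by (simp_all only: mult_eq_0_iff power_eq_0_iff de_Morgan_disj de_Morgan_conj not_False_eq_True simp_thms)
    show "order a (Q * (\<Prod>d | d dvd N. g d ^ nat (?e d))) =
      order a ((monom 1 N - [:1:]) ^ c * (\<Prod>d | d dvd N. g d ^ nat (- ?e d)))"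
      unfolding order_mult[OF nz(1)] order_mult[OF nz(2)] order_prod_g h2 by (rule h1)
  qed
  then have LR: "(of_int_poly ?L :: complex poly) = of_int_poly ?R" unfolding L R .
  show ?thesis
  proof (rule poly_eqI)
    fix i
    have "coeff (of_int_poly ?L :: complex poly) i = coeff (of_int_poly ?R) i" unfolding LR ..
    then show "coeff ?L i = coeff ?R i" by (simp only: coeff_map_poly of_int_0 of_int_eq_iff)
  qed
qed

lemma fract_eq_of_poly_eq:
  fixes P B :: "'a::idom" and f :: "'i \<Rightarrow> 'a" and e :: "'i \<Rightarrow> int"
  assumes "finite D" "\<And>d. d \<in> D \<Longrightarrow> f d \<noteq> 0" "s = 1 \<or> s = -1"
    and "P * (\<Prod>d\<in>D. f d ^ nat (s * e d)) = B * (\<Prod>d\<in>D. f d ^ nat (- (s * e d)))"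
  shows "to_fract P = to_fract B / (\<Prod>d\<in>D. to_fract (f d) powi e d) powi s"
proof -
  have hom: "to_fract (\<Prod>d\<in>D. f d ^ k d) = (\<Prod>d\<in>D. to_fract (f d) ^ k d)" for k
  proof -
    have pow: "to_fract (x ^ j) = to_fract x ^ j" for x :: 'a and j by (induction j) simp_all
    show ?thesis using assms(1) by (induction D rule: finite_induct) (simp_all add: pow)
  qed
  have nz: "(\<Prod>d\<in>D. to_fract (f d) ^ k d) \<noteq> 0" for k using assms(1,2) by simp
  have "(\<Prod>d\<in>D. to_fract (f d) powi e d) powi s = (\<Prod>d\<in>D. to_fract (f d) powi (s * e d))"
    using assms(3) by (auto simp: power_int_minus prod_inversef[unfolded o_def, symmetric])
  also have "\<dots> = (\<Prod>d\<in>D. to_fract (f d) ^ nat (s * e d) / to_fract (f d) ^ nat (- (s * e d)))"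
    by (rule prod.cong) (auto simp: power_int_def field_simps)
  also have "\<dots> = to_fract (\<Prod>d\<in>D. f d ^ nat (s * e d)) / to_fract (\<Prod>d\<in>D. f d ^ nat (- (s * e d)))"
    by (simp add: prod_dividef hom)
  finally have *: "(\<Prod>d\<in>D. to_fract (f d) powi e d) powi s =
    to_fract (\<Prod>d\<in>D. f d ^ nat (s * e d)) / to_fract (\<Prod>d\<in>D. f d ^ nat (- (s * e d)))" .
  have "to_fract P * to_fract (\<Prod>d\<in>D. f d ^ nat (s * e d)) = to_fract B * to_fract (\<Prod>d\<in>D. f d ^ nat (- (s * e d)))"
    using assms(4) by (simp only: to_fract_mult[symmetric])
  then show ?thesis unfolding * using nz hom by (simp add: field_simps)
qed

section \<open>Free abelian groups with coordinates\<close>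

lemma (in comm_group) additive_functional:
  fixes h :: "'a \<Rightarrow> int"
  assumes add: "\<And>x y. x \<in> carrier G \<Longrightarrow> y \<in> carrier G \<Longrightarrow> h (x \<otimes> y) = h x + h y"
  shows "h \<one> = 0" "x \<in> carrier G \<Longrightarrow> h (inv x) = - h x"
    and "x \<in> carrier G \<Longrightarrow> h (x [^] (k :: int)) = k * h x"
    and "finite A \<Longrightarrow> (\<And>j. j \<in> A \<Longrightarrow> b j \<in> carrier G) \<Longrightarrow>
      h (finprod G (\<lambda>j. b j [^] (a j :: int)) A) = (\<Sum>j\<in>A. a j * h (b j))"
proof -
  show one: "h \<one> = 0" using add[of \<one> \<one>] by simp
  show hinv: "h (inv x) = - h x" if "x \<in> carrier G" for x
    using add[of x "inv x"] that one by simp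
  have nat: "h (x [^] (n :: nat)) = int n * h x" if "x \<in> carrier G" for x n
    using that by (induction n) (simp_all add: one add algebra_simps)
  show pow: "h (x [^] (k :: int)) = k * h x" if "x \<in> carrier G" for x k
    using that nat hinv by (cases k rule: int_cases2) (simp_all add: int_pow_int int_pow_neg_int)
  show "h (finprod G (\<lambda>j. b j [^] (a j :: int)) A) = (\<Sum>j\<in>A. a j * h (b j))"
    if "finite A" "\<And>j. j \<in> A \<Longrightarrow> b j \<in> carrier G"
    using that
  proof (induction A rule: finite_induct)
    case (insert j A)
    then show ?case by (subst finprod_insert) (auto simp: add pow)
  qed (simp add: one)
qed

text \<open>An isomorphism with integer vectors of length \<open>c\<close>, given by its coordinate
  functions. For the Grothendieck group these are the dimensions at the elements of the
  poset.\<close>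

locale group_coordinates = comm_group G for G (structure) +
  fixes c :: nat and \<delta> :: "nat \<Rightarrow> 'a \<Rightarrow> int"
  assumes coord_mult: "i < c \<Longrightarrow> x \<in> carrier G \<Longrightarrow> y \<in> carrier G \<Longrightarrow> \<delta> i (x \<otimes> y) = \<delta> i x + \<delta> i y"
    and coord_eqI: "x \<in> carrier G \<Longrightarrow> y \<in> carrier G \<Longrightarrow> (\<And>i. i < c \<Longrightarrow> \<delta> i x = \<delta> i y) \<Longrightarrow> x = y"
    and coord_surj: "\<exists>x\<in>carrier G. \<forall>i<c. \<delta> i x = v i"
begin

lemma coord_finprod:
  fixes m :: nat and b :: "nat \<Rightarrow> 'a"
  assumes "i < c" "\<And>j. j < m \<Longrightarrow> b j \<in> carrier G"
  shows "\<delta> i (finprod G (\<lambda>j. b j [^] (a j :: int)) {..<m}) = (\<Sum>j<m. a j * \<delta> i (b j))"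
  by (rule additive_functional(4)) (use assms coord_mult in auto)

text \<open>Expanding elements with unit coordinate vectors in \<open>bs\<close> gives a right
  inverse of \<open>T\<close>; uniqueness of expansions makes it a left inverse. The sizes agree
  because \<open>T * T'\<close> and \<open>T' * T\<close> have the same trace.\<close>

lemma basis_matrix_inverse:
  assumes "int_basis G bs"
  defines "T \<equiv> mat c (length bs) (\<lambda>(i, j). \<delta> i (bs ! j))"
  shows "length bs = c" "\<exists>T' \<in> carrier_mat c c. T * T' = 1\<^sub>m c \<and> T' * T = 1\<^sub>m c"
proof -
  define m where "m = length bs"
  have bs: "bs ! j \<in> carrier G" if "j < m" for j
    using assms(1) that by (auto simp: int_basis_def m_def)
  let ?comb = "\<lambda>a :: int vec. finprod G (\<lambda>i. bs ! i [^] (a $ i)) {..<m}"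
  have comb: "?comb a \<in> carrier G" for a using bs by (intro finprod_closed) auto
  have ex1: "\<exists>!a. a \<in> carrier_vec m \<and> g = ?comb a" if "g \<in> carrier G" for g
    using assms(1) that by (simp add: int_basis_def m_def)
  have "\<forall>k. \<exists>x. x \<in> carrier G \<and> (\<forall>i<c. \<delta> i x = (if i = k then 1 else 0))"
    by (intro allI) (use coord_surj[of "\<lambda>i. if i = _ then 1 else 0"] in \<open>simp add: Bex_def\<close>)
  from choice[OF this] obtain e where
    "\<forall>k. e k \<in> carrier G \<and> (\<forall>i<c. \<delta> i (e k) = (if i = k then 1 else 0))" ..
  then have e: "\<And>k. e k \<in> carrier G" "\<And>k i. i < c \<Longrightarrow> \<delta> i (e k) = (if i = k then 1 else 0)"
    by simp_all
  have "\<forall>k. \<exists>a. a \<in> carrier_vec m \<and> e k = ?comb a" using ex1 e(1) by blast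
  from choice[OF this] obtain a where "\<forall>k. a k \<in> carrier_vec m \<and> e k = ?comb (a k)" ..
  then have a: "\<And>k. a k \<in> carrier_vec m" "\<And>k. e k = ?comb (a k)" by blast+
  define T' where "T' = mat m c (\<lambda>(j, k). a k $ j)"
  have car: "T \<in> carrier_mat c m" "T' \<in> carrier_mat m c" by (simp_all add: T_def T'_def m_def)
  have TT': "T * T' = 1\<^sub>m c"
  proof (rule eq_matI)
    fix i k assume "i < dim_row (1\<^sub>m c :: int mat)" "k < dim_col (1\<^sub>m c :: int mat)"
    then have ik: "i < c" "k < c" by simp_all
    have "(T * T') $$ (i, k) = (\<Sum>j<m. a k $ j * \<delta> i (bs ! j))"
      using ik by (simp add: T_def T'_def m_def scalar_prod_def atLeast0LessThan mult.commute)
    also have "\<dots> = \<delta> i (e k)"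
      unfolding a(2) by (rule coord_finprod[symmetric]) (use ik bs in auto)
    finally show "(T * T') $$ (i, k) = 1\<^sub>m c $$ (i, k)" using e ik by simp
  qed (use car in auto)
  have T'T: "T' * T = 1\<^sub>m m"
  proof (rule eq_matI)
    fix l j assume "l < dim_row (1\<^sub>m m :: int mat)" "j < dim_col (1\<^sub>m m :: int mat)"
    then have lj: "l < m" "j < m" by simp_all
    have comb_eq: "bs ! j = ?comb v" if "v \<in> carrier_vec m" "T *\<^sub>v v = col T j" for v
    proof (rule coord_eqI)
      fix i assume i: "i < c"
      have "\<delta> i (?comb v) = (\<Sum>k<m. v $ k * \<delta> i (bs ! k))"
        by (rule coord_finprod) (use i bs in auto)
      also have "\<dots> = (T *\<^sub>v v) $ i"
        using i that(1) by (simp add: T_def m_def scalar_prod_def atLeast0LessThan mult.commute)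
      also have "(T *\<^sub>v v) $ i = \<delta> i (bs ! j)"
        unfolding that(2) using i lj by (simp add: T_def m_def)
      finally show "\<delta> i (bs ! j) = \<delta> i (?comb v)" by (rule sym)
    qed (use bs lj comb in auto)
    have cv: "col (T' * T) j \<in> carrier_vec m" by (rule carrier_vecI) (simp add: T'_def)
    have "T *\<^sub>v col (T' * T) j = col (T * (T' * T)) j"
      by (rule col_mult2[symmetric, OF car(1) mult_carrier_mat[OF car(2,1)] lj(2)])
    also have "T * (T' * T) = T * T' * T" by (rule assoc_mult_mat[symmetric, OF car(1,2,1)])
    also have "\<dots> = T" unfolding TT' using car(1) by (rule left_mult_one_mat)
    finally have 1: "bs ! j = ?comb (col (T' * T) j)" by (rule comb_eq[OF cv])
    have "T *\<^sub>v unit_vec m j = col T j"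
      using col_mult2[OF car(1) one_carrier_mat lj(2)] car(1) lj(2) by simp
    then have 2: "bs ! j = ?comb (unit_vec m j)" by (rule comb_eq[OF unit_vec_carrier])
    have "col (T' * T) j = unit_vec m j"
      using ex1[OF bs[OF lj(2)]] 1 2 cv unit_vec_carrier by blast
    then have "col (T' * T) j $ l = unit_vec m j $ l" by simp
    then show "(T' * T) $$ (l, j) = 1\<^sub>m m $$ (l, j)"
      using lj car by (simp add: unit_vec_def)
  qed (use car in auto)
  have "mtrace (T * T') = mtrace (T' * T)" by (rule mtrace_mult_commute[OF car])
  then have "int c = int m" unfolding TT' T'T by (simp add: mtrace_def)
  then have cm: "m = c" by simp
  then show "length bs = c" by (simp add: m_def)
  show "\<exists>T' \<in> carrier_mat c c. T * T' = 1\<^sub>m c \<and> T' * T = 1\<^sub>m c"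
    using car(2) TT' T'T unfolding cm by blast
qed

text \<open>\<open>endo_char_poly\<close> is a definite description over all bases: one basis
  realises \<open>M\<close>, and every other one gives a similar matrix.\<close>

lemma endo_char_poly_eq:
  assumes M: "M \<in> carrier_mat c c"
    and \<phi>: "\<And>x. x \<in> carrier G \<Longrightarrow> \<phi> x \<in> carrier G"
      "\<And>x i. x \<in> carrier G \<Longrightarrow> i < c \<Longrightarrow> \<delta> i (\<phi> x) = (\<Sum>k<c. M $$ (i, k) * \<delta> k x)"
  shows "endo_char_poly G \<phi> = char_poly M"
  unfolding endo_char_poly_def
proof (rule the_equality)
  have "\<forall>k. \<exists>x. x \<in> carrier G \<and> (\<forall>i<c. \<delta> i x = (if i = k then 1 else 0))"
    by (intro allI) (use coord_surj[of "\<lambda>i. if i = _ then 1 else 0"] in \<open>simp add: Bex_def\<close>)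
  from choice[OF this] obtain e where
    "\<forall>k. e k \<in> carrier G \<and> (\<forall>i<c. \<delta> i (e k) = (if i = k then 1 else 0))" ..
  then have e: "\<And>k. e k \<in> carrier G" "\<And>k i. i < c \<Longrightarrow> \<delta> i (e k) = (if i = k then 1 else 0)"
    by simp_all
  define bs where "bs = map e [0..<c]"
  have bs: "length bs = c" "\<And>j. j < c \<Longrightarrow> bs ! j = e j" by (simp_all add: bs_def)
  have comb: "finprod G (\<lambda>i. bs ! i [^] (a i :: int)) {..<c} \<in> carrier G" for a
    using e bs by (intro finprod_closed) auto
  have coord: "\<delta> i (finprod G (\<lambda>i. bs ! i [^] (a i :: int)) {..<c}) = a i" if "i < c" for i a
  proof -
    have "\<delta> i (finprod G (\<lambda>i. bs ! i [^] (a i :: int)) {..<c}) = (\<Sum>j<c. a j * \<delta> i (bs ! j))"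
      by (rule coord_finprod) (use that bs e in auto)
    also have "\<dots> = (\<Sum>j<c. if j = i then a i else 0)"
      by (rule sum.cong) (use that bs e in auto)
    finally show ?thesis using that by simp
  qed
  have "int_basis G bs"
    unfolding int_basis_def bs(1)
  proof (intro conjI ballI)
    show "set bs \<subseteq> carrier G" using e by (auto simp: bs_def)
    fix g assume g: "g \<in> carrier G"
    show "\<exists>!a. a \<in> carrier_vec c \<and> g = finprod G (\<lambda>i. bs ! i [^] (a $ i :: int)) {..<c}"
    proof (rule ex1I)
      show "vec c (\<lambda>i. \<delta> i g) \<in> carrier_vec c \<and>
          g = finprod G (\<lambda>i. bs ! i [^] (vec c (\<lambda>i. \<delta> i g) $ i :: int)) {..<c}"
      proof
        show "g = finprod G (\<lambda>i. bs ! i [^] (vec c (\<lambda>i. \<delta> i g) $ i :: int)) {..<c}"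
          by (rule coord_eqI[OF g comb]) (simp add: coord)
      qed simp
      fix a assume "a \<in> carrier_vec c \<and> g = finprod G (\<lambda>i. bs ! i [^] (a $ i :: int)) {..<c}"
      then show "a = vec c (\<lambda>i. \<delta> i g)" using coord by (intro eq_vecI) auto
    qed
  qed
  moreover have "matrix_of_endo G bs \<phi> M"
    unfolding matrix_of_endo_def bs(1)
  proof (intro conjI allI impI M)
    fix j assume j: "j < c"
    show "\<phi> (bs ! j) = finprod G (\<lambda>i. bs ! i [^] (M $$ (i, j))) {..<c}"
    proof (rule coord_eqI[OF _ comb])
      show "\<phi> (bs ! j) \<in> carrier G" using \<phi>(1) e bs j by simp
      fix i assume i: "i < c"
      have "\<delta> i (\<phi> (bs ! j)) = (\<Sum>k<c. if k = j then M $$ (i, j) else 0)"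
        unfolding bs(2)[OF j] \<phi>(2)[OF e(1) i] by (rule sum.cong) (use e in auto)
      then show "\<delta> i (\<phi> (bs ! j)) = \<delta> i (finprod G (\<lambda>i. bs ! i [^] (M $$ (i, j))) {..<c})"
        using coord[OF i] j by simp
    qed
  qed
  ultimately show "\<exists>bs A. int_basis G bs \<and> matrix_of_endo G bs \<phi> A \<and> char_poly M = char_poly A"
    by blast
next
  fix p assume "\<exists>bs A. int_basis G bs \<and> matrix_of_endo G bs \<phi> A \<and> p = char_poly A"
  then obtain bs A where bs: "int_basis G bs" and A: "matrix_of_endo G bs \<phi> A" and p: "p = char_poly A"
    by blast
  define T where "T = mat c (length bs) (\<lambda>(i, j). \<delta> i (bs ! j))"
  from basis_matrix_inverse[OF bs, folded T_def] obtain T' where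
    len: "length bs = c" and T': "T' \<in> carrier_mat c c" "T * T' = 1\<^sub>m c" "T' * T = 1\<^sub>m c" by blast
  have car: "T \<in> carrier_mat c c" "A \<in> carrier_mat c c"
    using A by (simp_all add: T_def len matrix_of_endo_def)
  have b: "bs ! j \<in> carrier G" if "j < c" for j
    using bs that len by (auto simp: int_basis_def)
  have "M * T = T * A"
  proof (rule eq_matI)
    fix i j assume "i < dim_row (T * A)" "j < dim_col (T * A)"
    then have ij: "i < c" "j < c" using car by auto
    have "(M * T) $$ (i, j) = (\<Sum>k<c. M $$ (i, k) * \<delta> k (bs ! j))"
      using ij M by (simp add: T_def len scalar_prod_def atLeast0LessThan)
    also have "\<dots> = \<delta> i (\<phi> (bs ! j))" using \<phi>(2)[OF b[OF ij(2)] ij(1)] ..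
    also have "\<phi> (bs ! j) = finprod G (\<lambda>i. bs ! i [^] (A $$ (i, j))) {..<c}"
      using A ij len by (simp add: matrix_of_endo_def)
    also have "\<delta> i \<dots> = (\<Sum>k<c. A $$ (k, j) * \<delta> i (bs ! k))"
      by (rule coord_finprod) (use ij b in auto)
    also have "\<dots> = (T * A) $$ (i, j)"
      using ij car by (simp add: T_def len scalar_prod_def atLeast0LessThan mult.commute)
    finally show "(M * T) $$ (i, j) = (T * A) $$ (i, j)" .
  qed (use car M in auto)
  then have "T * A * T' = M * (T * T')" using assoc_mult_mat[OF M car(1) T'(1)] by simp
  then have "M = T * A * T'" unfolding T'(2) using M by simp
  then have "similar_mat M A"
    by (intro similar_matI[of _ _ T T' c]) (use M car T' in auto)
  then show "p = char_poly M" using char_poly_similar p by metis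
qed

end

section \<open>Additivity of the dimension\<close>

text \<open>If \<open>m < b\<close>, padding with zeros to square size keeps the product. The
  reversed product would then also be the identity, but its entry at \<open>(m, m)\<close> is
  0.\<close>

lemma left_inverse_dim_le:
  fixes P Q :: "'k::field mat"
  assumes "P \<in> carrier_mat b m" "Q \<in> carrier_mat m b" "P * Q = 1\<^sub>m b"
  shows "b \<le> m"
proof (rule ccontr)
  assume "\<not> b \<le> m"
  then have m: "m < b" by simp
  define P' where "P' = mat b b (\<lambda>(i, j). if j < m then P $$ (i, j) else 0)"
  define Q' where "Q' = mat b b (\<lambda>(i, j). if i < m then Q $$ (i, j) else 0)"
  have car: "P' \<in> carrier_mat b b" "Q' \<in> carrier_mat b b" by (simp_all add: P'_def Q'_def)
  have "P' * Q' = 1\<^sub>m b"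
  proof (rule eq_matI)
    fix i j assume "i < dim_row (1\<^sub>m b :: 'k mat)" "j < dim_col (1\<^sub>m b :: 'k mat)"
    then have ij: "i < b" "j < b" by simp_all
    have "(P' * Q') $$ (i, j) = (\<Sum>l<b. if l < m then P $$ (i, l) * Q $$ (l, j) else 0)"
      using ij by (simp add: P'_def Q'_def scalar_prod_def atLeast0LessThan) (rule sum.cong, auto)
    also have "\<dots> = (\<Sum>l<m. P $$ (i, l) * Q $$ (l, j))"
      by (rule sum.mono_neutral_cong_right) (use m in auto)
    also have "\<dots> = (P * Q) $$ (i, j)"
      using ij assms(1,2) by (simp add: scalar_prod_def atLeast0LessThan)
    finally show "(P' * Q') $$ (i, j) = 1\<^sub>m b $$ (i, j)" unfolding assms(3) .
  qed (use car in auto)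
  then have "Q' * P' = 1\<^sub>m b" by (rule mat_mult_left_right_inverse[OF car])
  then have "(Q' * P') $$ (m, m) = 1" using m by simp
  moreover have "(Q' * P') $$ (m, m) = 0"
    using m by (simp add: P'_def Q'_def scalar_prod_def)
  ultimately show False by simp
qed

lemma mult_mat_vec_cancel:
  fixes f :: "'k::field mat"
  assumes "f \<in> carrier_mat b a" "inj_on ((*\<^sub>v) f) (carrier_vec a)"
    and "A \<in> carrier_mat a m" "B \<in> carrier_mat a m" "f * A = f * B"
  shows "A = B"
proof -
  have "col A j = col B j" if "j < m" for j
  proof (rule inj_onD[OF assms(2)])
    show "f *\<^sub>v col A j = f *\<^sub>v col B j"
      using assms(5) col_mult2[OF assms(1,3) that] col_mult2[OF assms(1,4) that] by simp
  qed (use assms that in auto)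
  then show ?thesis using assms(3,4) by (intro mat_col_eqI) auto
qed

text \<open>The sequence is split by a section \<open>S\<close> of \<open>g\<close> and a retraction
  \<open>R\<close> of \<open>f\<close>. The block matrices formed by \<open>f\<close>,
  \<open>S\<close> and by \<open>R\<close>, \<open>g\<close> are mutually inverse.\<close>

lemma exact_dim:
  fixes f g :: "'k::field mat"
  assumes f: "f \<in> carrier_mat b a" and g: "g \<in> carrier_mat c b"
    and inj: "inj_on ((*\<^sub>v) f) (carrier_vec a)"
    and ker: "((*\<^sub>v) f) ` carrier_vec a = mat_kernel g"
    and surj: "((*\<^sub>v) g) ` carrier_vec b = carrier_vec c"
  shows "b = a + c"
proof -
  have "\<forall>j. \<exists>s. s \<in> carrier_vec b \<and> (j < c \<longrightarrow> g *\<^sub>v s = unit_vec c j)"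
  proof
    fix j
    have "unit_vec c j \<in> ((*\<^sub>v) g) ` carrier_vec b" unfolding surj by simp
    then show "\<exists>s. s \<in> carrier_vec b \<and> (j < c \<longrightarrow> g *\<^sub>v s = unit_vec c j)" by force
  qed
  from choice[OF this] obtain s where "\<forall>j. s j \<in> carrier_vec b \<and> (j < c \<longrightarrow> g *\<^sub>v s j = unit_vec c j)" ..
  then have s: "\<And>j. s j \<in> carrier_vec b" "\<And>j. j < c \<Longrightarrow> g *\<^sub>v s j = unit_vec c j" by simp_all
  define S where "S = mat b c (\<lambda>(i, j). s j $ i)"
  have S: "S \<in> carrier_mat b c" by (simp add: S_def)
  have colS: "col S j = s j" if "j < c" for j using s(1)[of j] that by (intro eq_vecI) (auto simp: S_def)
  have gS: "g * S = 1\<^sub>m c"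
  proof (rule mat_col_eqI)
    fix j assume "j < dim_col (1\<^sub>m c :: 'k mat)"
    then have j: "j < c" by simp
    show "col (g * S) j = col (1\<^sub>m c) j"
      unfolding col_mult2[OF g S j] colS[OF j] s(2)[OF j] using j by simp
  qed (use g S in auto)
  have gf: "g * f = 0\<^sub>m c a"
  proof (rule mat_col_eqI)
    fix j assume "j < dim_col (0\<^sub>m c a :: 'k mat)"
    then have j: "j < a" by simp
    have "col f j = f *\<^sub>v unit_vec a j" using f j by auto
    then have "col f j \<in> mat_kernel g" unfolding ker[symmetric] by simp
    then have "g *\<^sub>v col f j = 0\<^sub>v c" using g by (simp add: mat_kernel_def)
    then show "col (g * f) j = col (0\<^sub>m c a) j"
      unfolding col_mult2[OF g f j] using j by (simp only:) simp
  qed (use g f in auto)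
  \<comment> \<open>The projection onto the kernel of \<open>g\<close>, so its columns lift through
    \<open>f\<close>.\<close>
  let ?E = "1\<^sub>m b - S * g"
  have Sg: "S * g \<in> carrier_mat b b" using S g by simp
  have E: "?E \<in> carrier_mat b b" using Sg by (rule minus_carrier_mat)
  have gE: "g * ?E = 0\<^sub>m c b"
  proof -
    have "g * ?E = g * 1\<^sub>m b - g * (S * g)" by (rule mult_minus_distrib_mat[OF g one_carrier_mat Sg])
    also have "g * (S * g) = g" using gS g S by (simp add: assoc_mult_mat[OF g S g, symmetric])
    finally show ?thesis using g by simp
  qed
  have "\<forall>j. \<exists>r. r \<in> carrier_vec a \<and> (j < b \<longrightarrow> f *\<^sub>v r = col ?E j)"
  proof
    fix j
    show "\<exists>r. r \<in> carrier_vec a \<and> (j < b \<longrightarrow> f *\<^sub>v r = col ?E j)"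
    proof (cases "j < b")
      case True
      have "g *\<^sub>v col ?E j = 0\<^sub>v c"
        using col_mult2[OF g E True] gE True by simp
      then have "col ?E j \<in> mat_kernel g" using g col_carrier_vec[OF True E] by (simp add: mat_kernel_def)
      then have "col ?E j \<in> ((*\<^sub>v) f) ` carrier_vec a" unfolding ker .
      then show ?thesis by force
    qed (auto intro: exI[of _ "0\<^sub>v a"])
  qed
  from choice[OF this] obtain r where "\<forall>j. r j \<in> carrier_vec a \<and> (j < b \<longrightarrow> f *\<^sub>v r j = col ?E j)" ..
  then have r: "\<And>j. r j \<in> carrier_vec a" "\<And>j. j < b \<Longrightarrow> f *\<^sub>v r j = col ?E j" by simp_all
  define R where "R = mat a b (\<lambda>(i, j). r j $ i)"
  have R: "R \<in> carrier_mat a b" by (simp add: R_def)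
  have colR: "col R j = r j" if "j < b" for j using r(1)[of j] that by (intro eq_vecI) (auto simp: R_def)
  have fR: "f * R = ?E"
  proof (rule mat_col_eqI)
    fix j assume "j < dim_col ?E"
    then have j: "j < b" using g by simp
    show "col (f * R) j = col ?E j"
      unfolding col_mult2[OF f R j] colR[OF j] r(2)[OF j] ..
  qed (use f R S g in auto)
  have Rf: "R * f = 1\<^sub>m a"
  proof (rule mult_mat_vec_cancel[OF f inj])
    have "f * (R * f) = ?E * f" using assoc_mult_mat[OF f R f] fR by simp
    also have "\<dots> = 1\<^sub>m b * f - S * g * f" by (rule minus_mult_distrib_mat[OF one_carrier_mat Sg f])
    also have "S * g * f = 0\<^sub>m b a" using assoc_mult_mat[OF S g f] gf S by simp
    also have "1\<^sub>m b * f - 0\<^sub>m b a = f * 1\<^sub>m a" using f by (intro eq_matI) auto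
    finally show "f * (R * f) = f * 1\<^sub>m a" .
  qed (use R f in auto)
  have RS: "R * S = 0\<^sub>m a c"
  proof (rule mult_mat_vec_cancel[OF f inj])
    have "f * (R * S) = ?E * S" using assoc_mult_mat[OF f R S] fR by simp
    also have "\<dots> = 1\<^sub>m b * S - S * g * S" by (rule minus_mult_distrib_mat[OF one_carrier_mat Sg S])
    also have "S * g * S = S" using assoc_mult_mat[OF S g S] gS S by simp
    also have "1\<^sub>m b * S - S = f * 0\<^sub>m a c" using S f by (intro eq_matI) auto
    finally show "f * (R * S) = f * 0\<^sub>m a c" .
  qed (use R S in auto)
  let ?P = "mat b (a + c) (\<lambda>(i, j). if j < a then f $$ (i, j) else S $$ (i, j - a))"
  let ?Q = "mat (a + c) b (\<lambda>(i, j). if i < a then R $$ (i, j) else g $$ (i - a, j))"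
  have split: "(\<Sum>l<a + c. h l) = (\<Sum>l<a. h l) + (\<Sum>l<c. h (l + a))" for h :: "nat \<Rightarrow> 'k"
  proof -
    have "(\<Sum>l=a..<a + c. h l) = (\<Sum>l=0..<c. h (l + a))"
      using sum.shift_bounds_nat_ivl[of h 0 a c] by (simp add: add.commute)
    then show ?thesis using sum.atLeastLessThan_concat[of 0 a "a + c" h] by (simp add: atLeast0LessThan)
  qed
  have PQ: "?P * ?Q = 1\<^sub>m b"
  proof (rule eq_matI)
    fix i j assume "i < dim_row (1\<^sub>m b :: 'k mat)" "j < dim_col (1\<^sub>m b :: 'k mat)"
    then have ij: "i < b" "j < b" by simp_all
    have "(?P * ?Q) $$ (i, j) = (\<Sum>l<a. f $$ (i, l) * R $$ (l, j)) + (\<Sum>l<c. S $$ (i, l) * g $$ (l, j))"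
      using ij by (simp add: scalar_prod_def atLeast0LessThan split)
    also have "\<dots> = (f * R) $$ (i, j) + (S * g) $$ (i, j)"
      using ij f R S g by (simp add: scalar_prod_def atLeast0LessThan)
    also have "\<dots> = 1\<^sub>m b $$ (i, j)"
      unfolding fR using ij S g by simp
    finally show "(?P * ?Q) $$ (i, j) = 1\<^sub>m b $$ (i, j)" .
  qed simp_all
  have QP: "?Q * ?P = 1\<^sub>m (a + c)"
  proof (rule eq_matI)
    fix i j assume "i < dim_row (1\<^sub>m (a + c) :: 'k mat)" "j < dim_col (1\<^sub>m (a + c) :: 'k mat)"
    then have ij: "i < a + c" "j < a + c" by simp_all
    have "(?Q * ?P) $$ (i, j) = (\<Sum>l<b. (if i < a then R $$ (i, l) else g $$ (i - a, l)) *
        (if j < a then f $$ (l, j) else S $$ (l, j - a)))"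
      using ij by (simp add: scalar_prod_def atLeast0LessThan)
    also have "\<dots> = (if i < a then if j < a then (R * f) $$ (i, j) else (R * S) $$ (i, j - a)
        else if j < a then (g * f) $$ (i - a, j) else (g * S) $$ (i - a, j - a))"
      using ij R S g f by (auto simp: scalar_prod_def atLeast0LessThan)
    also have "\<dots> = 1\<^sub>m (a + c) $$ (i, j)"
      unfolding Rf RS gf gS using ij by auto
    finally show "(?Q * ?P) $$ (i, j) = 1\<^sub>m (a + c) $$ (i, j)" .
  qed simp_all
  have "b \<le> a + c" by (rule left_inverse_dim_le[OF _ _ PQ]) simp_all
  moreover have "a + c \<le> b" by (rule left_inverse_dim_le[OF _ _ QP]) simp_all
  ultimately show ?thesis by simp
qed

lemma short_exact_qdim:
  assumes "short_exact V leq L M N" "x \<in> V"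
  shows "qdim M x = qdim L x + qdim N x"
proof -
  obtain f g where "module_hom V leq L M f" "module_hom V leq M N g"
    "inj_on ((*\<^sub>v) (f x)) (carrier_vec (qdim L x))"
    "((*\<^sub>v) (f x)) ` carrier_vec (qdim L x) = mat_kernel (g x)"
    "((*\<^sub>v) (g x)) ` carrier_vec (qdim M x) = carrier_vec (qdim N x)"
    using assms by (auto simp: short_exact_def)
  then show ?thesis using assms(2) by (intro exact_dim[of "f x" _ _ "g x"]) (auto simp: module_hom_def)
qed

section \<open>Modules over a finite poset\<close>

locale finite_poset =
  fixes V :: "'v set" and leq :: "'v \<Rightarrow> 'v \<Rightarrow> bool"
  assumes finV: "finite V"
    and leq_refl: "x \<in> V \<Longrightarrow> leq x x"
    and leq_antisym: "x \<in> V \<Longrightarrow> y \<in> V \<Longrightarrow> leq x y \<Longrightarrow> leq y x \<Longrightarrow> x = y"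
    and leq_trans: "x \<in> V \<Longrightarrow> y \<in> V \<Longrightarrow> z \<in> V \<Longrightarrow> leq x y \<Longrightarrow> leq y z \<Longrightarrow> leq x z"
begin

lemma hasse_path_nonempty: "hasse_path V leq p \<Longrightarrow> p \<noteq> []"
  by (cases p) auto

lemma hasse_path_in: "hasse_path V leq p \<Longrightarrow> set p \<subseteq> V"
proof (induction p rule: induct_list012)
  case (3 x y p)
  then show ?case by (auto simp: hasse_arrow_def)
qed auto

lemma hasse_path_between:
  "hasse_path V leq p \<Longrightarrow> y \<in> set p \<Longrightarrow> leq y (hd p) \<and> leq (last p) y"
proof (induction p arbitrary: y rule: induct_list012)
  case (3 x z p)
  have p: "hasse_path V leq (z # p)" "x \<in> V" "z \<in> V" "leq z x" using 3 by (auto simp: hasse_arrow_def)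
  have inV: "set (z # p) \<subseteq> V" by (rule hasse_path_in[OF p(1)])
  have l: "last (z # p) \<in> V" using inV last_in_set[of "z # p"] by blast
  have IH: "leq y z \<and> leq (last (z # p)) y" if "y \<in> set (z # p)" for y
    using 3(2)[OF p(1) that] by simp
  show ?case
  proof (cases "y = x")
    case True
    have "leq (last (z # p)) z" using IH[of z] by simp
    then have "leq (last (z # p)) x" using leq_trans[OF l p(3,2) _ p(4)] by simp
    then show ?thesis using True leq_refl[OF p(2)] by simp
  next
    case False
    then have y: "y \<in> set (z # p)" using 3(4) by simp
    then have "leq y x" using IH[OF y] p inV leq_trans[of y z x] by blast
    then show ?thesis using IH[OF y] by simp
  qed
qed (auto simp: leq_refl)

lemma path_map_carrier:
  assumes "\<And>x y. hasse_arrow V leq x y \<Longrightarrow> qmap M x y \<in> carrier_mat (qdim M y) (qdim M x)"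
  shows "hasse_path V leq p \<Longrightarrow> path_map M p \<in> carrier_mat (qdim M (last p)) (qdim M (hd p))"
proof (induction p rule: induct_list012)
  case (3 x y p)
  then have "path_map M (y # p) \<in> carrier_mat (qdim M (last (y # p))) (qdim M y)"
    "qmap M x y \<in> carrier_mat (qdim M y) (qdim M x)" using assms by auto
  then show ?case by auto
qed auto

text \<open>If both ends of a path lie in \<open>U\<close>, convexity keeps the path in
  \<open>U\<close> and its map is the identity; otherwise one end has dimension 0.\<close>

lemma hasse_module_thin:
  fixes U :: "'v set"
  assumes convex: "\<And>x y z. x \<in> U \<Longrightarrow> z \<in> U \<Longrightarrow> y \<in> V \<Longrightarrow> leq z y \<Longrightarrow> leq y x \<Longrightarrow> y \<in> U"
  shows "hasse_module V leq (thin_module U :: ('v, 'k::field) qrep)"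
proof -
  let ?M = "thin_module U :: ('v, 'k) qrep"
  have arrow: "qmap ?M x y \<in> carrier_mat (qdim ?M y) (qdim ?M x)" for x y
    by (simp add: thin_module_def Let_def)
  have car: "path_map ?M p \<in> carrier_mat (qdim ?M (last p)) (qdim ?M (hd p))" if "hasse_path V leq p" for p
    by (rule path_map_carrier[OF arrow that])
  have inside: "path_map ?M p = 1\<^sub>m 1" if "hasse_path V leq p" "set p \<subseteq> U" for p
    using that
  proof (induction p rule: induct_list012)
    case (2 x) then show ?case by (simp add: thin_module_def Let_def)
  next
    case (3 x y p)
    then have "path_map ?M (y # p) = 1\<^sub>m 1" by simp
    moreover have "qmap ?M x y = 1\<^sub>m 1" using 3 by (simp add: thin_module_def Let_def)
    ultimately show ?case by simp
  qed simp
  have "path_map ?M p = path_map ?M q"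
    if p: "hasse_path V leq p" and q: "hasse_path V leq q" and eq: "hd p = hd q" "last p = last q" for p q
  proof (cases "hd p \<in> U \<and> last p \<in> U")
    case True
    have "set r \<subseteq> U" if r: "hasse_path V leq r" "hd r \<in> U" "last r \<in> U" for r
      using hasse_path_between[OF r(1)] hasse_path_in[OF r(1)] r convex by blast
    then show ?thesis using True p q eq inside by simp
  next
    case False
    then have "qdim ?M (hd p) = 0 \<or> qdim ?M (last p) = 0" by (auto simp: thin_module_def Let_def)
    then show ?thesis using car[OF p] car[OF q] eq by (intro eq_matI) auto
  qed
  then show ?thesis using arrow by (auto simp: hasse_module_def)
qed

lemma module_hom_path:
  assumes hom: "module_hom V leq M N g"
    and M: "\<And>x y. hasse_arrow V leq x y \<Longrightarrow> qmap M x y \<in> carrier_mat (qdim M y) (qdim M x)"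
    and N: "\<And>x y. hasse_arrow V leq x y \<Longrightarrow> qmap N x y \<in> carrier_mat (qdim N y) (qdim N x)"
  shows "hasse_path V leq p \<Longrightarrow> path_map N p * g (hd p) = g (last p) * path_map M p"
proof (induction p rule: induct_list012)
  case (2 x)
  then have "g x \<in> carrier_mat (qdim N x) (qdim M x)" using hom by (auto simp: module_hom_def)
  then show ?case by simp
next
  case (3 x y p)
  then have p: "hasse_path V leq (y # p)" and a: "hasse_arrow V leq x y" and V: "x \<in> V" "y \<in> V"
    by (auto simp: hasse_arrow_def)
  have l: "last (y # p) \<in> V" using hasse_path_in[OF p] last_in_set[of "y # p"] by blast
  have g: "g z \<in> carrier_mat (qdim N z) (qdim M z)" if "z \<in> V" for z using hom that by (auto simp: module_hom_def)
  have PN: "path_map N (y # p) \<in> carrier_mat (qdim N (last (y # p))) (qdim N y)"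
    using path_map_carrier[OF N p] by simp
  have PM: "path_map M (y # p) \<in> carrier_mat (qdim M (last (y # p))) (qdim M y)"
    using path_map_carrier[OF M p] by simp
  have "path_map N (x # y # p) * g x = path_map N (y # p) * (qmap N x y * g x)"
    using assoc_mult_mat[OF PN N[OF a] g[OF V(1)]] by simp
  also have "qmap N x y * g x = g y * qmap M x y" using hom a by (simp add: module_hom_def)
  also have "path_map N (y # p) * (g y * qmap M x y) = path_map N (y # p) * g y * qmap M x y"
    using assoc_mult_mat[OF PN g[OF V(2)] M[OF a]] by simp
  also have "path_map N (y # p) * g y = g (last (y # p)) * path_map M (y # p)" using 3(2)[OF p] by simp
  also have "g (last (y # p)) * path_map M (y # p) * qmap M x y = g (last (y # p)) * path_map M (x # y # p)"
    using assoc_mult_mat[OF g[OF l] PM M[OF a]] by simp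
  finally show ?case by simp
qed simp

text \<open>A right inverse of \<open>g\<close> at each vertex expresses the path maps of
  \<open>N\<close> through those of \<open>M\<close>. The \<open>h x\<close> are linear sections
  vertex by vertex, not a homomorphism of modules.\<close>

lemma hasse_module_quotient:
  assumes M: "hasse_module V leq M" and hom: "module_hom V leq M N g"
    and N: "\<And>x y. hasse_arrow V leq x y \<Longrightarrow> qmap N x y \<in> carrier_mat (qdim N y) (qdim N x)"
    and h: "\<And>x. x \<in> V \<Longrightarrow> h x \<in> carrier_mat (qdim M x) (qdim N x)"
      "\<And>x. x \<in> V \<Longrightarrow> g x * h x = 1\<^sub>m (qdim N x)"
  shows "hasse_module V leq N"
proof -
  have Ma: "qmap M x y \<in> carrier_mat (qdim M y) (qdim M x)" if "hasse_arrow V leq x y" for x y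
    using M that by (auto simp: hasse_module_def)
  have path: "path_map N p = g (last p) * path_map M p * h (hd p)" if p: "hasse_path V leq p" for p
  proof -
    have hd: "hd p \<in> V" using hasse_path_in[OF p] hasse_path_nonempty[OF p] by auto
    have gc: "g (hd p) \<in> carrier_mat (qdim N (hd p)) (qdim M (hd p))" using hom hd by (auto simp: module_hom_def)
    have PN: "path_map N p \<in> carrier_mat (qdim N (last p)) (qdim N (hd p))"
      by (rule path_map_carrier[OF N p])
    have "path_map N p = path_map N p * (g (hd p) * h (hd p))" using h(2)[OF hd] PN by simp
    also have "\<dots> = path_map N p * g (hd p) * h (hd p)" by (rule assoc_mult_mat[OF PN gc h(1)[OF hd], symmetric])
    also have "path_map N p * g (hd p) = g (last p) * path_map M p"
      by (rule module_hom_path[OF hom Ma N p])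
    finally show ?thesis .
  qed
  have "path_map N p = path_map N q"
    if "hasse_path V leq p" "hasse_path V leq q" "hd p = hd q" "last p = last q" for p q
  proof -
    have "path_map M p = path_map M q" using M that unfolding hasse_module_def by blast
    then show ?thesis unfolding path[OF that(1)] path[OF that(2)] that(3,4) by simp
  qed
  then show ?thesis using N by (auto simp: hasse_module_def)
qed

end

lemma eq_mat_if_empty:
  "A \<in> carrier_mat m n \<Longrightarrow> B \<in> carrier_mat m n \<Longrightarrow> m = 0 \<or> n = 0 \<Longrightarrow> A = B"
  by (intro eq_matI) auto

context finite_poset
begin

lemma minimal_support:
  assumes "U \<subseteq> V" "U \<noteq> {}"
  shows "\<exists>x\<in>U. \<forall>y\<in>U. leq y x \<longrightarrow> y = x"
proof -
  have finU: "finite U" using assms(1) finV finite_subset by blast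
  let ?n = "\<lambda>x. card {y\<in>V. leq y x}"
  obtain x where x: "x \<in> U" "\<And>y. y \<in> U \<Longrightarrow> ?n x \<le> ?n y"
    using ex_min_if_finite[of "?n ` U"] finU assms(2) by (force simp: not_less)
  have "y = x" if y: "y \<in> U" "leq y x" for y
  proof (rule ccontr)
    assume "y \<noteq> x"
    have V: "x \<in> V" "y \<in> V" using x y assms(1) by auto
    have "\<not> leq x y" using \<open>y \<noteq> x\<close> leq_antisym V y by blast
    then have "{z\<in>V. leq z y} \<subset> {z\<in>V. leq z x}"
      using V y leq_refl leq_trans[OF _ V(2,1) _ y(2)] by blast
    then have "?n y < ?n x" using finV by (intro psubset_card_mono) auto
    then show False using x(2)[OF y(1)] by simp
  qed
  then show ?thesis using x by blast
qed

text \<open>The zeta matrix is unitriangular: a simple is the projective at \<open>x\<close> minus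
  the simples strictly below \<open>x\<close>. The solution is a column of the Moebius function of
  the poset.\<close>

lemma zeta_unit_vector:
  "x \<in> V \<Longrightarrow> \<exists>a :: 'v \<Rightarrow> int. \<forall>w\<in>V. (\<Sum>u\<in>V. if leq w u then a u else 0) = (if w = x then 1 else 0)"
proof (induction "card {y\<in>V. leq y x}" arbitrary: x rule: less_induct)
  case less
  let ?D = "{y\<in>V. leq y x} - {x}"
  have finD: "finite ?D" using finV by simp
  have "\<exists>a :: 'v \<Rightarrow> int. \<forall>w\<in>V. (\<Sum>u\<in>V. if leq w u then a u else 0) = (if w = y then 1 else 0)" if y: "y \<in> ?D" for y
  proof (rule less.hyps)
    have "\<not> leq x y" using leq_antisym less.prems y by blast
    then have "{z\<in>V. leq z y} \<subset> {z\<in>V. leq z x}"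
      using less.prems y leq_refl leq_trans[of _ y x] by blast
    then show "card {z\<in>V. leq z y} < card {z\<in>V. leq z x}" using finV by (intro psubset_card_mono) auto
    show "y \<in> V" using y by simp
  qed
  then have "\<forall>y\<in>?D. \<exists>a :: 'v \<Rightarrow> int. \<forall>w\<in>V. (\<Sum>u\<in>V. if leq w u then a u else 0) = (if w = y then 1 else 0)"
    by blast
  from bchoice[OF this] obtain A :: "'v \<Rightarrow> 'v \<Rightarrow> int" where
    A: "\<And>y w. y \<in> ?D \<Longrightarrow> w \<in> V \<Longrightarrow> (\<Sum>u\<in>V. if leq w u then A y u else 0) = (if w = y then 1 else 0)"
    by blast
  let ?a = "\<lambda>u. (if u = x then 1 else 0) - (\<Sum>y\<in>?D. A y u)"
  show ?case
  proof (intro exI[of _ ?a] ballI)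
    fix w assume w: "w \<in> V"
    have "(\<Sum>u\<in>V. if leq w u then ?a u else 0) =
        (\<Sum>u\<in>V. (if u = x then if leq w x then 1 else 0 else 0) - (\<Sum>y\<in>?D. if leq w u then A y u else 0))"
      by (rule sum.cong) auto
    also have "\<dots> = (if leq w x then 1 else 0) - (\<Sum>y\<in>?D. \<Sum>u\<in>V. if leq w u then A y u else 0)"
      using finV less.prems by (simp add: sum_subtractf sum.swap[of _ V])
    also have "(\<Sum>y\<in>?D. \<Sum>u\<in>V. if leq w u then A y u else 0) = (\<Sum>y\<in>?D. if y = w then 1 else 0)"
      by (rule sum.cong) (use A w in auto)
    also have "\<dots> = (if w \<in> ?D then 1 else 0)" using finD by simp
    finally show "(\<Sum>u\<in>V. if leq w u then ?a u else 0) = (if w = x then 1 else 0)"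
      using w leq_refl by auto
  qed
qed

abbreviation simple :: "'v \<Rightarrow> ('v, 'k::field) qrep" where
  "simple x \<equiv> thin_module {x}"

lemma hasse_module_simple: "x \<in> V \<Longrightarrow> hasse_module V leq (simple x :: ('v, 'k::field) qrep)"
  by (intro hasse_module_thin) (use leq_antisym in blast)

text \<open>No arrow from \<open>x\<close> leads into the support, so every line at \<open>x\<close>
  is a submodule. The first coordinate line is split off.\<close>

lemma simple_submodule:
  fixes M :: "('v, 'k::field) qrep"
  assumes M: "hasse_module V leq M" and x: "x \<in> V" "qdim M x = Suc d"
    and minimal: "\<And>y. hasse_arrow V leq x y \<Longrightarrow> qdim M y = 0"
  shows "\<exists>N. short_exact V leq (simple x) M N \<and> qdim N = (qdim M)(x := d)"
proof -
  have Ma: "qmap M y z \<in> carrier_mat (qdim M z) (qdim M y)" if "hasse_arrow V leq y z" for y z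
    using M that by (auto simp: hasse_module_def)
  \<comment> \<open>\<open>dropm\<close> forgets the first coordinate, \<open>embm\<close> is a
    section of it, and \<open>col0\<close> spans its kernel.\<close>
  define dropm :: "'k mat" where "dropm = mat d (Suc d) (\<lambda>(i, j). if j = Suc i then 1 else 0)"
  define embm :: "'k mat" where "embm = mat (Suc d) d (\<lambda>(i, j). if i = Suc j then 1 else 0)"
  define col0 :: "'k mat" where "col0 = mat (Suc d) 1 (\<lambda>(i, j). if i = 0 then 1 else 0)"
  define G where "G y = (if y = x then dropm else 1\<^sub>m (qdim M y))" for y
  define H where "H y = (if y = x then embm else 1\<^sub>m (qdim M y))" for y
  define f where "f y = (if y = x then col0 else 0\<^sub>m (qdim M y) 0)" for y
  define dN where "dN = (qdim M)(x := d)"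
  define N where "N = QRep dN (\<lambda>y z. G z * (qmap M y z * H y))"
  have G: "G y \<in> carrier_mat (dN y) (qdim M y)" for y using x(2) by (simp add: G_def dN_def dropm_def)
  have H: "H y \<in> carrier_mat (qdim M y) (dN y)" for y using x(2) by (simp add: H_def dN_def embm_def)
  have "dropm * embm = 1\<^sub>m d"
    by (rule eq_matI) (auto simp: dropm_def embm_def scalar_prod_def sum.delta if_distrib[of "\<lambda>a. a * _"] cong: if_cong)
  then have GH: "G y * H y = 1\<^sub>m (dN y)" for y by (simp add: G_def H_def dN_def)
  have qdN: "qdim N = dN" by (simp add: N_def)
  have Na: "qmap N y z \<in> carrier_mat (qdim N z) (qdim N y)" if "hasse_arrow V leq y z" for y z
    using G H Ma[OF that] by (auto simp: N_def intro!: mult_carrier_mat[of _ _ "qdim M _"])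
  have homN: "module_hom V leq M N G"
    unfolding module_hom_def
  proof (intro conjI ballI allI impI)
    show "G y \<in> carrier_mat (qdim N y) (qdim M y)" if "y \<in> V" for y using G by (simp add: qdN)
    fix y z assume a: "hasse_arrow V leq y z"
    show "G z * qmap M y z = qmap N y z * G y"
    proof (cases "y = x")
      case True
      then have "qdim M z = 0" "z \<noteq> x" using minimal a by (auto simp: hasse_arrow_def)
      then have "dN z = 0" by (simp add: dN_def)
      moreover have "G z * qmap M y z \<in> carrier_mat (dN z) (qdim M y)"
        "qmap N y z * G y \<in> carrier_mat (dN z) (qdim M y)"
        using G[of z] G[of y] Ma[OF a] Na[OF a] unfolding qdN by (auto intro: mult_carrier_mat)
      ultimately show ?thesis using \<open>dN z = 0\<close> by (blast intro: eq_mat_if_empty)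
    next
      case False
      then show ?thesis using Ma[OF a] G[of z] by (simp add: N_def H_def G_def[of y])
    qed
  qed
  have N: "hasse_module V leq N"
    by (rule hasse_module_quotient[OF M homN Na, of H]) (use H GH qdN in auto)
  have qL: "qdim (simple x :: ('v, 'k) qrep) y = (if y = x then 1 else 0)" for y
    by (simp add: thin_module_def Let_def)
  have fc: "f y \<in> carrier_mat (qdim M y) (qdim (simple x :: ('v, 'k) qrep) y)" for y
    using x(2) by (simp add: f_def qL col0_def)
  have homL: "module_hom V leq (simple x) M f"
    unfolding module_hom_def
  proof (intro conjI ballI allI impI)
    show "f y \<in> carrier_mat (qdim M y) (qdim (simple x :: ('v, 'k) qrep) y)" for y by (rule fc)
    fix y z assume a: "hasse_arrow V leq y z"
    let ?L = "simple x :: ('v, 'k) qrep"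
    have La: "qmap ?L y z \<in> carrier_mat (qdim ?L z) (qdim ?L y)" by (simp add: thin_module_def Let_def)
    have "f z * qmap ?L y z \<in> carrier_mat (qdim M z) (qdim ?L y)" "qmap M y z * f y \<in> carrier_mat (qdim M z) (qdim ?L y)"
      using La Ma[OF a] fc[of y] fc[of z] by (auto intro: mult_carrier_mat)
    moreover have "qdim M z = 0 \<or> qdim ?L y = 0" using minimal a qL[of y] by (cases "y = x") auto
    ultimately show "f z * qmap ?L y z = qmap M y z * f y" by (blast intro: eq_mat_if_empty)
  qed
  have "inj_on ((*\<^sub>v) (f y)) (carrier_vec (qdim (simple x :: ('v, 'k) qrep) y)) \<and>
      ((*\<^sub>v) (f y)) ` carrier_vec (qdim (simple x :: ('v, 'k) qrep) y) = mat_kernel (G y) \<and>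
      ((*\<^sub>v) (G y)) ` carrier_vec (qdim M y) = carrier_vec (qdim N y)" if "y \<in> V" for y
  proof (intro conjI)
    show "((*\<^sub>v) (G y)) ` carrier_vec (qdim M y) = carrier_vec (qdim N y)"
    proof (intro equalityI subsetI)
      fix v :: "'k vec" assume "v \<in> carrier_vec (qdim N y)"
      then have v: "v \<in> carrier_vec (dN y)" by (simp add: qdN)
      then have "v = G y *\<^sub>v (H y *\<^sub>v v)"
        using assoc_mult_mat_vec[OF G[of y] H[of y] v] GH[of y] by simp
      moreover have "H y *\<^sub>v v \<in> carrier_vec (qdim M y)" using H[of y] v by auto
      ultimately show "v \<in> ((*\<^sub>v) (G y)) ` carrier_vec (qdim M y)" by blast
    qed (use G[of y] qdN in auto)
    show "inj_on ((*\<^sub>v) (f y)) (carrier_vec (qdim (simple x :: ('v, 'k) qrep) y))"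
    proof (cases "y = x")
      case True
      show ?thesis
      proof (rule inj_onI)
        fix v w :: "'k vec"
        assume vw: "v \<in> carrier_vec (qdim (simple x :: ('v, 'k) qrep) y)"
          "w \<in> carrier_vec (qdim (simple x :: ('v, 'k) qrep) y)" "f y *\<^sub>v v = f y *\<^sub>v w"
        then have "(col0 *\<^sub>v v) $ 0 = (col0 *\<^sub>v w) $ 0" using True by (simp add: f_def)
        then have "v $ 0 = w $ 0" using vw(1,2) True by (simp add: col0_def qL scalar_prod_def)
        then show "v = w" using vw(1,2) True by (intro eq_vecI) (auto simp: qL)
      qed
    next
      case False
      then show ?thesis by (auto simp: qL inj_on_def intro!: eq_vecI)
    qed
    show "((*\<^sub>v) (f y)) ` carrier_vec (qdim (simple x :: ('v, 'k) qrep) y) = mat_kernel (G y)"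
    proof (cases "y = x")
      case True
      show ?thesis
      proof (intro equalityI subsetI)
        fix w assume "w \<in> ((*\<^sub>v) (f y)) ` carrier_vec (qdim (simple x :: ('v, 'k) qrep) y)"
        then obtain v where v: "v \<in> carrier_vec 1" "w = col0 *\<^sub>v v" using True by (auto simp: qL f_def)
        have "dropm *\<^sub>v w = (dropm * col0) *\<^sub>v v"
          unfolding v(2) by (rule assoc_mult_mat_vec[symmetric]) (use v in \<open>auto simp: dropm_def col0_def\<close>)
        also have "dropm * col0 = 0\<^sub>m d 1"
          by (rule eq_matI) (auto simp: dropm_def col0_def scalar_prod_def intro!: sum.neutral)
        finally have "dropm *\<^sub>v w = 0\<^sub>v d" using v by auto
        moreover have "w \<in> carrier_vec (Suc d)" unfolding v(2) by (rule carrier_vecI) (simp add: col0_def)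
        ultimately show "w \<in> mat_kernel (G y)" using True by (simp add: mat_kernel_def G_def dropm_def)
      next
        fix w assume "w \<in> mat_kernel (G y)"
        then have w: "w \<in> carrier_vec (Suc d)" "dropm *\<^sub>v w = 0\<^sub>v d"
          using True by (auto simp: mat_kernel_def G_def dropm_def)
        have "w $ Suc i = 0" if "i < d" for i
        proof -
          have "(dropm *\<^sub>v w) $ i = (\<Sum>j<Suc d. if j = Suc i then w $ j else 0)"
            using that w(1) by (simp add: dropm_def scalar_prod_def atLeast0LessThan if_distrib[of "\<lambda>a. a * _"] cong: if_cong)
          also have "\<dots> = w $ Suc i" using that by (simp only: sum.delta finite_lessThan lessThan_iff) simp
          finally show ?thesis using w(2) that by simp
        qed
        then have "w = col0 *\<^sub>v vec 1 (\<lambda>_. w $ 0)"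
          using w(1) by (intro eq_vecI) (auto simp: col0_def scalar_prod_def gr0_conv_Suc)
        then show "w \<in> ((*\<^sub>v) (f y)) ` carrier_vec (qdim (simple x :: ('v, 'k) qrep) y)"
          using True by (auto simp: qL f_def)
      qed
    next
      case False
      have "((*\<^sub>v) (f y)) ` carrier_vec 0 = {0\<^sub>v (qdim M y)}"
      proof -
        have "carrier_vec 0 = {0\<^sub>v 0 :: 'k vec}" by (auto intro!: eq_vecI)
        then show ?thesis using False by (auto simp: f_def intro!: eq_vecI)
      qed
      moreover have "mat_kernel (G y) = {0\<^sub>v (qdim M y)}"
        using False by (auto simp: mat_kernel_def G_def)
      ultimately show ?thesis using False by (simp add: qL)
    qed
  qed
  then have "short_exact V leq (simple x) M N"
    unfolding short_exact_def using M N hasse_module_simple[OF x(1)] homL homN by blast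
  then show ?thesis using qdN dN_def by blast
qed

text \<open>Representations that vanish on \<open>V\<close> can differ elsewhere and are then
  distinct generators. This sequence gives the relation \<open>M - M - M\<close>, so each of them
  has class zero.\<close>

lemma zero_module_exact:
  fixes M :: "('v, 'k::field) qrep"
  assumes "hasse_module V leq M" "\<And>x. x \<in> V \<Longrightarrow> qdim M x = 0"
  shows "short_exact V leq M M M"
proof -
  have Ma: "qmap M y z \<in> carrier_mat (qdim M z) (qdim M y)" if "hasse_arrow V leq y z" for y z
    using assms(1) that by (auto simp: hasse_module_def)
  have hom: "module_hom V leq M M (\<lambda>x. 1\<^sub>m (qdim M x))"
    unfolding module_hom_def
  proof (intro conjI ballI allI impI)
    fix y z assume "hasse_arrow V leq y z"
    from Ma[OF this] show "1\<^sub>m (qdim M z) * qmap M y z = qmap M y z * 1\<^sub>m (qdim M y)" by simp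
  qed simp
  have z: "v = 0\<^sub>v 0" if "v \<in> carrier_vec 0" for v :: "'k vec" using that by (intro eq_vecI) auto
  have exact: "inj_on ((*\<^sub>v) (1\<^sub>m (qdim M x) :: 'k mat)) (carrier_vec (qdim M x)) \<and>
      ((*\<^sub>v) (1\<^sub>m (qdim M x))) ` carrier_vec (qdim M x) = mat_kernel (1\<^sub>m (qdim M x) :: 'k mat) \<and>
      ((*\<^sub>v) (1\<^sub>m (qdim M x))) ` carrier_vec (qdim M x) = (carrier_vec (qdim M x) :: 'k vec set)"
    if "x \<in> V" for x
  proof -
    have d: "qdim M x = 0" by (rule assms(2)[OF that])
    have c: "carrier_vec (qdim M x) = {0\<^sub>v 0 :: 'k vec}" unfolding d using z zero_carrier_vec by blast
    have m: "1\<^sub>m (qdim M x) *\<^sub>v 0\<^sub>v 0 = (0\<^sub>v 0 :: 'k vec)" unfolding d by (rule one_mult_mat_vec) (rule zero_carrier_vec)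
    have k: "mat_kernel (1\<^sub>m (qdim M x)) = {0\<^sub>v 0 :: 'k vec}"
    proof (rule subset_antisym)
      show "mat_kernel (1\<^sub>m (qdim M x)) \<subseteq> {0\<^sub>v 0 :: 'k vec}"
        unfolding c[symmetric] mat_kernel_def by (rule subsetI) simp
      have "0\<^sub>v 0 \<in> mat_kernel (1\<^sub>m (qdim M x) :: 'k mat)"
        by (rule mat_kernelI[OF one_carrier_mat]) (use m[unfolded d] d in simp_all)
      then show "{0\<^sub>v 0 :: 'k vec} \<subseteq> mat_kernel (1\<^sub>m (qdim M x))" by blast
    qed
    show ?thesis unfolding c k image_insert image_empty m by simp
  qed
  show ?thesis unfolding short_exact_def using assms(1) hom exact by blast
qed

end

section \<open>The Grothendieck group\<close>

text \<open>The linear extension of the dimension at \<open>x\<close>; the integers appear as the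
  free group on one generator so that \<open>frag_extend\<close> can be used.\<close>

definition frag_dim :: "'v \<Rightarrow> (('v, 'k::field) qrep \<Rightarrow>\<^sub>0 int) \<Rightarrow> int" where
  "frag_dim x c = Poly_Mapping.lookup (frag_extend (\<lambda>M. frag_cmul (int (qdim M x)) (frag_of ())) c) ()"

lemma frag_dim_of: "frag_dim x (frag_of M) = int (qdim M x)"
  by (simp add: frag_dim_def)

lemma frag_dim_0: "frag_dim x 0 = 0"
  by (simp add: frag_dim_def)

lemma frag_dim_add: "frag_dim x (a + b) = frag_dim x a + frag_dim x b"
  by (simp add: frag_dim_def frag_extend_add lookup_add)

lemma frag_dim_diff: "frag_dim x (a - b) = frag_dim x a - frag_dim x b"
  by (simp add: frag_dim_def frag_extend_diff lookup_minus)

lemma frag_dim_minus: "frag_dim x (- a) = - frag_dim x a"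
  using frag_dim_diff[of x 0 a] by (simp add: frag_dim_0)

lemma frag_dim_cmul: "frag_dim x (frag_cmul k a) = k * frag_dim x a"
  by (simp add: frag_dim_def frag_extend_cmul)

lemma frag_dim_sum: "finite A \<Longrightarrow> frag_dim x (\<Sum>i\<in>A. b i) = (\<Sum>i\<in>A. frag_dim x (b i))"
  by (induction A rule: finite_induct) (simp_all add: frag_dim_0 frag_dim_add)

definition K0_dim :: "'v \<Rightarrow> ('v, 'k::field) qrep_K0 \<Rightarrow> int" where
  "K0_dim x C = frag_dim x (SOME c. c \<in> C)"

context finite_poset
begin

lemma qdim_thin: "qdim (thin_module U) x = (if x \<in> U then 1 else 0)"
  by (simp add: thin_module_def Let_def)

lemma comm_group_free_on_modules: "comm_group (free_on_modules V leq)"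
  by (simp add: free_on_modules_def abelian_free_Abelian_group)

lemma carrier_free_on_modules:
  "c \<in> carrier (free_on_modules V leq) \<longleftrightarrow> Poly_Mapping.keys c \<subseteq> {M. hasse_module V leq M}"
  by (simp add: free_on_modules_def)

lemma subgroup_exact_relations:
  "subgroup (exact_relations V leq :: (('v, 'k::field) qrep \<Rightarrow>\<^sub>0 int) set) (free_on_modules V leq)"
  unfolding exact_relations_def
proof (rule group.generate_is_subgroup)
  show "{frag_of M - frag_of L - frag_of N | L M N. short_exact V leq L M (N :: ('v, 'k) qrep)} \<subseteq>
      carrier (free_on_modules V leq)"
  proof safe
    fix L M N :: "('v, 'k) qrep"
    assume "short_exact V leq L M N"
    then have "hasse_module V leq L" "hasse_module V leq M" "hasse_module V leq N"
      by (simp_all add: short_exact_def)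
    then show "frag_of M - frag_of L - frag_of N \<in> carrier (free_on_modules V leq)"
      unfolding carrier_free_on_modules
      using keys_diff[of "frag_of M - frag_of L" "frag_of N"] keys_diff[of "frag_of M" "frag_of L"] by auto
  qed
qed (simp add: free_on_modules_def)

lemma relations_zero: "0 \<in> exact_relations V leq"
  using subgroup.one_closed[OF subgroup_exact_relations] by (simp add: free_on_modules_def)

lemma relations_add:
  "a \<in> exact_relations V leq \<Longrightarrow> b \<in> exact_relations V leq \<Longrightarrow> a + b \<in> exact_relations V leq"
  using subgroup.m_closed[OF subgroup_exact_relations, of a b] by (simp add: free_on_modules_def)

lemma relations_minus: "a \<in> exact_relations V leq \<Longrightarrow> - a \<in> exact_relations V leq"
  using subgroup.m_inv_closed[OF subgroup_exact_relations, of a]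
    subgroup.mem_carrier[OF subgroup_exact_relations, of a]
  by (simp add: free_on_modules_def)

lemma relations_exact:
  "short_exact V leq L M N \<Longrightarrow> frag_of M - frag_of L - frag_of N \<in> exact_relations V leq"
  unfolding exact_relations_def by (rule generate.incl) blast

lemma frag_of_eq_simples:
  fixes M :: "('v, 'k::field) qrep"
  assumes "hasse_module V leq M"
  shows "frag_of M - (\<Sum>y\<in>V. frag_cmul (int (qdim M y)) (frag_of (simple y))) \<in> exact_relations V leq"
  using assms
proof (induction "\<Sum>y\<in>V. qdim M y" arbitrary: M)
  case 0
  then have z: "\<And>x. x \<in> V \<Longrightarrow> qdim M x = 0" using finV by simp
  have "- (frag_of M - frag_of M - frag_of M) \<in> exact_relations V leq"
    by (intro relations_minus relations_exact zero_module_exact 0(2) z)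
  moreover have "(\<Sum>y\<in>V. frag_cmul (int (qdim M y)) (frag_of (simple y :: ('v, 'k) qrep))) = 0"
    by (rule sum.neutral) (simp add: z)
  ultimately show ?case by simp
next
  case (Suc s)
  let ?U = "{y\<in>V. qdim M y \<noteq> 0}"
  have "?U \<noteq> {}"
  proof
    assume "?U = {}"
    then have "(\<Sum>y\<in>V. qdim M y) = 0" by (intro sum.neutral) auto
    then show False using Suc(2) by simp
  qed
  then obtain x where x: "x \<in> ?U" "\<And>y. y \<in> ?U \<Longrightarrow> leq y x \<Longrightarrow> y = x"
    using minimal_support[of ?U] by blast
  obtain d where d: "qdim M x = Suc d" using x(1) not0_implies_Suc by auto
  have "qdim M y = 0" if "hasse_arrow V leq x y" for y
    using x(2)[of y] that by (auto simp: hasse_arrow_def)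
  from simple_submodule[OF Suc(3) _ d this] x(1) obtain N where
    N: "short_exact V leq (simple x) M N" "qdim N = (qdim M)(x := d)" by blast
  have xV: "x \<in> V" using x(1) by simp
  let ?S = "\<lambda>M :: ('v, 'k) qrep. \<Sum>y\<in>V. frag_cmul (int (qdim M y)) (frag_of (simple y :: ('v, 'k) qrep))"
  have "(\<Sum>y\<in>V. qdim M y) = Suc (\<Sum>y\<in>V. qdim N y)"
    using finV xV by (simp add: sum.remove[of V x] N(2) d)
  then have s: "s = (\<Sum>y\<in>V. qdim N y)" using Suc(2) by simp
  have 1: "frag_of N - ?S N \<in> exact_relations V leq"
    by (rule Suc(1)[OF s]) (use N(1) in \<open>simp add: short_exact_def\<close>)
  have "?S M = frag_of (simple x) + ?S N"
    using finV xV by (simp add: sum.remove[of V x] N(2) d frag_cmul_distrib)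
  then have eq: "frag_of M - ?S M = (frag_of M - frag_of (simple x) - frag_of N) + (frag_of N - ?S N)" by simp
  show ?case unfolding eq by (rule relations_add[OF relations_exact[OF N(1)] 1])
qed

lemma frag_eq_simples:
  assumes "c \<in> carrier (free_on_modules V leq)"
  shows "c - (\<Sum>y\<in>V. frag_cmul (frag_dim y c) (frag_of (simple y))) \<in> exact_relations V leq"
  using assms[unfolded carrier_free_on_modules]
proof (induction c rule: frag_induction)
  case zero
  then show ?case by (simp add: frag_dim_0 relations_zero)
next
  case (one M)
  then show ?case using frag_of_eq_simples[of M] by (simp add: frag_dim_of)
next
  case (diff a b)
  let ?S = "\<lambda>c. \<Sum>y\<in>V. frag_cmul (frag_dim y c) (frag_of (simple y))"
  have "a - b - ?S (a - b) = (a - ?S a) + - (b - ?S b)"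
    by (simp add: frag_dim_diff frag_cmul_diff_distrib sum_subtractf)
  then show ?case using relations_add[OF diff(1) relations_minus[OF diff(2)]] by (simp only:)
qed

lemma frag_dim_relation:
  fixes r :: "('v, 'k::field) qrep \<Rightarrow>\<^sub>0 int"
  assumes "r \<in> exact_relations V leq" "x \<in> V"
  shows "frag_dim x r = 0"
proof -
  let ?E = "{frag_of M - frag_of L - frag_of N | L M N. short_exact V leq L M (N :: ('v, 'k) qrep)}"
  have gen: "frag_dim x h = 0" if mem: "h \<in> ?E" for h
  proof -
    obtain L M N :: "('v, 'k) qrep" where h: "short_exact V leq L M N" "h = frag_of M - frag_of L - frag_of N"
      using mem by blast
    show ?thesis using short_exact_qdim[OF h(1) assms(2)] by (simp add: h(2) frag_dim_diff frag_dim_of)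
  qed
  show ?thesis using assms(1) unfolding exact_relations_def
  proof (induction r rule: generate.induct)
    case one
    then show ?case by (simp add: free_on_modules_def frag_dim_0)
  next
    case (incl h)
    then show ?case by (rule gen)
  next
    case (inv h)
    then have "h \<in> exact_relations V leq" unfolding exact_relations_def by (rule generate.incl)
    then have "inv\<^bsub>free_on_modules V leq\<^esub> h = - h"
      using subgroup.mem_carrier[OF subgroup_exact_relations, of h] by (simp add: free_on_modules_def)
    then show ?case using gen[OF inv] by (simp add: frag_dim_minus)
  next
    case (eng a b)
    then show ?case by (simp add: free_on_modules_def frag_dim_add)
  qed
qed

lemma relation_if_frag_dim_zero:
  assumes "c \<in> carrier (free_on_modules V leq)" "\<And>x. x \<in> V \<Longrightarrow> frag_dim x c = 0"
  shows "c \<in> exact_relations V leq"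
  using frag_eq_simples[OF assms(1)] assms(2) by simp

lemma comm_group_K0: "comm_group (K0 V leq)"
  unfolding K0_def by (rule comm_group.abelian_FactGroup[OF comm_group_free_on_modules subgroup_exact_relations])

lemma carrier_K0:
  "carrier (K0 V leq) =
    (\<lambda>c. exact_relations V leq #>\<^bsub>free_on_modules V leq\<^esub> c) ` carrier (free_on_modules V leq)"
  unfolding K0_def by (rule carrier_FactGroup)

lemma mult_K0:
  assumes "a \<in> carrier (free_on_modules V leq)" "b \<in> carrier (free_on_modules V leq)"
  shows "(exact_relations V leq #>\<^bsub>free_on_modules V leq\<^esub> a) \<otimes>\<^bsub>K0 V leq\<^esub>
      (exact_relations V leq #>\<^bsub>free_on_modules V leq\<^esub> b) =
    exact_relations V leq #>\<^bsub>free_on_modules V leq\<^esub> (a + b)"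
  unfolding K0_def mult_FactGroup
  using normal.rcos_sum[OF comm_group.subgroup_imp_normal[OF comm_group_free_on_modules
    subgroup_exact_relations] assms] by (simp add: free_on_modules_def)

lemma K0_dim_coset:
  assumes "x \<in> V"
  shows "K0_dim x (exact_relations V leq #>\<^bsub>free_on_modules V leq\<^esub> c) = frag_dim x c"
proof -
  let ?C = "exact_relations V leq #>\<^bsub>free_on_modules V leq\<^esub> c"
  have C: "?C = (\<lambda>r. r + c) ` exact_relations V leq"
    by (auto simp: r_coset_def free_on_modules_def)
  have "c \<in> ?C" unfolding C using relations_zero by (auto intro: image_eqI[of _ _ 0])
  then have "(SOME c. c \<in> ?C) \<in> ?C" by (rule someI)
  then obtain r where "r \<in> exact_relations V leq" "(SOME c. c \<in> ?C) = r + c" unfolding C by blast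
  then show ?thesis using frag_dim_relation[OF _ assms] by (simp add: K0_dim_def frag_dim_add)
qed

lemma K0_class_closed: "hasse_module V leq M \<Longrightarrow> K0_class V leq M \<in> carrier (K0 V leq)"
  unfolding carrier_K0 K0_class_def by (rule imageI) (simp add: carrier_free_on_modules)

lemma K0_dim_class: "x \<in> V \<Longrightarrow> K0_dim x (K0_class V leq M) = int (qdim M x)"
  by (simp add: K0_class_def K0_dim_coset frag_dim_of)

lemma K0_coordinates:
  assumes "distinct xs" "set xs = V"
  shows "group_coordinates (K0 V leq :: ('v, 'k::field) qrep_K0 monoid) (length xs) (\<lambda>i. K0_dim (xs ! i))"
proof (rule group_coordinates.intro[OF comm_group_K0], unfold_locales)
  let ?F = "free_on_modules V leq :: (('v, 'k) qrep \<Rightarrow>\<^sub>0 int) monoid"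
  let ?R = "exact_relations V leq :: (('v, 'k) qrep \<Rightarrow>\<^sub>0 int) set"
  have xs: "xs ! i \<in> V" if "i < length xs" for i using that assms(2) by auto
  have add: "a + b \<in> carrier ?F" if "a \<in> carrier ?F" "b \<in> carrier ?F" for a b
    using that keys_add[of a b] unfolding carrier_free_on_modules by blast
  fix i and C D :: "('v, 'k) qrep_K0"
  assume C: "C \<in> carrier (K0 V leq)" and D: "D \<in> carrier (K0 V leq)"
  obtain a b where ab: "a \<in> carrier ?F" "C = ?R #>\<^bsub>?F\<^esub> a" "b \<in> carrier ?F" "D = ?R #>\<^bsub>?F\<^esub> b"
    using C D unfolding carrier_K0 by blast
  show "K0_dim (xs ! i) (C \<otimes>\<^bsub>K0 V leq\<^esub> D) = K0_dim (xs ! i) C + K0_dim (xs ! i) D" if "i < length xs"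
    unfolding ab(2,4) mult_K0[OF ab(1,3)] K0_dim_coset[OF xs[OF that]] by (rule frag_dim_add)
  assume eq: "\<And>i. i < length xs \<Longrightarrow> K0_dim (xs ! i) C = K0_dim (xs ! i) D"
  have "a - b \<in> ?R"
  proof (rule relation_if_frag_dim_zero)
    show "a - b \<in> carrier ?F" using ab(1,3) keys_diff[of a b] unfolding carrier_free_on_modules by blast
    fix x assume x: "x \<in> V"
    then obtain i where i: "i < length xs" "x = xs ! i" using assms(2) by (metis in_set_conv_nth)
    show "frag_dim x (a - b) = 0"
      using eq[OF i(1)] unfolding ab(2,4) K0_dim_coset[OF xs[OF i(1)]] by (simp add: frag_dim_diff i(2))
  qed
  then have "a \<in> ?R #>\<^bsub>?F\<^esub> b" by (force simp: r_coset_def free_on_modules_def)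
  then show "C = D"
    unfolding ab(2,4)
    by (rule group.repr_independence[OF comm_group.axioms(2)[OF comm_group_free_on_modules] _ ab(3)
      subgroup_exact_relations, symmetric])
next
  fix v :: "nat \<Rightarrow> int"
  let ?F = "free_on_modules V leq :: (('v, 'k) qrep \<Rightarrow>\<^sub>0 int) monoid"
  let ?c = "\<Sum>j<length xs. frag_cmul (v j) (frag_of (simple (xs ! j))) :: ('v, 'k) qrep \<Rightarrow>\<^sub>0 int"
  have "?c \<in> carrier ?F"
    unfolding free_on_modules_def
  proof (rule sum_closed_free_Abelian_group)
    fix j assume "j \<in> {..<length xs}"
    then have "xs ! j \<in> V" using assms(2) nth_mem by blast
    from hasse_module_simple[OF this, where 'k = 'k]
    show "frag_cmul (v j) (frag_of (simple (xs ! j) :: ('v, 'k) qrep)) \<in>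
        carrier (free_Abelian_group {M. hasse_module V leq M})"
      using keys_cmul[of "v j" "frag_of (simple (xs ! j) :: ('v, 'k) qrep)"] by auto
  qed
  moreover have "K0_dim (xs ! i) (exact_relations V leq #>\<^bsub>?F\<^esub> ?c) = v i" if i: "i < length xs" for i
  proof -
    have "frag_dim (xs ! i) ?c = (\<Sum>j<length xs. if j = i then v i else 0)"
      unfolding frag_dim_sum[OF finite_lessThan]
      by (rule sum.cong) (use i assms(1) in \<open>auto simp: frag_dim_cmul frag_dim_of qdim_thin nth_eq_iff_index_eq\<close>)
    moreover have "xs ! i \<in> V" using nth_mem[OF i] assms(2) by blast
    ultimately show ?thesis using i by (simp add: K0_dim_coset)
  qed
  ultimately show "\<exists>x\<in>carrier (K0 V leq :: ('v, 'k) qrep_K0 monoid). \<forall>i<length xs. K0_dim (xs ! i) x = v i"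
    unfolding carrier_K0 by blast
qed

lemma zeta_matrix_inverse:
  assumes "distinct xs" "set xs = V"
  defines "c \<equiv> length xs"
  defines "Z \<equiv> mat c c (\<lambda>(i, j). if leq (xs ! i) (xs ! j) then 1 else 0 :: int)"
  shows "\<exists>Y\<in>carrier_mat c c. Z * Y = 1\<^sub>m c"
proof -
  have "\<forall>x\<in>V. \<exists>a :: 'v \<Rightarrow> int. \<forall>w\<in>V. (\<Sum>u\<in>V. if leq w u then a u else 0) = (if w = x then 1 else 0)"
    using zeta_unit_vector by blast
  from bchoice[OF this] obtain A :: "'v \<Rightarrow> 'v \<Rightarrow> int" where
    A: "\<And>x w. x \<in> V \<Longrightarrow> w \<in> V \<Longrightarrow> (\<Sum>u\<in>V. if leq w u then A x u else 0) = (if w = x then 1 else 0)"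
    by blast
  let ?Y = "mat c c (\<lambda>(i, j). A (xs ! j) (xs ! i))"
  have "Z * ?Y = 1\<^sub>m c"
  proof (rule eq_matI)
    fix i j assume "i < dim_row (1\<^sub>m c :: int mat)" "j < dim_col (1\<^sub>m c :: int mat)"
    then have ij: "i < c" "j < c" by simp_all
    then have V: "xs ! i \<in> V" "xs ! j \<in> V" using assms(2) by (auto simp: c_def)
    have "(Z * ?Y) $$ (i, j) = (\<Sum>k<c. if leq (xs ! i) (xs ! k) then A (xs ! j) (xs ! k) else 0)"
      using ij by (simp add: Z_def scalar_prod_def atLeast0LessThan) (rule sum.cong, auto)
    also have "\<dots> = (\<Sum>u\<in>V. if leq (xs ! i) u then A (xs ! j) u else 0)"
      by (rule sum.reindex_bij_betw) (use bij_betw_nth[OF assms(1), of "{..<c}" V] assms(2) in \<open>simp add: c_def\<close>)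
    also have "\<dots> = (if xs ! i = xs ! j then 1 else 0)" by (rule A[OF V(2,1)])
    finally show "(Z * ?Y) $$ (i, j) = 1\<^sub>m c $$ (i, j)"
      using ij assms(1) by (simp add: nth_eq_iff_index_eq c_def)
  qed (simp_all add: Z_def)
  then show ?thesis by (intro bexI[of _ ?Y]) auto
qed

text \<open>In coordinates the condition on the Coxeter transformation says that
  \<open>M * Z\<close> is minus the transpose of \<open>Z\<close>. As \<open>Z\<close> is invertible
  over the integers, exactly one \<open>M\<close> satisfies it, which gives the definite description
  its meaning.\<close>

lemma coxeter_char_poly:
  assumes xs: "distinct xs" "set xs = V"
  defines "c \<equiv> length xs"
  defines "Z \<equiv> mat c c (\<lambda>(i, j). if leq (xs ! i) (xs ! j) then 1 else 0 :: int)"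
  shows "\<exists>M Y. M \<in> carrier_mat c c \<and> M * Z = - transpose_mat Z \<and> Y \<in> carrier_mat c c \<and> Z * Y = 1\<^sub>m c \<and>
    endo_char_poly (K0 V leq) (coxeter_transformation V leq :: ('v, 'k::field) qrep_K0 \<Rightarrow> _) = char_poly M"
proof -
  let ?K = "K0 V leq :: ('v, 'k) qrep_K0 monoid"
  let ?\<delta> = "\<lambda>i. K0_dim (xs ! i) :: ('v, 'k) qrep_K0 \<Rightarrow> int"
  interpret group_coordinates ?K c ?\<delta> unfolding c_def by (rule K0_coordinates[OF xs])
  obtain Y where Y: "Y \<in> carrier_mat c c" "Z * Y = 1\<^sub>m c"
    using zeta_matrix_inverse[OF xs] unfolding Z_def c_def by blast
  have Z: "Z \<in> carrier_mat c c" by (simp add: Z_def)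
  have YZ: "Y * Z = 1\<^sub>m c" by (rule int_mat_left_inverse[OF Z Y])
  have Zt: "- transpose_mat Z \<in> carrier_mat c c" using Z by simp
  define M where "M = - transpose_mat Z * Y"
  have M: "M \<in> carrier_mat c c" using Zt Y(1) unfolding M_def by (rule mult_carrier_mat)
  have MZ: "M * Z = - transpose_mat Z"
    unfolding M_def assoc_mult_mat[OF Zt Y(1) Z] YZ using Zt by (rule right_mult_one_mat)
  have assoc: "(\<Sum>k<c. (A * B) $$ (i, k) * d k) = (\<Sum>j<c. A $$ (i, j) * (\<Sum>k<c. B $$ (j, k) * d k))"
    if "A \<in> carrier_mat c c" "B \<in> carrier_mat c c" "i < c" for A B :: "int mat" and d i
  proof -
    have "(\<Sum>k<c. (A * B) $$ (i, k) * d k) = (\<Sum>k<c. \<Sum>j<c. A $$ (i, j) * (B $$ (j, k) * d k))"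
      using that by (intro sum.cong) (auto simp: scalar_prod_def atLeast0LessThan sum_distrib_right mult.assoc)
    also have "\<dots> = (\<Sum>j<c. \<Sum>k<c. A $$ (i, j) * (B $$ (j, k) * d k))" by (rule sum.swap)
    finally show ?thesis by (simp add: sum_distrib_left)
  qed
  define P where "P j = K0_class V leq (projective_module V leq (xs ! j) :: ('v, 'k) qrep)" for j
  define I where "I j = K0_class V leq (injective_module V leq (xs ! j) :: ('v, 'k) qrep)" for j
  have V: "xs ! i \<in> V" if "i < c" for i using that xs(2) by (auto simp: c_def)
  have Pc: "P j \<in> carrier ?K" and Ic: "I j \<in> carrier ?K" if "j < c" for j
    unfolding P_def I_def projective_module_def injective_module_def
    by (intro K0_class_closed hasse_module_thin, use V[OF that] in \<open>blast intro: leq_trans\<close>)+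
  have dP: "?\<delta> i (P j) = Z $$ (i, j)" if "i < c" "j < c" for i j
    using that V by (simp add: P_def K0_dim_class projective_module_def qdim_thin Z_def)
  have dI: "?\<delta> i (I j) = Z $$ (j, i)" if "i < c" "j < c" for i j
    using that V by (simp add: I_def K0_dim_class injective_module_def qdim_thin Z_def)
  have dinv: "?\<delta> i (inv\<^bsub>?K\<^esub> I j) = - Z $$ (j, i)" if "i < c" "j < c" for i j
    using additive_functional(2)[of "?\<delta> i", OF coord_mult[OF that(1)] Ic[OF that(2)]] dI[OF that] by simp
  define is_cox where "is_cox \<theta> \<longleftrightarrow> \<theta> \<in> hom ?K ?K \<and> \<theta> \<in> extensional (carrier ?K) \<and>
    (\<forall>x\<in>V. \<theta> (K0_class V leq (projective_module V leq x)) =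
      inv\<^bsub>?K\<^esub> K0_class V leq (injective_module V leq x))" for \<theta>
  have cox_closed: "\<theta> g \<in> carrier ?K" if "is_cox \<theta>" "g \<in> carrier ?K" for \<theta> g
    using hom_in_carrier[of \<theta> ?K ?K g] that by (simp add: is_cox_def)
  have is_coxD: "?\<delta> i (\<theta> g) = (\<Sum>k<c. M $$ (i, k) * ?\<delta> k g)"
    if \<theta>: "is_cox \<theta>" and g: "g \<in> carrier ?K" and i: "i < c" for \<theta> g i
  proof -
    \<comment> \<open>The coordinates of \<open>g\<close> in the basis of projectives, computed with
      the inverse \<open>Y\<close> of \<open>Z\<close>.\<close>
    define a where "a j = (\<Sum>k<c. Y $$ (j, k) * ?\<delta> k g)" for j
    let ?g = "finprod ?K (\<lambda>j. P j [^]\<^bsub>?K\<^esub> a j) {..<c}"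
    have "g = ?g"
    proof (rule coord_eqI[OF g])
      show "?g \<in> carrier ?K" using Pc by (intro finprod_closed) auto
      fix l assume l: "l < c"
      have "?\<delta> l ?g = (\<Sum>j<c. a j * ?\<delta> l (P j))" by (rule coord_finprod) (use l Pc in auto)
      also have "\<dots> = (\<Sum>j<c. Z $$ (l, j) * a j)" by (rule sum.cong) (use dP l in \<open>auto simp: mult.commute\<close>)
      also have "\<dots> = (\<Sum>k<c. (Z * Y) $$ (l, k) * ?\<delta> k g)" unfolding a_def by (rule assoc[OF Z Y(1) l, symmetric])
      also have "\<dots> = (\<Sum>k<c. if k = l then ?\<delta> l g else 0)" unfolding Y(2) by (rule sum.cong) (use l in auto)
      finally show "?\<delta> l g = ?\<delta> l ?g" using l by simp
    qed
    then have "?\<delta> i (\<theta> g) = ?\<delta> i (\<theta> ?g)" by simp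
    also have "\<dots> = (\<Sum>j<c. a j * ?\<delta> i (\<theta> (P j)))"
    proof (rule additive_functional(4))
      fix x y assume "x \<in> carrier ?K" "y \<in> carrier ?K"
      then show "?\<delta> i (\<theta> (x \<otimes>\<^bsub>?K\<^esub> y)) = ?\<delta> i (\<theta> x) + ?\<delta> i (\<theta> y)"
        using coord_mult[OF i] cox_closed[OF \<theta>] hom_mult[of \<theta> ?K ?K x y] \<theta> unfolding is_cox_def by simp
    qed (use Pc in auto)
    also have "\<dots> = (\<Sum>j<c. (- transpose_mat Z) $$ (i, j) * a j)"
    proof (rule sum.cong)
      fix j assume "j \<in> {..<c}"
      then have j: "j < c" by simp
      have "\<theta> (P j) = inv\<^bsub>?K\<^esub> I j" using \<theta> V[OF j] unfolding is_cox_def P_def I_def by blast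
      then show "a j * ?\<delta> i (\<theta> (P j)) = (- transpose_mat Z) $$ (i, j) * a j"
        using dinv[OF i j] i j Z by simp
    qed simp
    also have "\<dots> = (\<Sum>k<c. M $$ (i, k) * ?\<delta> k g)"
      unfolding a_def M_def by (rule assoc[OF Zt Y(1) i, symmetric])
    finally show ?thesis .
  qed
  have "\<forall>g. \<exists>h. h \<in> carrier ?K \<and> (\<forall>i<c. ?\<delta> i h = (\<Sum>k<c. M $$ (i, k) * ?\<delta> k g))"
    using coord_surj[of "\<lambda>i. \<Sum>k<c. M $$ (i, k) * ?\<delta> k g" for g] by blast
  from choice[OF this] obtain h where
    h: "\<And>g. h g \<in> carrier ?K" "\<And>g i. i < c \<Longrightarrow> ?\<delta> i (h g) = (\<Sum>k<c. M $$ (i, k) * ?\<delta> k g)" by blast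
  have cox_h: "is_cox (restrict h (carrier ?K))"
    unfolding is_cox_def
  proof (intro conjI ballI homI)
    fix x y assume xy: "x \<in> carrier ?K" "y \<in> carrier ?K"
    have "h (x \<otimes>\<^bsub>?K\<^esub> y) = h x \<otimes>\<^bsub>?K\<^esub> h y"
      by (rule coord_eqI) (use h xy in \<open>auto simp: coord_mult sum.distrib distrib_left\<close>)
    then show "restrict h (carrier ?K) (x \<otimes>\<^bsub>?K\<^esub> y) =
        restrict h (carrier ?K) x \<otimes>\<^bsub>?K\<^esub> restrict h (carrier ?K) y" using xy by simp
  next
    fix x assume "x \<in> V"
    then obtain j where j: "j < c" "x = xs ! j" using xs(2) unfolding c_def by (metis in_set_conv_nth)
    have "h (P j) = inv\<^bsub>?K\<^esub> I j"
    proof (rule coord_eqI)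
      show "inv\<^bsub>?K\<^esub> I j \<in> carrier ?K" using Ic[OF j(1)] by simp
      fix i assume i: "i < c"
      have "?\<delta> i (h (P j)) = (\<Sum>k<c. M $$ (i, k) * Z $$ (k, j))"
        unfolding h(2)[OF i] by (rule sum.cong) (use dP j in auto)
      also have "\<dots> = (M * Z) $$ (i, j)"
        using i j M Z by (simp add: scalar_prod_def atLeast0LessThan)
      finally show "?\<delta> i (h (P j)) = ?\<delta> i (inv\<^bsub>?K\<^esub> I j)"
        unfolding MZ dinv[OF i j(1)] using i j(1) Z by simp
    qed (rule h(1))
    then show "restrict h (carrier ?K) (K0_class V leq (projective_module V leq x)) =
        inv\<^bsub>?K\<^esub> K0_class V leq (injective_module V leq x)"
      using Pc[OF j(1)] unfolding P_def I_def j(2) by simp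
  qed (use h(1) in auto)
  have uniq: "\<theta> = restrict h (carrier ?K)" if \<theta>: "is_cox \<theta>" for \<theta>
  proof (rule extensionalityI)
    fix g assume g: "g \<in> carrier ?K"
    show "\<theta> g = restrict h (carrier ?K) g"
    proof (rule coord_eqI)
      show "\<theta> g \<in> carrier ?K" by (rule cox_closed[OF \<theta> g])
      show "restrict h (carrier ?K) g \<in> carrier ?K" using h g by simp
      show "?\<delta> i (\<theta> g) = ?\<delta> i (restrict h (carrier ?K) g)" if "i < c" for i
        unfolding is_coxD[OF \<theta> g that] is_coxD[OF cox_h g that] ..
    qed
  qed (use \<theta> in \<open>auto simp: is_cox_def\<close>)
  have "coxeter_transformation V leq = restrict h (carrier ?K)"
    unfolding coxeter_transformation_def is_cox_def[symmetric] by (rule the_equality[of is_cox, OF cox_h uniq])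
  then have "is_cox (coxeter_transformation V leq)" using cox_h by simp
  then have "endo_char_poly ?K (coxeter_transformation V leq) = char_poly M"
    by (intro endo_char_poly_eq[OF M]) (auto simp: is_coxD cox_closed)
  then show ?thesis using M MZ Y by blast
qed

end

section \<open>The Tamari order is a partial order\<close>

text \<open>The number of pairs of a node and a node in its right subtree. A root move on
  \<open>A (B C)\<close> lowers it by one more than the size of \<open>C\<close>, so moves never
  cycle and the order is antisymmetric.\<close>

fun right_weight :: "pbtree \<Rightarrow> nat" where
  "right_weight Triv = 0"
| "right_weight (Graft l r) = right_weight l + right_weight r + internal r"

lemma tamari_move_right_weight: "tamari_move t u \<Longrightarrow> right_weight u < right_weight t"
proof (induction rule: tamari_move.induct)
  case (right r r' l)
  have "tamari_le r' r" using right by (auto simp: tamari_le_def)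
  from tamari_le_internal[OF this] right show ?case by simp
qed simp_all

lemma tamari_le_antisym:
  assumes "tamari_le x y" "tamari_le y x"
  shows "x = y"
proof -
  have "a = b \<or> right_weight a < right_weight b" if "tamari_le a b" for a b
    using that unfolding tamari_le_def
    by (induction rule: rtranclp_induct) (auto dest: tamari_move_right_weight)
  from this[OF assms(1)] this[OF assms(2)] show ?thesis by auto
qed

lemma finite_poset_tamari: "finite_poset (Yset n) tamari_le"
  by unfold_locales (blast intro: finite_Yset tamari_le_refl tamari_le_antisym tamari_le_trans)+

section \<open>The characteristic polynomial\<close>

theorem mainTheorem2:
  fixes n :: nat
  shows "to_fract (endo_char_poly (K0 (Yset n) tamari_le)
           (coxeter_transformation (Yset n) tamari_le ::
              (pbtree, 'k::field) qrep_K0 \<Rightarrow> (pbtree, 'k) qrep_K0)) =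
         to_fract (monom 1 (2 * n + 2) - 1) ^ catalan n /
         (\<Prod>d | d dvd 2 * n + 2.
            to_fract (monom 1 d - [:(- 1) ^ (d * (n + 1)):]) powi bnum d)
           powi ((- 1) ^ (n + 1))"
proof -
  obtain xs where xs: "distinct xs" "set xs = Yset n" using finite_distinct_list[OF finite_Yset] by blast
  define c where "c = length xs"
  have c: "c = catalan n" using distinct_card[OF xs(1)] card_Yset by (simp add: c_def xs(2))
  define Z where "Z = mat c c (\<lambda>(i, j). if tamari_le (xs ! i) (xs ! j) then 1 else 0 :: int)"
  have "\<exists>M Y. M \<in> carrier_mat c c \<and> M * Z = - transpose_mat Z \<and> Y \<in> carrier_mat c c \<and> Z * Y = 1\<^sub>m c \<and>
      endo_char_poly (K0 (Yset n) tamari_le)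
        (coxeter_transformation (Yset n) tamari_le :: (pbtree, 'k) qrep_K0 \<Rightarrow> _) = char_poly M"
    unfolding Z_def c_def by (rule finite_poset.coxeter_char_poly[OF finite_poset_tamari xs])
  then obtain M Y where M: "M \<in> carrier_mat c c" "M * Z = - transpose_mat Z"
    and Y: "Y \<in> carrier_mat c c" "Z * Y = 1\<^sub>m c"
    and P: "endo_char_poly (K0 (Yset n) tamari_le)
      (coxeter_transformation (Yset n) tamari_le :: (pbtree, 'k) qrep_K0 \<Rightarrow> _) = char_poly M"
    by blast
  have monic: "lead_coeff (char_poly M) = 1" using degree_monic_char_poly[OF M(1)] by simp
  have sums: "(\<Sum>a\<in>#proots (of_int_poly (char_poly M) :: complex poly). a ^ k) =
      of_int ((if 2 * n + 2 dvd k then int (2 * n + 2) * int (catalan n) else 0) +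
        (-1) ^ n * (-1) ^ (k * (n + 1)) * lam (gcd k (2 * n + 2)))" for k
  proof -
    let ?M = "map_mat of_int M :: complex mat"
    have "(\<Sum>a\<in>#proots (of_int_poly (char_poly M) :: complex poly). a ^ k) = mtrace (?M ^\<^sub>m k)"
      using mtrace_pow_eq_power_sum[of ?M c k] M(1) by (simp add: of_int_hom.char_poly_hom[OF M(1)])
    also have "\<dots> = of_int (mtrace (M ^\<^sub>m k))"
      unfolding of_int_hom.mat_hom_pow[OF M(1), symmetric]
      using pow_carrier_mat[OF M(1), of k] M(1) by (simp add: mtrace_def)
    also have "mtrace (M ^\<^sub>m k) = (-1) ^ (k * (n + 1)) * frag_trace (dyck ` Yset n) (rot ^^ k)"
      by (rule trace_coxeter_matrix[OF xs M(1)[unfolded c_def] M(2)[unfolded Z_def c_def]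
        Y(1)[unfolded c_def] Y(2)[unfolded Z_def c_def]])
    finally show ?thesis unfolding trace_rot .
  qed
  have pow: "to_fract (x ^ j) = to_fract x ^ j" for x :: "int poly" and j by (induction j) simp_all
  show ?thesis
    unfolding P pow[symmetric]
  proof (rule fract_eq_of_poly_eq)
    show "finite {d. d dvd 2 * n + 2}" by simp
    show "monom 1 d - [:(- 1) ^ (d * (n + 1)):] \<noteq> (0 :: int poly)" if "d \<in> {d. d dvd 2 * n + 2}" for d
    proof -
      have "0 < d" using that by (auto intro: Nat.gr0I)
      from monic_monom_diff[OF this, of "(- 1) ^ (d * (n + 1)) :: int"] show ?thesis
        by (metis leading_coeff_0_iff zero_neq_one)
    qed
    show "(- 1) ^ (n + 1) = (1 :: int) \<or> (- 1) ^ (n + 1) = (- 1 :: int)"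
      by (cases "even n") simp_all
    show "char_poly M * (\<Prod>d | d dvd 2 * n + 2.
          (monom 1 d - [:(- 1) ^ (d * (n + 1)):]) ^ nat ((- 1) ^ (n + 1) * bnum d)) =
        (monom 1 (2 * n + 2) - 1) ^ catalan n * (\<Prod>d | d dvd 2 * n + 2.
          (monom 1 d - [:(- 1) ^ (d * (n + 1)):]) ^ nat (- ((- 1) ^ (n + 1) * bnum d)))"
      by (rule poly_eq_of_power_sums[OF monic sums])
  qed
qed

end
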